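(* For every graph $H$, we have $c_H(\gamma)\geq \gamma^{1/2+o(1)}$, where the $o(1)$ in the exponent denotes a quantity tending to $0$ as $\gamma\to 0$. More precisely, if $H$ has $h$ vertices and $N$ is sufficiently large with respect to $\gamma$, then every $N$-vertex graph with at least $\gamma N^h$ copies of $H$ contains an $H$-blowup $H[t]$, where $$t \geq \frac{\delta_H\sqrt{\gamma}}{(\log \frac 1\gamma)^2}\,\log N$$ and $\delta_H>0$ is a constant depending only on $H$.
   Context: Here $\gamma>0$, and all logarithms are to base $2$. For a graph $H$ and an integer $t$, the $t$-blowup $H[t]$ is the graph obtained from $H$ by replacing every vertex by an independent set of order $t$ and every edge by a complete bipartite graph between the two corresponding independent sets. A copy of $H$ in $G$ is a (not necessarily induced) subgraph of $G$ isomorphic to $H$. For an $h$-vertex graph $H$ and $\gamma>0$, $c_H(\gamma)$ denotes the supremum over all $c>0$ such that every $N$-vertex graph with at least $\gamma N^h$ copies of $H$ contains an $H$-blowup $H[t]$ of size $t\ge(c-o(1))\log N$, where this $o(1)$ tends to $0$ as $N\to\infty$.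
   Formalization: In the quantitative part, γ ranges over (0, γ₀] for an arbitrary cutoff γ₀ < 1, and δ depends on H and γ₀; a single δ_H for all γ < 1 fails as γ → 1 (asymmetric H, very dense random graphs), and the bound is undefined at γ = 1. Graphs G have natural-number vertices. *)

theory Defs
  imports
    Complex_Main
    "HOL-Library.Extended_Real"
    "Graph_Theory.Pair_Digraph"
    "Graph_Theory.Digraph_Isomorphism"
begin

text \<open>
  Finite simple graphs are the \<^locale>\<open>pair_graph\<close>s: finite, loopfree, symmetric digraphs whose
  arcs are pairs of vertices, every edge being present in both directions.
\<close>

definition blowup :: "'a pair_pre_digraph \<Rightarrow> nat \<Rightarrow> ('a \<times> nat) pair_pre_digraph" where
  "blowup H t = \<lparr> pverts = pverts H \<times> {..<t},
     parcs = {((u, i), (v, j)) | u v i j. (u, v) \<in> parcs H \<and> i < t \<and> j < t} \<rparr>"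

text \<open>
  Copies are subgraphs, not embeddings: each subgraph of \<open>G\<close> isomorphic to \<open>H\<close> counts once,
  irrespective of the number of automorphisms of \<open>H\<close>. Subgraphs need not be induced.
\<close>

definition copies :: "'a pair_pre_digraph \<Rightarrow> 'b pair_pre_digraph \<Rightarrow> 'b pair_pre_digraph set" where
  "copies H G = {S. subgraph (with_proj S) (with_proj G) \<and> digraph_iso (with_proj H) (with_proj S)}"

definition contains_copy :: "'b pair_pre_digraph \<Rightarrow> 'a pair_pre_digraph \<Rightarrow> bool" where
  "contains_copy G H \<longleftrightarrow> copies H G \<noteq> {}"

text \<open>
  The host graphs have vertices in \<^typ>\<open>nat\<close>; up to isomorphism these are all finite graphs.
\<close>

definition many_copies :: "'a pair_pre_digraph \<Rightarrow> real \<Rightarrow> nat \<Rightarrow> nat pair_pre_digraph \<Rightarrow> bool" where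
  "many_copies H \<gamma> N G \<longleftrightarrow> pair_graph G \<and> card (pverts G) = N \<and>
     real (card (copies H G)) \<ge> \<gamma> * real N ^ card (pverts H)"

definition forces_blowup :: "'a pair_pre_digraph \<Rightarrow> real \<Rightarrow> real \<Rightarrow> bool" where
  "forces_blowup H \<gamma> c \<longleftrightarrow> (\<exists>\<epsilon> :: nat \<Rightarrow> real. \<epsilon> \<longlonglongrightarrow> 0 \<and>
     (\<forall>N G. many_copies H \<gamma> N G \<longrightarrow>
        (\<exists>t. real t \<ge> (c - \<epsilon> N) * log 2 (real N) \<and> contains_copy G (blowup H t))))"

text \<open>
  The supremum may be infinite, e.g. if \<open>H\<close> has no edges, or if \<open>\<gamma>\<close> is so large that no large
  graph has the required number of copies.
\<close>

definition blowup_const :: "'a pair_pre_digraph \<Rightarrow> real \<Rightarrow> ereal" where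
  "blowup_const H \<gamma> = (SUP c \<in> {c. c > 0 \<and> forces_blowup H \<gamma> c}. ereal c)"

lemma pair_graph_blowup:
  assumes "pair_graph H"
  shows "pair_graph (blowup H t)"
proof -
  interpret pair_graph H by fact
  have sub: "parcs (blowup H t) \<subseteq> pverts (blowup H t) \<times> pverts (blowup H t)"
    by (auto simp: blowup_def dest: in_arcsD1 in_arcsD2)
  have fin: "finite (pverts (blowup H t))"
    by (simp add: blowup_def)
  have sym: "sym (parcs (blowup H t))"
    by (auto simp: blowup_def intro!: symI dest: arcs_symmetric)
  show ?thesis
    using sub fin sym finite_subset[OF sub]
    by unfold_locales (auto simp: symmetric_def, auto simp: blowup_def dest: no_loops')
qed

lemma digraph_iso_with_proj_iff:
  assumes "pair_wf_digraph H"
  shows "digraph_iso (with_proj H) (with_proj S) \<longleftrightarrow>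
    (\<exists>f. inj_on f (pverts H) \<and> pverts S = f ` pverts H \<and> parcs S = map_prod f f ` parcs H)"
proof -
  interpret pair_wf_digraph H by fact
  show ?thesis
  proof
    assume "digraph_iso (with_proj H) (with_proj S)"
    then obtain g where g: "pre_digraph.digraph_isomorphism (with_proj H) g"
      and S: "with_proj S = app_iso g (with_proj H)"
      by (auto simp: digraph_iso_def)
    let ?f = "iso_verts g"
    have tl: "iso_tail g = fst" and hd: "iso_head g = snd"
      and vs: "pverts S = ?f ` pverts H" and as: "parcs S = iso_arcs g ` parcs H"
      using S by (simp_all add: with_proj_def app_iso_def)
    have "iso_arcs g a = map_prod ?f ?f a" if "a \<in> parcs H" for a
      using g that tl hd
      by (auto simp: pre_digraph.digraph_isomorphism_def prod_eq_iff)
    then have "parcs S = map_prod ?f ?f ` parcs H"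
      unfolding as by (intro image_cong) auto
    with vs g show "\<exists>f. inj_on f (pverts H) \<and> pverts S = f ` pverts H
        \<and> parcs S = map_prod f f ` parcs H"
      by (auto simp: pre_digraph.digraph_isomorphism_def)
  next
    assume "\<exists>f. inj_on f (pverts H) \<and> pverts S = f ` pverts H
        \<and> parcs S = map_prod f f ` parcs H"
    then obtain f where f: "inj_on f (pverts H)" "pverts S = f ` pverts H"
        "parcs S = map_prod f f ` parcs H" by blast
    let ?g = "\<lparr> iso_verts = f, iso_arcs = map_prod f f, iso_head = snd, iso_tail = fst \<rparr>"
    have "inj_on (map_prod f f) (parcs H)"
      using f(1) unfolding inj_on_def by (auto; metis in_arcsD1 in_arcsD2)
    then have "pre_digraph.digraph_isomorphism (with_proj H) ?g"
      using f(1) wf_digraph_wp_iff[of H] assms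
      by (auto simp: pre_digraph.digraph_isomorphism_def)
    moreover have "with_proj S = app_iso ?g (with_proj H)"
      using f by (simp add: with_proj_def app_iso_def)
    ultimately show "digraph_iso (with_proj H) (with_proj S)"
      unfolding digraph_iso_def by blast
  qed
qed

end

theory Submission
  imports Defs "HOL-Library.FuncSet"
begin

text \<open>
  A copy of \<open>H\<close> is viewed as a tuple \<open>x\<close> of vertices of \<open>G\<close> all of whose pairs satisfy prescribed
  relations \<open>E j k (x j) (x k)\<close>. Among all boxes \<open>X\<^sub>0 \<times> X\<^sub>1 \<times> \<dots>\<close> of vertex sets, maximise the
  density of copies, divided by a tiny power of the pair densities and multiplied by a tiny power of
  the volume: in an optimal box all pairs are \<open>\<epsilon>\<close>-regular, the sides are still linear in \<open>N\<close>, and by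
  the counting lemma the pair densities \<open>p\<^sub>j\<^sub>k\<close> satisfy \<open>\<Prod> p\<^sub>j\<^sub>k \<ge> \<gamma> / 2 = s\<^sup>2\<close>.

  The parts of the blowup are then chosen one by one, each as a set of \<open>m\<close> (about \<open>log N\<close>) vertices
  having the same neighbours in the previously chosen parts. A part chosen at vertex \<open>j\<close> is later cut
  down to common neighbourhoods, which costs a factor \<open>\<Prod> p\<^sub>j\<^sub>k\<close> over the later vertices \<open>k\<close>. Since at
  most three vertices have \<open>\<Prod>\<^bsub>k\<noteq>j\<^esub> p\<^sub>j\<^sub>k < s\<close>, all other vertices are treated first at a cost of at most
  a factor \<open>s\<close>. For the last three vertices \<open>u\<close>, \<open>v\<close>, \<open>z\<close>, averaging arguments as in the
  Kovari-Sos-Turan theorem make the pairs \<open>uv\<close> and \<open>vz\<close> free of charge, and the order is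
  chosen such that \<open>p\<^sub>u\<^sub>z \<ge> s\<close>.
\<close>

section \<open>Counting in regular systems\<close>

text \<open>Cutting a part down is harmless only if the remaining tuples see a fixed proportion of
  it. Averaging guarantees this for a proportion of order \<open>s\<close> of the tuples, and this
  has to survive all later choices. So every stage carries a weight on the tuples still to be
  chosen, whose total stays above a constant depending only on \<gamma> and the number of vertices.
  The regularity parameter is fixed after this constant, and \<open>N\<close> last; the sides of the
  box are very small in terms of \<gamma>, but this only adds a constant to their logarithm.

  Each selection of \<open>m\<close> vertices divides a set of candidates by an \<open>m\<close>-th
  power. As long as the base of this power is polynomial in 1 / \<gamma>, \<open>m\<close> can be of
  order log N / log (1 / \<gamma>). This is the only logarithm lost, and it shapes the weights: a
  tuple that is kept must not lose more than a power of \<gamma>, while a tuple spoiling a single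
  part must fall below what is kept. The two powers in \<open>amp\<close> achieve both.\<close>

lemma sum_PiE_insert:
  fixes g :: "('i \<Rightarrow> 'v) \<Rightarrow> real"
  assumes "i \<notin> S"
  shows "(\<Sum>x\<in>PiE (insert i S) Y. g x) = (\<Sum>y\<in>Y i. \<Sum>x\<in>PiE S Y. g (x(i := y)))"
proof -
  have "(\<Sum>x\<in>PiE (insert i S) Y. g x) = (\<Sum>(y, x)\<in>Y i \<times> PiE S Y. g (x(i := y)))"
    unfolding PiE_insert_eq using inj_combinator[OF assms, of Y]
    by (subst sum.reindex) (auto simp: case_prod_unfold)
  then show ?thesis by (simp add: sum.cartesian_product)
qed

lemma sum_PiE_insert':
  fixes g :: "('i \<Rightarrow> 'v) \<Rightarrow> real"
  assumes "i \<notin> S"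
  shows "(\<Sum>x\<in>PiE (insert i S) Y. g x) = (\<Sum>x\<in>PiE S Y. \<Sum>y\<in>Y i. g (x(i := y)))"
  unfolding sum_PiE_insert[OF assms] by (rule sum.swap)

definition all_rel :: "('i \<Rightarrow> 'i \<Rightarrow> 'v \<Rightarrow> 'v \<Rightarrow> bool) \<Rightarrow> ('i \<times> 'i) set \<Rightarrow> ('i \<Rightarrow> 'v) \<Rightarrow> bool" where
  "all_rel E P x \<longleftrightarrow> (\<forall>(j, k)\<in>P. E j k (x j) (x k))"

definition pairs :: "'i::linorder set \<Rightarrow> ('i \<times> 'i) set" where
  "pairs S = {(j, k). j \<in> S \<and> k \<in> S \<and> j < k}"

lemma finite_pairs [simp]: "finite S \<Longrightarrow> finite (pairs S)"
  by (rule finite_subset[of _ "S \<times> S"]) (auto simp: pairs_def)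

lemma pairs_mono: "S \<subseteq> T \<Longrightarrow> pairs S \<subseteq> pairs T"
  by (auto simp: pairs_def)

text \<open>Regularity in its cut-norm form: the error is measured against the whole of
  \<open>X j\<close> and \<open>X k\<close>, so small \<open>A\<close> and \<open>B\<close> need no
  exception and errors add up. \<open>p j k\<close> may be any value for which the estimate
  holds.\<close>

locale regular_system =
  fixes S :: "'i::linorder set" and E :: "'i \<Rightarrow> 'i \<Rightarrow> 'v \<Rightarrow> 'v \<Rightarrow> bool"
    and X :: "'i \<Rightarrow> 'v set" and p :: "'i \<Rightarrow> 'i \<Rightarrow> real" and \<epsilon> :: real
  assumes finS: "finite S"
    and finX: "k \<in> S \<Longrightarrow> finite (X k)"
    and neX: "k \<in> S \<Longrightarrow> X k \<noteq> {}"
    and p_nonneg: "(j, k) \<in> pairs S \<Longrightarrow> 0 \<le> p j k"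
    and p_le_1: "(j, k) \<in> pairs S \<Longrightarrow> p j k \<le> 1"
    and \<epsilon>_nonneg: "0 \<le> \<epsilon>"
    and regular: "\<lbrakk>(j, k) \<in> pairs S; A \<subseteq> X j; B \<subseteq> X k\<rbrakk> \<Longrightarrow>
      \<bar>\<Sum>a\<in>A. \<Sum>b\<in>B. of_bool (E j k a b) - p j k\<bar> \<le> \<epsilon> * real (card (X j)) * real (card (X k))"
begin

definition pp :: "('i \<times> 'i) set \<Rightarrow> real" where
  "pp P = (\<Prod>(j, k)\<in>P. p j k)"

lemma pp_bounds: "P \<subseteq> pairs S \<Longrightarrow> 0 \<le> pp P \<and> pp P \<le> 1"
  unfolding pp_def by (intro conjI prod_nonneg prod_le_1) (auto simp: p_nonneg p_le_1 subset_iff)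

text \<open>Fix all coordinates except those of \<open>j\<close> and \<open>k\<close>. Since (j, k)
  is not in \<open>P\<close>, no relation of \<open>P\<close> involves both, so \<open>P\<close>
  cuts out a set \<open>A z\<close> for \<open>x j\<close> and independently a set
  \<open>B z\<close> for \<open>x k\<close>. Regularity applies to each such slice.\<close>

lemma counting_step:
  assumes T: "T \<subseteq> S" and P: "P \<subseteq> pairs T" and jk: "(j, k) \<in> pairs T" "(j, k) \<notin> P"
    and Y: "\<And>l. l \<in> T \<Longrightarrow> Y l \<subseteq> X l"
  shows "\<bar>\<Sum>x\<in>PiE T Y. (of_bool (E j k (x j) (x k)) - p j k) * of_bool (all_rel E P x)\<bar>
    \<le> \<epsilon> * (\<Prod>l\<in>T. real (card (X l)))"
proof -
  define T' where "T' = T - {j, k}"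
  have finT: "finite T" using T finS finite_subset by blast
  have jk': "j \<in> T" "k \<in> T" "j < k" using jk by (auto simp: pairs_def)
  have T_eq: "T = insert j (insert k T')" and ni: "j \<notin> insert k T'" "k \<notin> T'"
    using jk' by (auto simp: T'_def)
  define A where "A z = {a \<in> Y j. \<forall>(j', k')\<in>P. j' \<noteq> k \<and> k' \<noteq> k \<longrightarrow>
      E j' k' ((z(j := a)) j') ((z(j := a)) k')}" for z
  define B where "B z = {b \<in> Y k. \<forall>(j', k')\<in>P. j' \<noteq> j \<and> k' \<noteq> j \<longrightarrow>
      E j' k' ((z(k := b)) j') ((z(k := b)) k')}" for z
  have fY: "finite (Y j)" "finite (Y k)"
    using Y jk' T finX finite_subset by (metis subsetD)+
  have split: "all_rel E P (z(k := b, j := a)) \<longleftrightarrow> a \<in> A z \<and> b \<in> B z"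
    if "a \<in> Y j" "b \<in> Y k" for z a b
  proof -
    have both: "\<not> ((j' = j \<or> k' = j) \<and> (j' = k \<or> k' = k))" if "(j', k') \<in> P" for j' k'
      using that P jk(2) jk'(3) by (auto simp: pairs_def)
    define c where "c e \<longleftrightarrow> (case e of (j', k') \<Rightarrow> E j' k' ((z(k := b, j := a)) j') ((z(k := b, j := a)) k'))" for e
    define cA where "cA e \<longleftrightarrow> (case e of (j', k') \<Rightarrow> j' \<noteq> k \<and> k' \<noteq> k \<longrightarrow> E j' k' ((z(j := a)) j') ((z(j := a)) k'))" for e
    define cB where "cB e \<longleftrightarrow> (case e of (j', k') \<Rightarrow> j' \<noteq> j \<and> k' \<noteq> j \<longrightarrow> E j' k' ((z(k := b)) j') ((z(k := b)) k'))" for e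
    have "c e \<longleftrightarrow> cA e \<and> cB e" if "e \<in> P" for e
    proof -
      obtain j' k' where e: "e = (j', k')" by force
      show ?thesis
        using both[of j' k'] that jk'(3) unfolding c_def cA_def cB_def e by auto
    qed
    then have "(\<forall>e\<in>P. c e) \<longleftrightarrow> (\<forall>e\<in>P. cA e) \<and> (\<forall>e\<in>P. cB e)" by blast
    then have "all_rel E P (z(k := b, j := a)) \<longleftrightarrow>
       (\<forall>(j', k')\<in>P. j' \<noteq> k \<and> k' \<noteq> k \<longrightarrow> E j' k' ((z(j := a)) j') ((z(j := a)) k')) \<and>
       (\<forall>(j', k')\<in>P. j' \<noteq> j \<and> k' \<noteq> j \<longrightarrow> E j' k' ((z(k := b)) j') ((z(k := b)) k'))"
      unfolding all_rel_def c_def cA_def cB_def .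
    then show ?thesis using that by (simp add: A_def B_def)
  qed
  have inner: "\<bar>\<Sum>a\<in>Y j. \<Sum>b\<in>Y k. (of_bool (E j k a b) - p j k) * of_bool (a \<in> A z \<and> b \<in> B z)\<bar>
     \<le> \<epsilon> * real (card (X j)) * real (card (X k))" for z
  proof -
    have AB: "A z \<subseteq> Y j" "B z \<subseteq> Y k" by (auto simp: A_def B_def)
    have "(\<Sum>a\<in>Y j. \<Sum>b\<in>Y k. (of_bool (E j k a b) - p j k) * of_bool (a \<in> A z \<and> b \<in> B z))
      = (\<Sum>a\<in>Y j. if a \<in> A z then (\<Sum>b\<in>Y k. if b \<in> B z then of_bool (E j k a b) - p j k else 0) else 0)"
      by (intro sum.cong refl) (auto intro!: sum.cong)
    also have "\<dots> = (\<Sum>a\<in>A z. \<Sum>b\<in>B z. of_bool (E j k a b) - p j k)"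
      using AB fY by (simp add: sum.inter_restrict[symmetric] Int_absorb1)
    moreover have "(j, k) \<in> pairs S" using jk(1) pairs_mono[OF T] by blast
    moreover have "A z \<subseteq> X j" "B z \<subseteq> X k" using AB Y jk' by blast+
    ultimately show ?thesis using regular[of j k "A z" "B z"] by simp
  qed
  have "(\<Sum>x\<in>PiE T Y. (of_bool (E j k (x j) (x k)) - p j k) * of_bool (all_rel E P x))
    = (\<Sum>z\<in>PiE T' Y. \<Sum>a\<in>Y j. \<Sum>b\<in>Y k. (of_bool (E j k a b) - p j k) * of_bool (a \<in> A z \<and> b \<in> B z))"
    (is "_ = sum ?G _")
    unfolding T_eq sum_PiE_insert'[OF ni(1)] sum_PiE_insert'[OF ni(2)] 
    using jk'(3) by (subst sum.swap) (auto intro!: sum.cong simp: split)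
  also have "\<bar>\<dots>\<bar> \<le> (\<Sum>z\<in>PiE T' Y. \<epsilon> * real (card (X j)) * real (card (X k)))"
    by (rule order_trans[OF sum_abs]) (intro sum_mono inner)
  also have "\<dots> = \<epsilon> * real (card (X j)) * real (card (X k)) * (\<Prod>l\<in>T'. real (card (Y l)))"
    using finT by (simp add: T'_def card_PiE)
  also have "\<dots> \<le> \<epsilon> * real (card (X j)) * real (card (X k)) * (\<Prod>l\<in>T'. real (card (X l)))"
    using \<epsilon>_nonneg Y T finX
    by (intro mult_left_mono prod_mono) (auto simp: T'_def intro!: card_mono)
  also have "\<dots> = \<epsilon> * (\<Prod>l\<in>T. real (card (X l)))"
    using ni finT unfolding T_eq by simp
  finally show ?thesis .
qed

text \<open>Telescoping: the relations of \<open>P\<close> are replaced by their densities one at a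
  time, each at the price \<epsilon>. The sub-box \<open>Y\<close> is arbitrary, which is what later
  allows weights and exceptional sets.\<close>

lemma counting:
  assumes T: "T \<subseteq> S" and P: "P \<subseteq> pairs T"
    and Y: "\<And>l. l \<in> T \<Longrightarrow> Y l \<subseteq> X l"
  shows "\<bar>\<Sum>x\<in>PiE T Y. of_bool (all_rel E P x) - pp P\<bar>
    \<le> real (card P) * \<epsilon> * (\<Prod>l\<in>T. real (card (X l)))"
proof -
  have "finite P" using P T finS finite_subset by (metis finite_pairs)
  then show ?thesis using P
  proof (induction P rule: finite_induct)
    case empty
    then show ?case by (simp add: pp_def all_rel_def)
  next
    case (insert e P)
    obtain j k where e: "e = (j, k)" by force
    have IH: "\<bar>\<Sum>x\<in>PiE T Y. of_bool (all_rel E P x) - pp P\<bar>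
      \<le> real (card P) * \<epsilon> * (\<Prod>l\<in>T. real (card (X l)))" using insert by auto
    have st: "\<bar>\<Sum>x\<in>PiE T Y. (of_bool (E j k (x j) (x k)) - p j k) * of_bool (all_rel E P x)\<bar>
      \<le> \<epsilon> * (\<Prod>l\<in>T. real (card (X l)))"
      using insert by (intro counting_step[OF T]) (auto simp: e Y)
    have pjk: "0 \<le> p j k" "p j k \<le> 1" using insert.prems e pairs_mono[OF T] p_nonneg p_le_1 by auto
    have "(\<Sum>x\<in>PiE T Y. of_bool (all_rel E (insert e P) x) - pp (insert e P))
       = (\<Sum>x\<in>PiE T Y. (of_bool (E j k (x j) (x k)) - p j k) * of_bool (all_rel E P x))
         + p j k * (\<Sum>x\<in>PiE T Y. of_bool (all_rel E P x) - pp P)"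
      using insert.hyps unfolding sum_distrib_left sum.distrib[symmetric]
      by (intro sum.cong refl) (auto simp: pp_def e all_rel_def algebra_simps)
    also have "\<bar>\<dots>\<bar> \<le> \<epsilon> * (\<Prod>l\<in>T. real (card (X l))) + 1 * (real (card P) * \<epsilon> * (\<Prod>l\<in>T. real (card (X l))))"
      by (rule order_trans[OF abs_triangle_ineq], unfold abs_mult, intro add_mono mult_mono st IH)
         (use pjk in auto)
    finally show ?case using insert.hyps by (simp add: algebra_simps)
  qed
qed

text \<open>\<open>B\<close> bounds the sum of the absolute coefficients when \<open>f\<close> is
  written as a linear combination of indicators of boxes. The correlation of \<open>f\<close> with
  the edge relations is then at most \<open>B\<close> times that of a single box.\<close>

inductive box_comb :: "'i set \<Rightarrow> real \<Rightarrow> (('i \<Rightarrow> 'v) \<Rightarrow> real) \<Rightarrow> bool" for T where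
  box: "box_comb T 1 (\<lambda>x. of_bool (\<forall>k\<in>T. x k \<in> Y k))"
| lin: "box_comb T B f \<Longrightarrow> box_comb T C g \<Longrightarrow> \<bar>a\<bar> * B + \<bar>b\<bar> * C \<le> D \<Longrightarrow> box_comb T D (\<lambda>x. a * f x + b * g x)"

lemma box_comb_nonneg: "box_comb T B f \<Longrightarrow> 0 \<le> B"
proof (induction rule: box_comb.induct)
  case (lin B f C g a b D)
  have "0 \<le> \<bar>a\<bar> * B + \<bar>b\<bar> * C" using lin by auto
  with lin show ?case by linarith
qed auto

lemma box_comb_counting:
  assumes "box_comb T B f" and T: "T \<subseteq> S" and P: "P \<subseteq> pairs T"
    and Y: "\<And>l. l \<in> T \<Longrightarrow> Y l \<subseteq> X l"
  shows "\<bar>\<Sum>x\<in>PiE T Y. f x * (of_bool (all_rel E P x) - pp P)\<bar>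
    \<le> B * (real (card P) * \<epsilon> * (\<Prod>l\<in>T. real (card (X l))))"
  using assms(1)
proof (induction rule: box_comb.induct)
  case (box Y')
  have fT: "finite T" using T finS finite_subset by blast
  have fY: "finite (PiE T Y)" using fT Y T by (intro finite_PiE) (meson finite_subset finX subsetD)+
  have "(\<Sum>x\<in>PiE T Y. of_bool (\<forall>k\<in>T. x k \<in> Y' k) * (of_bool (all_rel E P x) - pp P))
     = (\<Sum>x\<in>PiE T (\<lambda>l. Y l \<inter> Y' l). of_bool (all_rel E P x) - pp P)"
    by (rule sum.mono_neutral_cong_right[OF fY]) auto
  also have "\<bar>\<dots>\<bar> \<le> real (card P) * \<epsilon> * (\<Prod>l\<in>T. real (card (X l)))"
    using Y by (intro counting T P) auto
  finally show ?case by simp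
next
  case (lin B f C g a b D)
  let ?R = "real (card P) * \<epsilon> * (\<Prod>l\<in>T. real (card (X l)))"
  let ?s = "\<lambda>f. \<Sum>x\<in>PiE T Y. f x * (of_bool (all_rel E P x) - pp P)"
  have "?s (\<lambda>x. a * f x + b * g x) = a * ?s f + b * ?s g"
    by (simp add: sum_distrib_left sum.distrib[symmetric] algebra_simps)
  also have "\<bar>\<dots>\<bar> \<le> \<bar>a\<bar> * \<bar>?s f\<bar> + \<bar>b\<bar> * \<bar>?s g\<bar>"
    by (rule order_trans[OF abs_triangle_ineq]) (simp add: abs_mult)
  also have "\<dots> \<le> \<bar>a\<bar> * (B * ?R) + \<bar>b\<bar> * (C * ?R)"
    using lin.IH by (intro add_mono mult_left_mono) auto
  also have "\<dots> = (\<bar>a\<bar> * B + \<bar>b\<bar> * C) * ?R" by (simp only: algebra_simps)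
  also have "\<dots> \<le> D * ?R"
    using lin.hyps \<epsilon>_nonneg by (intro mult_right_mono mult_nonneg_nonneg prod_nonneg) auto
  finally show ?case .
qed

text \<open>The intersection of two boxes is a box, so the coefficient norm is
  submultiplicative.\<close>

lemma box_comb_mult:
  assumes "box_comb T B f" "box_comb T C g"
  shows "box_comb T (B * C) (\<lambda>x. f x * g x)"
  using assms(1)
proof (induction rule: box_comb.induct)
  case (box Y)
  show ?case using assms(2)
  proof (induction rule: box_comb.induct)
    case (box Y')
    have "(\<lambda>x. of_bool (\<forall>k\<in>T. x k \<in> Y k) * of_bool (\<forall>k\<in>T. x k \<in> Y' k) :: real)
      = (\<lambda>x. of_bool (\<forall>k\<in>T. x k \<in> Y k \<inter> Y' k))"
      by (auto simp: fun_eq_iff simp flip: of_bool_conj)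
    then show ?case using box_comb.box[of T "\<lambda>k. Y k \<inter> Y' k"] by simp
  next
    case (lin B f C g a b D)
    from box_comb.lin[OF lin.IH, of a b D] lin.hyps show ?case by (simp add: algebra_simps)
  qed
next
  case (lin B f C' g a b D)
  have "\<bar>a\<bar> * (B * C) + \<bar>b\<bar> * (C' * C) = (\<bar>a\<bar> * B + \<bar>b\<bar> * C') * C" by (simp add: algebra_simps)
  also have "\<dots> \<le> D * C" using lin.hyps box_comb_nonneg[OF assms(2)] by (intro mult_right_mono)
  finally show ?case using box_comb.lin[OF lin.IH, of a b "D * C"] by (simp add: algebra_simps)
qed

lemma box_comb_const_1: "box_comb T 1 (\<lambda>x. 1)"
  using box_comb.box[of T "\<lambda>_. UNIV"] by simp

lemma box_comb_power: "box_comb T B f \<Longrightarrow> box_comb T (B ^ r) (\<lambda>x. f x ^ r)"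
  by (induction r) (auto intro: box_comb_const_1 dest: box_comb_mult)

lemma box_comb_prod:
  assumes "\<And>j. j \<in> I \<Longrightarrow> box_comb T B (f j)"
  shows "box_comb T (B ^ card I) (\<lambda>x. \<Prod>j\<in>I. f j x)"
  using assms by (induction I rule: infinite_finite_induct) (auto intro: box_comb_const_1 box_comb_mult)

lemma box_comb_sum:
  assumes "finite I" "\<And>j. j \<in> I \<Longrightarrow> box_comb T 1 (f j)"
  shows "box_comb T (real (card I)) (\<lambda>x. \<Sum>j\<in>I. f j x)"
  using assms
proof (induction I rule: finite_induct)
  case empty
  then show ?case using box_comb.lin[OF box_comb_const_1 box_comb_const_1, of 0 0 0] by simp
next
  case (insert j I)
  then show ?case using box_comb.lin[of T 1 "f j" "real (card I)" "\<lambda>x. \<Sum>j\<in>I. f j x" 1 1 "1 + real (card I)"] by simp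
qed

end

section \<open>Typical vertices\<close>

context regular_system
begin

text \<open>\<open>H y\<close> is the weight of the tuples through \<open>y\<close>, and
  \<open>G P y\<close> the share of it satisfying \<open>P\<close>. Over every subset of
  \<open>X i\<close> the sums of \<open>G P\<close> and of \<open>pp P * H\<close> agree up to the
  regularity error, so few vertices of noticeable weight deviate by a factor 2 in a given direction.
  The upper estimate for \<open>P2\<close> serves the last triple of vertices, where a ratio of two
  counts matters.\<close>

lemma typical_vertices:
  fixes \<psi> :: "('i \<Rightarrow> 'v) \<Rightarrow> real" and q K \<sigma> :: real
  assumes i: "i \<notin> T'" and T: "insert i T' \<subseteq> S"
    and box_comb: "box_comb (insert i T') B \<psi>" and \<psi>: "\<And>x. 0 \<le> \<psi> x" "\<And>x. \<psi> x \<le> 1"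
    and P: "P1 \<subseteq> pairs (insert i T')" "P2 \<subseteq> pairs (insert i T')"
    and K: "real (card P1) \<le> K" "real (card P2) \<le> K"
    and q: "0 < q" "q \<le> pp P1" "q \<le> pp P2"
    and \<sigma>: "0 < \<sigma>"
    and sum: "\<sigma> * (\<Prod>l\<in>insert i T'. real (card (X l))) \<le> (\<Sum>x\<in>PiE (insert i T') X. \<psi> x)"
    and small: "B * K * \<epsilon> \<le> q * \<sigma>\<^sup>2 / 32"
  defines "V' \<equiv> \<Prod>l\<in>T'. real (card (X l))"
    and "H \<equiv> \<lambda>y. \<Sum>x\<in>PiE T' X. \<psi> (x(i := y))"
    and "G \<equiv> \<lambda>P y. \<Sum>x\<in>PiE T' X. \<psi> (x(i := y)) * of_bool (all_rel E P (x(i := y)))"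
  shows "\<sigma> / 4 * real (card (X i)) \<le>
    real (card {y \<in> X i. \<sigma> / 2 * V' \<le> H y \<and> pp P1 / 2 * H y \<le> G P1 y \<and> G P2 y \<le> 2 * pp P2 * H y})"
proof -
  have fT: "finite T'" and fX: "finite (X i)" using T finS finX by (auto intro: finite_subset)
  have V': "0 < V'" unfolding V'_def using T finX neX by (intro prod_pos) (auto simp: card_gt_0_iff)
  have V: "(\<Prod>l\<in>insert i T'. real (card (X l))) = real (card (X i)) * V'"
    using i fT by (simp add: V'_def)
  have B: "0 \<le> B" using box_comb by (rule box_comb_nonneg)
  \<comment> \<open>A sum over \<open>Z\<close> is a sum over the box with side \<open>Z\<close> at
    \<open>i\<close>; uniformity in \<open>Z\<close> is what rules out many exceptional
    vertices.\<close>
  have key: "\<bar>\<Sum>y\<in>Z. G P y - pp P * H y\<bar> \<le> q * \<sigma>\<^sup>2 / 32 * (real (card (X i)) * V')"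
    if Z: "Z \<subseteq> X i" and PP: "P \<subseteq> pairs (insert i T')" "real (card P) \<le> K" for Z P
  proof -
    have "(\<Sum>y\<in>Z. G P y - pp P * H y) = (\<Sum>y\<in>Z. \<Sum>x\<in>PiE T' X. \<psi> (x(i := y)) * (of_bool (all_rel E P (x(i := y))) - pp P))"
      unfolding G_def H_def by (simp add: algebra_simps sum_subtractf sum_distrib_left)
    also have "\<dots> = (\<Sum>x\<in>PiE (insert i T') (X(i := Z)). \<psi> x * (of_bool (all_rel E P x) - pp P))"
      using i unfolding sum_PiE_insert[OF i]
      by (intro sum.cong PiE_cong) auto
    also have "\<bar>\<dots>\<bar> \<le> B * (real (card P) * \<epsilon> * (\<Prod>l\<in>insert i T'. real (card (X l))))"
      using Z by (intro box_comb_counting[OF box_comb T PP(1)]) auto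
    also have "\<dots> = B * real (card P) * \<epsilon> * (real (card (X i)) * V')" by (simp add: V)
    also have "\<dots> \<le> q * \<sigma>\<^sup>2 / 32 * (real (card (X i)) * V')"
      using PP(2) B \<epsilon>_nonneg V' 
      by (intro mult_right_mono order_trans[OF _ small] mult_left_mono) auto
    finally show ?thesis .
  qed
  define G0 where "G0 = {y \<in> X i. \<sigma> / 2 * V' \<le> H y}"
  define Z1 where "Z1 = {y \<in> X i. \<sigma> / 2 * V' \<le> H y \<and> G P1 y < pp P1 / 2 * H y}"
  define Z2 where "Z2 = {y \<in> X i. \<sigma> / 2 * V' \<le> H y \<and> 2 * pp P2 * H y < G P2 y}"
  have HV: "H y \<le> V'" for y
  proof -
    have "H y \<le> (\<Sum>x\<in>PiE T' X. 1)" unfolding H_def by (intro sum_mono \<psi>)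
    also have "\<dots> = V'" using fT by (simp add: V'_def card_PiE)
    finally show ?thesis .
  qed
  have g0: "\<sigma> / 2 * real (card (X i)) \<le> real (card G0)"
  proof -
    have "\<sigma> * (real (card (X i)) * V') \<le> (\<Sum>y\<in>X i. H y)"
      using sum V i by (simp add: H_def sum_PiE_insert)
    also have "\<dots> \<le> (\<Sum>y\<in>X i. of_bool (y \<in> G0) * V' + \<sigma> / 2 * V')"
      using HV V' \<sigma> by (intro sum_mono) (auto simp: G0_def intro: add_increasing2)
    also have "\<dots> = real (card G0) * V' + real (card (X i)) * (\<sigma> / 2 * V')"
    proof -
      have "(\<Sum>y\<in>X i. of_bool (y \<in> G0)) = real (card (G0 \<inter> X i))"
        using fX by (simp add: of_bool_def sum.If_cases Int_commute)
      moreover have "G0 \<inter> X i = G0" by (auto simp: G0_def)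
      ultimately show ?thesis by (simp add: sum.distrib flip: sum_distrib_right)
    qed
    finally have "(\<sigma> / 2 * real (card (X i))) * V' \<le> real (card G0) * V'" by (simp add: algebra_simps)
    then show ?thesis using V' by simp
  qed
  \<comment> \<open>On \<open>Z\<close> all deviations have the same sign and size at least
    \<open>q * \<sigma> / 4 * V'\<close>, so \<open>key\<close> forces \<open>Z\<close> to be small.
    Two such sets remove at most half of the lower bound for \<open>card G0\<close>.\<close>
  have bad: "real (card Z) \<le> \<sigma> / 8 * real (card (X i))"
    if Z: "Z \<subseteq> X i" and PP: "P \<subseteq> pairs (insert i T')" "real (card P) \<le> K"
      and low: "\<And>y. y \<in> Z \<Longrightarrow> q * \<sigma> / 4 * V' \<le> c * (G P y - pp P * H y)" and c: "\<bar>c\<bar> = 1" for Z P c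
  proof -
    have "real (card Z) * (q * \<sigma> / 4 * V') \<le> (\<Sum>y\<in>Z. c * (G P y - pp P * H y))"
      using sum_mono[of Z "\<lambda>_. q * \<sigma> / 4 * V'"] low by simp
    also have "\<dots> \<le> \<bar>\<Sum>y\<in>Z. G P y - pp P * H y\<bar>"
      using c unfolding sum_distrib_left[symmetric] by (metis abs_ge_self abs_mult mult_1)
    also have "\<dots> \<le> q * \<sigma>\<^sup>2 / 32 * (real (card (X i)) * V')" by (rule key[OF Z PP])
    finally have "real (card Z) * (q * \<sigma> / 4 * V') \<le> (\<sigma> / 8 * real (card (X i))) * (q * \<sigma> / 4 * V')"
      by (simp add: power2_eq_square algebra_simps)
    moreover have "0 < q * \<sigma> / 4 * V'" using q(1) \<sigma> V' by simp
    ultimately show ?thesis by (rule mult_right_le_imp_le)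
  qed
  have lowb: "q * (\<sigma> / 2 * V') \<le> pp P * H y" if "\<sigma> / 2 * V' \<le> H y" "q \<le> pp P" for P y
    using that q \<sigma> V' by (intro mult_mono) auto
  have z1: "real (card Z1) \<le> \<sigma> / 8 * real (card (X i))"
  proof (rule bad[of _ P1 "-1"])
    fix y assume "y \<in> Z1"
    then have "\<sigma> / 2 * V' \<le> H y" "G P1 y < pp P1 / 2 * H y" by (auto simp: Z1_def)
    with lowb[OF this(1) q(2)] show "q * \<sigma> / 4 * V' \<le> -1 * (G P1 y - pp P1 * H y)"
      by (simp add: algebra_simps)
  qed (use P K in \<open>auto simp: Z1_def\<close>)
  have z2: "real (card Z2) \<le> \<sigma> / 8 * real (card (X i))"
  proof (rule bad[of _ P2 1])
    fix y assume "y \<in> Z2"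
    then have *: "\<sigma> / 2 * V' \<le> H y" "2 * pp P2 * H y < G P2 y" by (auto simp: Z2_def)
    have "0 < q * \<sigma> * V'" using q \<sigma> V' by simp
    with lowb[OF *(1) q(3)] *(2) show "q * \<sigma> / 4 * V' \<le> 1 * (G P2 y - pp P2 * H y)"
      by (simp add: algebra_simps)
  qed (use P K in \<open>auto simp: Z2_def\<close>)
  let ?Y = "{y \<in> X i. \<sigma> / 2 * V' \<le> H y \<and> pp P1 / 2 * H y \<le> G P1 y \<and> G P2 y \<le> 2 * pp P2 * H y}"
  have "G0 \<subseteq> ?Y \<union> (Z1 \<union> Z2)" by (auto simp: G0_def Z1_def Z2_def)
  then have "card G0 \<le> card (?Y \<union> (Z1 \<union> Z2))"
    using fX by (intro card_mono) (auto simp: Z1_def Z2_def)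
  also have "\<dots> \<le> card ?Y + (card Z1 + card Z2)"
    by (meson add_left_mono card_Un_le le_trans)
  finally have "real (card G0) \<le> real (card ?Y) + real (card Z1) + real (card Z2)" by linarith
  with g0 z1 z2 show ?thesis by (simp add: algebra_simps)
qed

end

section \<open>Classes of vertices with equal neighbourhoods in the chosen parts\<close>

lemma pigeonhole_class:
  assumes Y: "finite Y" "Y \<noteq> {}" and D: "finite D" "f ` Y \<subseteq> D"
  obtains d where "d \<in> D" "{y \<in> Y. f y = d} \<noteq> {}" "card Y \<le> card D * card {y \<in> Y. f y = d}"
proof -
  have "D \<noteq> {}" using Y D by auto
  define M where "M = Max ((\<lambda>d. card {y \<in> Y. f y = d}) ` D)"
  obtain d where d: "d \<in> D" "card {y \<in> Y. f y = d} = M"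
    using Max_in[of "(\<lambda>d. card {y \<in> Y. f y = d}) ` D"] \<open>D \<noteq> {}\<close> D(1) unfolding M_def
    by (metis (no_types, lifting) finite_imageI image_iff image_is_empty)
  have "card Y = (\<Sum>d\<in>D. card {y \<in> Y. f y = d})"
    using sum.group[OF Y(1) D, of "\<lambda>_. 1 :: nat"] by simp
  also have "\<dots> \<le> (\<Sum>d\<in>D. M)" unfolding M_def using D by (intro sum_mono Max_ge) auto
  also have "\<dots> = card D * card {y \<in> Y. f y = d}" using d by simp
  finally have le: "card Y \<le> card D * card {y \<in> Y. f y = d}" .
  moreover have "card Y > 0" using Y by (simp add: card_gt_0_iff)
  ultimately have "card {y \<in> Y. f y = d} > 0" by (metis gr0I mult_0_right not_le)
  then have "{y \<in> Y. f y = d} \<noteq> {}" by (auto simp: card_gt_0_iff)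
  with d le show ?thesis using that by blast
qed

text \<open>Pigeonhole over the possible neighbourhoods in the parts. There are at most
  \<open>2 ^ (m * card I)\<close> of them, a small power of \<open>N\<close> once \<open>m\<close>
  is a small multiple of log N. All vertices of \<open>W\<close> are joined to all of the new parts
  \<open>\<tau>' j\<close>.\<close>

lemma common_trace:
  fixes \<tau> :: "'i \<Rightarrow> 'v set"
  assumes Y: "finite Y" "Y \<noteq> {}" and I: "finite I"
    and \<tau>: "\<And>j. j \<in> I \<Longrightarrow> finite (\<tau> j) \<and> card (\<tau> j) \<le> m"
  obtains W \<tau>' where "W \<subseteq> Y" "W \<noteq> {}" "real (card Y) \<le> 2 ^ (m * card I) * real (card W)"
    "\<And>j y. j \<in> I \<Longrightarrow> y \<in> W \<Longrightarrow> \<tau>' j = {a \<in> \<tau> j. E j i a y}"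
    "\<And>j. j \<in> I \<Longrightarrow> \<tau>' j \<subseteq> \<tau> j"
proof -
  define ty where "ty y = (\<lambda>j\<in>I. {a \<in> \<tau> j. E j i a y})" for y
  let ?D = "PiE I (\<lambda>j. Pow (\<tau> j))"
  have finD: "finite ?D" using I \<tau> by (intro finite_PiE) auto
  have "ty ` Y \<subseteq> ?D" by (auto simp: ty_def)
  then obtain d where
    d: "d \<in> ?D" and neW: "{y \<in> Y. ty y = d} \<noteq> {}" and le: "card Y \<le> card ?D * card {y \<in> Y. ty y = d}"
    by (rule pigeonhole_class[OF Y finD])
  have "card ?D = (\<Prod>j\<in>I. 2 ^ card (\<tau> j))" using I \<tau> by (simp add: card_PiE card_Pow)
  also have "\<dots> \<le> (\<Prod>j\<in>I. 2 ^ m)" using \<tau> by (intro prod_mono) (auto intro!: power_increasing)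
  also have "\<dots> = 2 ^ (m * card I)" by (simp add: power_mult)
  finally have "card Y \<le> 2 ^ (m * card I) * card {y \<in> Y. ty y = d}"
    using le by (meson le_trans mult_le_mono1)
  then have "real (card Y) \<le> real (2 ^ (m * card I) * card {y \<in> Y. ty y = d})" by (subst of_nat_le_iff)
  then have cW: "real (card Y) \<le> 2 ^ (m * card I) * real (card {y \<in> Y. ty y = d})" by simp
  have dW: "d j = {a \<in> \<tau> j. E j i a y}" if "j \<in> I" "y \<in> {y \<in> Y. ty y = d}" for j y
    using that by (auto simp: ty_def)
  have "d j \<subseteq> \<tau> j" if "j \<in> I" for j using d that by (auto simp: PiE_def Pi_def)
  with neW cW dW show ?thesis by (intro that[of "{y \<in> Y. ty y = d}" d]) auto
qed

text \<open>
  A polynomial surrogate for the indicator of "\<open>f\<close> is not much smaller than \<open>s\<close>" (see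
  \<open>amp_params\<close>): unlike the indicator, it keeps the weights below in the span of box indicators,
  whose correlation with the edges is controlled by regularity.
\<close>

definition amp :: "nat \<Rightarrow> nat \<Rightarrow> real \<Rightarrow> real" where
  "amp R Q f = (1 - (1 - f) ^ R) ^ Q"

lemma amp_nonneg: "0 \<le> f \<Longrightarrow> f \<le> 1 \<Longrightarrow> 0 \<le> amp R Q f"
  and amp_le_1: "0 \<le> f \<Longrightarrow> f \<le> 1 \<Longrightarrow> amp R Q f \<le> 1"
  unfolding amp_def by (auto intro!: zero_le_power power_le_one)

text \<open>The denominator is the original size \<open>m\<close>, not \<open>card A\<close>: a part
  that has been cut down is still measured against its first size. Hence the fraction agrees before
  and after a cut, as \<open>weight_eq\<close> requires.\<close>

definition nbr_frac :: "('i \<Rightarrow> 'i \<Rightarrow> 'v \<Rightarrow> 'v \<Rightarrow> bool) \<Rightarrow> nat \<Rightarrow> 'i set \<Rightarrow> 'v set \<Rightarrow> 'i \<Rightarrow> ('i \<Rightarrow> 'v) \<Rightarrow> real" where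
  "nbr_frac E m T A j x = real (card {a \<in> A. \<forall>k\<in>T. E j k a (x k)}) / real m"

lemma nbr_frac_bounds:
  assumes "finite A \<and> card A \<le> m"
  shows "0 \<le> nbr_frac E m T A j x" "nbr_frac E m T A j x \<le> 1"
proof -
  have "card {a \<in> A. \<forall>k\<in>T. E j k a (x k)} \<le> card A" using assms by (intro card_mono) auto
  with assms show "nbr_frac E m T A j x \<le> 1" by (auto simp: nbr_frac_def divide_le_eq)
qed (simp add: nbr_frac_def)

text \<open>A soft indicator of the event that the tuple \<open>x\<close> of vertices still to be
  chosen leaves a sizeable share of every part \<open>\<tau> j\<close>.\<close>

definition weight :: "('i \<Rightarrow> 'i \<Rightarrow> 'v \<Rightarrow> 'v \<Rightarrow> bool) \<Rightarrow> nat \<Rightarrow> nat \<Rightarrow> nat \<Rightarrow> 'i set \<Rightarrow> 'i set \<Rightarrow>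
    ('i \<Rightarrow> 'v set) \<Rightarrow> ('i \<Rightarrow> 'v) \<Rightarrow> real" where
  "weight E m R Q I T \<tau> x = (\<Prod>j\<in>I. amp R Q (nbr_frac E m T (\<tau> j) j x))"

lemma weight_bounds:
  assumes "\<And>j. j \<in> I \<Longrightarrow> finite (\<tau> j) \<and> card (\<tau> j) \<le> m"
  shows "0 \<le> weight E m R Q I T \<tau> x" "weight E m R Q I T \<tau> x \<le> 1"
  unfolding weight_def
  by (intro prod_nonneg prod_le_1 ballI conjI amp_nonneg amp_le_1 nbr_frac_bounds assms; assumption)+

lemma weight_eq:
  assumes "i \<notin> T'" "\<And>j. j \<in> I \<Longrightarrow> \<tau>' j = {a \<in> \<tau> j. E j i a y}"
  shows "weight E m R Q I (insert i T') \<tau> (x(i := y)) = weight E m R Q I T' \<tau>' x"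
proof -
  have "{a \<in> \<tau> j. \<forall>k\<in>insert i T'. E j k a ((x(i := y)) k)} = {a \<in> \<tau>' j. \<forall>k\<in>T'. E j k a (x k)}"
    if "j \<in> I" for j using assms that by auto
  then show ?thesis unfolding weight_def nbr_frac_def by simp
qed

section \<open>Choosing one part of the blowup\<close>

context regular_system
begin

text \<open>For a fixed \<open>a\<close>, adjacency to all \<open>x k\<close> is a box condition, so
  \<open>nbr_frac\<close> is a sum of at most \<open>m\<close> box indicators divided by
  \<open>m\<close> and has norm at most 1; the bound then follows the formula of \<open>amp\<close>.
  It is huge but independent of \<open>m\<close> and \<open>N\<close>, so a small \<epsilon> beats
  it.\<close>

lemma box_comb_weight:
  assumes m: "m > 0" and \<tau>: "\<And>j. j \<in> I \<Longrightarrow> finite (\<tau> j) \<and> card (\<tau> j) \<le> m"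
  shows "box_comb T (((1 + 2 ^ R) ^ Q) ^ card I) (weight E m R Q I T \<tau>)"
proof -
  have fr: "box_comb T 1 (nbr_frac E m T (\<tau> j) j)" if j: "j \<in> I" for j
  proof -
    have fin: "finite (\<tau> j)" and le: "card (\<tau> j) \<le> m" using \<tau>[OF j] by auto
    have "box_comb T (real (card (\<tau> j))) (\<lambda>x. \<Sum>a\<in>\<tau> j. of_bool (\<forall>k\<in>T. x k \<in> {b. E j k a b}))"
      by (intro box_comb_sum fin box_comb.box)
    from box_comb.lin[OF this box_comb_const_1, of "1 / real m" 0 1] m le
    have "box_comb T 1 (\<lambda>x. 1 / real m * (\<Sum>a\<in>\<tau> j. of_bool (\<forall>k\<in>T. x k \<in> {b. E j k a b})))"
      by (simp add: divide_le_eq)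
    moreover have "(\<Sum>a\<in>\<tau> j. of_bool (\<forall>k\<in>T. x k \<in> {b. E j k a b})) = real (card {a \<in> \<tau> j. \<forall>k\<in>T. E j k a (x k)})" for x
      using fin by (simp add: of_bool_def sum.If_cases Int_def)
    ultimately show ?thesis unfolding nbr_frac_def by simp
  qed
  have "box_comb T ((1 + 2 ^ R) ^ Q) (\<lambda>x. amp R Q (nbr_frac E m T (\<tau> j) j x))" if "j \<in> I" for j
  proof -
    have "box_comb T 2 (\<lambda>x. 1 * 1 + (-1) * nbr_frac E m T (\<tau> j) j x)"
      by (rule box_comb.lin[OF box_comb_const_1 fr[OF that]]) simp
    then have "box_comb T (2 ^ R) (\<lambda>x. (1 - nbr_frac E m T (\<tau> j) j x) ^ R)" using box_comb_power by fastforce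
    then have "box_comb T (1 + 2 ^ R) (\<lambda>x. 1 * 1 + (-1) * (1 - nbr_frac E m T (\<tau> j) j x) ^ R)"
      by (rule box_comb.lin[OF box_comb_const_1]) simp
    then show ?thesis unfolding amp_def using box_comb_power by fastforce
  qed
  then show ?thesis unfolding weight_def[abs_def] by (rule box_comb_prod)
qed

text \<open>The typical vertices are sorted by their traces on the parts. Within one class the
  weight of the remaining tuples does not depend on the vertex, by \<open>weight_eq\<close>, so the
  estimates hold for all \<open>y\<close> in \<open>W\<close> against one common weight. This
  permits averaging over many \<open>y\<close> afterwards.\<close>

lemma select_class:
  fixes \<tau> :: "'i \<Rightarrow> 'v set" and q K \<sigma> :: real
  assumes i: "i \<notin> T'" and T: "insert i T' \<subseteq> S"
    and m: "m > 0" and I: "finite I" and \<tau>: "\<And>j. j \<in> I \<Longrightarrow> finite (\<tau> j) \<and> card (\<tau> j) \<le> m"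
    and P: "P1 \<subseteq> pairs (insert i T')" "P2 \<subseteq> pairs (insert i T')"
    and K: "real (card P1) \<le> K" "real (card P2) \<le> K"
    and q: "0 < q" "q \<le> pp P1" "q \<le> pp P2"
    and \<sigma>: "0 < \<sigma>"
    and sum: "\<sigma> * (\<Prod>l\<in>insert i T'. real (card (X l))) \<le> (\<Sum>x\<in>PiE (insert i T') X. weight E m R Q I (insert i T') \<tau> x)"
    and small: "((1 + 2 ^ R) ^ Q) ^ card I * K * \<epsilon> \<le> q * \<sigma>\<^sup>2 / 32"
  obtains W \<tau>' where
    "W \<subseteq> X i" "\<sigma> / 4 * real (card (X i)) \<le> 2 ^ (m * card I) * real (card W)"
    "\<And>j y. j \<in> I \<Longrightarrow> y \<in> W \<Longrightarrow> \<tau>' j = {a \<in> \<tau> j. E j i a y}"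
    "\<And>j. j \<in> I \<Longrightarrow> \<tau>' j \<subseteq> \<tau> j"
    "\<sigma> / 2 * (\<Prod>l\<in>T'. real (card (X l))) \<le> (\<Sum>x\<in>PiE T' X. weight E m R Q I T' \<tau>' x)"
    "\<And>y. y \<in> W \<Longrightarrow> pp P1 / 2 * (\<Sum>x\<in>PiE T' X. weight E m R Q I T' \<tau>' x) \<le>
       (\<Sum>x\<in>PiE T' X. weight E m R Q I T' \<tau>' x * of_bool (all_rel E P1 (x(i := y))))"
    "\<And>y. y \<in> W \<Longrightarrow> (\<Sum>x\<in>PiE T' X. weight E m R Q I T' \<tau>' x * of_bool (all_rel E P2 (x(i := y))))
       \<le> 2 * pp P2 * (\<Sum>x\<in>PiE T' X. weight E m R Q I T' \<tau>' x)"
proof -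
  let ?\<psi> = "weight E m R Q I (insert i T') \<tau>"
  define Y where "Y = {y \<in> X i. \<sigma> / 2 * (\<Prod>l\<in>T'. real (card (X l))) \<le> (\<Sum>x\<in>PiE T' X. ?\<psi> (x(i := y)))
    \<and> pp P1 / 2 * (\<Sum>x\<in>PiE T' X. ?\<psi> (x(i := y))) \<le> (\<Sum>x\<in>PiE T' X. ?\<psi> (x(i := y)) * of_bool (all_rel E P1 (x(i := y))))
    \<and> (\<Sum>x\<in>PiE T' X. ?\<psi> (x(i := y)) * of_bool (all_rel E P2 (x(i := y)))) \<le> 2 * pp P2 * (\<Sum>x\<in>PiE T' X. ?\<psi> (x(i := y)))}"
  have cardY: "\<sigma> / 4 * real (card (X i)) \<le> real (card Y)"
    unfolding Y_def
    by (rule typical_vertices[OF i T box_comb_weight[OF m \<tau>] weight_bounds(1)[OF \<tau>] weight_bounds(2)[OF \<tau>] P K q \<sigma> sum small])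
  have Xi: "card (X i) > 0" using T finX neX by (simp add: card_gt_0_iff)
  have finY: "finite Y" using T finX by (auto simp: Y_def)
  have "0 < \<sigma> / 4 * real (card (X i))" using Xi \<sigma> by simp
  then have "0 < real (card Y)" using cardY by linarith
  then have neY: "Y \<noteq> {}" by (metis card.empty less_irrefl of_nat_0)
  obtain W d where W: "W \<subseteq> Y" "W \<noteq> {}" and le: "real (card Y) \<le> 2 ^ (m * card I) * real (card W)"
    and dW: "\<And>j y. j \<in> I \<Longrightarrow> y \<in> W \<Longrightarrow> d j = {a \<in> \<tau> j. E j i a y}"
    and d: "\<And>j. j \<in> I \<Longrightarrow> d j \<subseteq> \<tau> j"
    by (rule common_trace[OF finY neY I \<tau>, where E = E and i = i], assumption, (rule that; assumption))
  have cW: "\<sigma> / 4 * real (card (X i)) \<le> 2 ^ (m * card I) * real (card W)" using cardY le by linarith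
  have eq: "?\<psi> (x(i := y)) = weight E m R Q I T' d x" if "y \<in> W" for x y
    using that dW by (intro weight_eq[OF i]) blast
  have WY: "y \<in> Y" if "y \<in> W" for y using that W by auto
  obtain y0 where y0: "y0 \<in> W" using W by auto
  show ?thesis
  proof (rule that[of W d])
    show "W \<subseteq> X i" using WY by (auto simp: Y_def)
    show "\<sigma> / 4 * real (card (X i)) \<le> 2 ^ (m * card I) * real (card W)" by (rule cW)
    show "d j = {a \<in> \<tau> j. E j i a y}" if "j \<in> I" "y \<in> W" for j y by (rule dW[OF that])
    show "d j \<subseteq> \<tau> j" if "j \<in> I" for j by (rule d[OF that])
    show "\<sigma> / 2 * (\<Prod>l\<in>T'. real (card (X l))) \<le> (\<Sum>x\<in>PiE T' X. weight E m R Q I T' d x)"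
      using WY[OF y0] unfolding Y_def mem_Collect_eq eq[OF y0] by blast
    show "pp P1 / 2 * (\<Sum>x\<in>PiE T' X. weight E m R Q I T' d x) \<le>
       (\<Sum>x\<in>PiE T' X. weight E m R Q I T' d x * of_bool (all_rel E P1 (x(i := y))))"
      if y: "y \<in> W" for y
      using WY[OF y] unfolding Y_def mem_Collect_eq eq[OF y] by blast
    show "(\<Sum>x\<in>PiE T' X. weight E m R Q I T' d x * of_bool (all_rel E P2 (x(i := y))))
       \<le> 2 * pp P2 * (\<Sum>x\<in>PiE T' X. weight E m R Q I T' d x)"
      if y: "y \<in> W" for y
      using WY[OF y] unfolding Y_def mem_Collect_eq eq[OF y] by blast
  qed
qed

text \<open>Any \<open>m\<close> vertices of the selected class can form the new part
  \<open>A\<close>: exchanging sums, the weighted mean of the fraction of \<open>A\<close> adjacent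
  to a tuple is at least \<open>s / 2\<close>, so tuples with fraction at least \<open>s / 4\<close>
  carry at least \<open>s / 4\<close> of the weight. The new factor \<open>amp\<close> costs them at
  most \<beta>. Together with \<open>\<sigma> / 2\<close> from the selection this gives
  \<open>s * \<beta> / 8\<close>.\<close>

lemma embed_step:
  fixes \<tau> :: "'i \<Rightarrow> 'v set" and s K \<sigma> :: real
  assumes i: "\<And>k. k \<in> T' \<Longrightarrow> i < k" and T: "insert i T' \<subseteq> S"
    and m: "m > 0" and I: "finite I" "i \<notin> I" and \<tau>: "\<And>j. j \<in> I \<Longrightarrow> finite (\<tau> j) \<and> card (\<tau> j) \<le> m"
    and K: "real (card T') \<le> K"
    and s: "0 < s" "s \<le> (\<Prod>k\<in>T'. p i k)"
    and \<sigma>: "0 < \<sigma>"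
    and sum: "\<sigma> * (\<Prod>l\<in>insert i T'. real (card (X l))) \<le> (\<Sum>x\<in>PiE (insert i T') X. weight E m R Q I (insert i T') \<tau> x)"
    and small: "((1 + 2 ^ R) ^ Q) ^ card I * K * \<epsilon> \<le> s * \<sigma>\<^sup>2 / 32"
    and large: "m * 2 ^ (m * card I) \<le> \<sigma> / 4 * real (card (X i))"
    and \<beta>: "\<And>f. s / 4 \<le> f \<Longrightarrow> f \<le> 1 \<Longrightarrow> \<beta> \<le> amp R Q f" "0 \<le> \<beta>"
  obtains \<tau>' where
    "\<And>j. j \<in> I \<Longrightarrow> \<tau>' j \<subseteq> \<tau> j" "\<tau>' i \<subseteq> X i" "card (\<tau>' i) = m"
    "\<And>j a b. j \<in> I \<Longrightarrow> a \<in> \<tau>' j \<Longrightarrow> b \<in> \<tau>' i \<Longrightarrow> E j i a b"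
    "\<sigma> * (s * \<beta> / 8) * (\<Prod>l\<in>T'. real (card (X l))) \<le> (\<Sum>x\<in>PiE T' X. weight E m R Q (insert i I) T' \<tau>' x)"
proof -
  have iT: "i \<notin> T'" using i by auto
  define P1 where "P1 = Pair i ` T'"
  have P1: "P1 \<subseteq> pairs (insert i T')" using i by (auto simp: P1_def pairs_def)
  have inj: "inj_on (Pair i) T'" by (auto simp: inj_on_def)
  have cP1: "card P1 = card T'" unfolding P1_def by (rule card_image[OF inj])
  have ppP1: "pp P1 = (\<Prod>k\<in>T'. p i k)" unfolding P1_def pp_def by (simp add: prod.reindex[OF inj])
  have pe: "pp {} = 1" by (simp add: pp_def)
  have s1: "s \<le> 1" using s ppP1 pp_bounds[OF order_trans[OF P1 pairs_mono[OF T]]] by linarith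
  have k1: "real (card P1) \<le> K" using K cP1 by simp
  have k2: "real (card ({} :: ('i \<times> 'i) set)) \<le> K" using order_trans[OF of_nat_0_le_iff K] by simp
  have q1: "s \<le> pp P1" and q2: "s \<le> pp {}" using s s1 ppP1 pe by auto
  obtain W \<tau>1 where W: "W \<subseteq> X i" "\<sigma> / 4 * real (card (X i)) \<le> 2 ^ (m * card I) * real (card W)"
    "\<And>j y. j \<in> I \<Longrightarrow> y \<in> W \<Longrightarrow> \<tau>1 j = {a \<in> \<tau> j. E j i a y}"
    "\<And>j. j \<in> I \<Longrightarrow> \<tau>1 j \<subseteq> \<tau> j"
    "\<sigma> / 2 * (\<Prod>l\<in>T'. real (card (X l))) \<le> (\<Sum>x\<in>PiE T' X. weight E m R Q I T' \<tau>1 x)"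
    "\<And>y. y \<in> W \<Longrightarrow> pp P1 / 2 * (\<Sum>x\<in>PiE T' X. weight E m R Q I T' \<tau>1 x) \<le>
       (\<Sum>x\<in>PiE T' X. weight E m R Q I T' \<tau>1 x * of_bool (all_rel E P1 (x(i := y))))"
    by (rule select_class[OF iT T m I(1) \<tau> P1 empty_subsetI k1 k2 s(1) q1 q2 \<sigma> sum small],
        assumption, (rule that; assumption))
  have "real (m * 2 ^ (m * card I)) \<le> \<sigma> / 4 * real (card (X i))" using large by simp
  also note W(2)
  finally have "real m * 2 ^ (m * card I) \<le> real (card W) * 2 ^ (m * card I)" by (simp add: mult.commute)
  then have "real m \<le> real (card W)" by (rule mult_right_le_imp_le) simp
  then have "m \<le> card W" by simp
  then obtain A where A: "A \<subseteq> W" "card A = m" by (meson obtain_subset_with_card_n)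
  have finA: "finite A" using A m card.infinite by fastforce
  define \<tau>' where "\<tau>' = \<tau>1(i := A)"
  let ?\<psi> = "weight E m R Q I T' \<tau>1"
  let ?h = "\<Sum>x\<in>PiE T' X. ?\<psi> x"
  have \<tau>1: "finite (\<tau>1 j) \<and> card (\<tau>1 j) \<le> m" if "j \<in> I" for j
    using \<tau>[OF that] W(4)[OF that] by (meson card_mono finite_subset le_trans)
  have \<psi>0: "0 \<le> ?\<psi> x" for x using \<tau>1 by (rule weight_bounds)
  have fr: "(\<Sum>y\<in>A. of_bool (all_rel E P1 (x(i := y)))) = real m * nbr_frac E m T' A i x" for x
  proof -
    have "all_rel E P1 (x(i := y)) \<longleftrightarrow> (\<forall>k\<in>T'. E i k y (x k))" for y
      using iT by (auto simp: all_rel_def P1_def)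
    then show ?thesis using finA m by (simp add: nbr_frac_def of_bool_def sum.If_cases Int_def)
  qed
  have fb: "0 \<le> nbr_frac E m T' A i x" "nbr_frac E m T' A i x \<le> 1" for x
    using nbr_frac_bounds[of A m E T' i x] finA A(2) by simp_all
  have "real m * (pp P1 / 2 * ?h) = (\<Sum>y\<in>A. pp P1 / 2 * ?h)" using A by simp
  also have "\<dots> \<le> (\<Sum>y\<in>A. \<Sum>x\<in>PiE T' X. ?\<psi> x * of_bool (all_rel E P1 (x(i := y))))"
    using A by (intro sum_mono W(6)) auto
  also have "\<dots> = real m * (\<Sum>x\<in>PiE T' X. ?\<psi> x * nbr_frac E m T' A i x)"
    by (subst sum.swap) (simp only: sum_distrib_left[symmetric] fr, simp only: sum_distrib_left mult.left_commute)
  finally have "pp P1 / 2 * ?h \<le> (\<Sum>x\<in>PiE T' X. ?\<psi> x * nbr_frac E m T' A i x)" using m by simp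
  moreover have "?\<psi> x * nbr_frac E m T' A i x \<le> ?\<psi> x * (s / 4 + of_bool (s / 4 \<le> nbr_frac E m T' A i x))" for x
    using \<psi>0 fb s by (intro mult_left_mono) (auto intro: add_increasing)
  ultimately have "pp P1 / 2 * ?h \<le> (\<Sum>x\<in>PiE T' X. ?\<psi> x * (s / 4 + of_bool (s / 4 \<le> nbr_frac E m T' A i x)))"
    by (meson order_trans sum_mono)
  then have "pp P1 / 2 * ?h \<le> s / 4 * ?h + (\<Sum>x\<in>PiE T' X. ?\<psi> x * of_bool (s / 4 \<le> nbr_frac E m T' A i x))"
    by (simp add: distrib_left sum.distrib sum_distrib_left mult.commute)
  moreover have "s / 2 * ?h \<le> pp P1 / 2 * ?h" using s ppP1 \<psi>0 by (intro mult_right_mono sum_nonneg) auto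
  ultimately have low: "s / 4 * ?h \<le> (\<Sum>x\<in>PiE T' X. ?\<psi> x * of_bool (s / 4 \<le> nbr_frac E m T' A i x))"
    by simp
  have "\<sigma> * (s * \<beta> / 8) * (\<Prod>l\<in>T'. real (card (X l))) = \<beta> * (s / 4 * (\<sigma> / 2 * (\<Prod>l\<in>T'. real (card (X l)))))"
    by simp
  also have "\<dots> \<le> \<beta> * (s / 4 * ?h)" using W(5) s \<beta> by (intro mult_left_mono) auto
  also have "\<dots> \<le> \<beta> * (\<Sum>x\<in>PiE T' X. ?\<psi> x * of_bool (s / 4 \<le> nbr_frac E m T' A i x))"
    using low \<beta>(2) by (rule mult_left_mono)
  also have "\<dots> \<le> (\<Sum>x\<in>PiE T' X. ?\<psi> x * amp R Q (nbr_frac E m T' A i x))"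
    unfolding sum_distrib_left
  proof (rule sum_mono)
    fix x
    have "\<beta> * of_bool (s / 4 \<le> nbr_frac E m T' A i x) \<le> amp R Q (nbr_frac E m T' A i x)"
      using \<beta>(1)[OF _ fb(2)] amp_nonneg[OF fb] by auto
    from mult_left_mono[OF this \<psi>0]
    show "\<beta> * (?\<psi> x * of_bool (s / 4 \<le> nbr_frac E m T' A i x)) \<le> ?\<psi> x * amp R Q (nbr_frac E m T' A i x)"
      by (simp add: algebra_simps)
  qed
  also have "\<dots> = (\<Sum>x\<in>PiE T' X. weight E m R Q (insert i I) T' \<tau>' x)"
  proof (rule sum.cong[OF refl])
    fix x
    have "(\<Prod>j\<in>I. amp R Q (nbr_frac E m T' (\<tau>' j) j x)) = ?\<psi> x"
      unfolding weight_def using I by (intro prod.cong) (auto simp: \<tau>'_def)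
    then show "?\<psi> x * amp R Q (nbr_frac E m T' A i x) = weight E m R Q (insert i I) T' \<tau>' x"
      using I by (simp add: weight_def \<tau>'_def)
  qed
  finally have fin: "\<sigma> * (s * \<beta> / 8) * (\<Prod>l\<in>T'. real (card (X l))) \<le> (\<Sum>x\<in>PiE T' X. weight E m R Q (insert i I) T' \<tau>' x)" .
  show ?thesis
  proof (rule that[OF _ _ _ _ fin])
    show "\<tau>' j \<subseteq> \<tau> j" if "j \<in> I" for j using that I W(4) by (auto simp: \<tau>'_def)
    show "E j i a b" if "j \<in> I" "a \<in> \<tau>' j" "b \<in> \<tau>' i" for j a b
      using that I W(3)[of j b] A by (auto simp: \<tau>'_def split: if_splits)
  qed (use A W in \<open>auto simp: \<tau>'_def\<close>)
qed

end

section \<open>Common neighbourhoods\<close>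

text \<open>A random \<open>m\<close>-subset of \<open>W\<close> meets \<open>T\<close> in
  \<open>m * card T / card W\<close> elements on average: each element of \<open>T\<close> lies in
  \<open>(card W - 1) choose (m - 1)\<close> of the subsets.\<close>

lemma sum_card_Int_subsets:
  assumes "finite W" "T \<subseteq> W" "m > 0"
  shows "(\<Sum>A | A \<subseteq> W \<and> card A = m. real (card (A \<inter> T))) * real (card W)
    = real m * real (card W choose m) * real (card T)"
proof -
  have finT: "finite T" using assms finite_subset by blast
  have finN: "finite {A. A \<subseteq> W \<and> card A = m}"
    by (rule finite_subset[of _ "Pow W"]) (use assms in auto)
  have one: "card {A. A \<subseteq> W \<and> card A = m \<and> t \<in> A} = (card W - 1) choose (m - 1)" if t: "t \<in> T" for t
  proof -
    have "bij_betw (insert t) {B. B \<subseteq> W - {t} \<and> card B = m - 1} {A. A \<subseteq> W \<and> card A = m \<and> t \<in> A}"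
    proof (rule bij_betw_byWitness[where f' = "\<lambda>A. A - {t}"])
      show "insert t ` {B. B \<subseteq> W - {t} \<and> card B = m - 1} \<subseteq> {A. A \<subseteq> W \<and> card A = m \<and> t \<in> A}"
      proof safe
        fix B assume B: "B \<subseteq> W - {t}" "card B = m - 1"
        then have "finite B" using assms finite_subset by blast
        with B assms show "card (insert t B) = m" by (subst card_insert_disjoint) auto
      qed (use assms t in auto)
      show "(\<lambda>A. A - {t}) ` {A. A \<subseteq> W \<and> card A = m \<and> t \<in> A} \<subseteq> {B. B \<subseteq> W - {t} \<and> card B = m - 1}"
        by (auto simp: card_Diff_singleton)
    qed auto
    then have "card {A. A \<subseteq> W \<and> card A = m \<and> t \<in> A} = card {B. B \<subseteq> W - {t} \<and> card B = m - 1}"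
      by (simp add: bij_betw_same_card)
    also have "\<dots> = (card W - 1) choose (m - 1)"
      using assms t by (subst n_subsets) (auto simp: card_Diff_singleton)
    finally show ?thesis .
  qed
  have "(\<Sum>A | A \<subseteq> W \<and> card A = m. real (card (A \<inter> T)))
    = (\<Sum>A | A \<subseteq> W \<and> card A = m. \<Sum>t\<in>T. of_bool (t \<in> A))"
    using finT by (intro sum.cong refl) (simp add: of_bool_def sum.If_cases Int_commute)
  also have "\<dots> = (\<Sum>t\<in>T. \<Sum>A | A \<subseteq> W \<and> card A = m. of_bool (t \<in> A))" by (rule sum.swap)
  also have "\<dots> = (\<Sum>t\<in>T. real ((card W - 1) choose (m - 1)))"
  proof (rule sum.cong[OF refl])
    fix t assume "t \<in> T"
    have "{A. A \<subseteq> W \<and> card A = m} \<inter> {A. t \<in> A} = {A. A \<subseteq> W \<and> card A = m \<and> t \<in> A}" by auto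
    then show "(\<Sum>A | A \<subseteq> W \<and> card A = m. of_bool (t \<in> A)) = real ((card W - 1) choose (m - 1))"
      using finN one[OF \<open>t \<in> T\<close>] by (simp add: of_bool_def sum.If_cases)
  qed
  finally show ?thesis
    using times_binomial_minus1_eq[OF assms(3), of "card W"]
    by (simp add: algebra_simps flip: of_nat_mult)
qed

text \<open>Factor by factor: each \<open>i < m\<close> is at most half of
  \<open>\<eta> * w\<close>, whence \<open>\<eta> / 2\<close> instead of \<eta>.\<close>

lemma binomial_ratio:
  assumes \<eta>: "0 \<le> \<eta>" "\<eta> \<le> 1" and w: "\<eta> * real w \<le> real w'" and m: "real m \<le> \<eta> / 2 * real w"
  shows "(\<eta> / 2) ^ m * real (w choose m) \<le> real (w' choose m)"
proof -
  have "\<eta> / 2 * real w \<le> real w'" using w mult_nonneg_nonneg[OF \<eta>(1) of_nat_0_le_iff[of w]] by simp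
  then have mw: "m \<le> w'" using m by linarith
  have "\<eta> / 2 * real w \<le> 1 * real w" using \<eta> by (intro mult_right_mono) auto
  then have mw2: "m \<le> w" using m by linarith
  have "(\<eta> / 2) ^ m * real (w choose m) = (\<Prod>i = 0..<m. \<eta> / 2 * (real (w - i) / real (m - i)))"
    unfolding binomial_altdef_of_nat[OF mw2] by (simp only: prod.distrib prod_constant card_atLeastLessThan diff_zero)
  also have "\<dots> \<le> (\<Prod>i = 0..<m. real (w' - i) / real (m - i))"
  proof (rule prod_mono, safe)
    fix i assume i: "i \<in> {0..<m}"
    have "\<eta> / 2 * real i \<ge> 0" using \<eta> by simp
    moreover have "real i \<le> \<eta> / 2 * real w" using i m by simp
    moreover have "real (w - i) = real w - real i" "real (w' - i) = real w' - real i"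
      using i mw mw2 by (auto simp: of_nat_diff)
    ultimately have "\<eta> / 2 * real (w - i) \<le> real (w' - i)"
      using w by (simp add: right_diff_distrib)
    then show "\<eta> / 2 * (real (w - i) / real (m - i)) \<le> real (w' - i) / real (m - i)"
      unfolding times_divide_eq_right by (rule divide_right_mono) simp
    show "0 \<le> \<eta> / 2 * (real (w - i) / real (m - i))" using \<eta> by simp
  qed
  also have "\<dots> = real (w' choose m)" using mw by (simp add: binomial_altdef_of_nat)
  finally show ?thesis .
qed

lemma exists_ge_average:
  fixes f :: "'a \<Rightarrow> real"
  assumes "finite D" "D \<noteq> {}" "real (card D) * c \<le> sum f D"
  obtains d where "d \<in> D" "c \<le> f d"
proof (rule ccontr)
  assume "\<not> thesis"
  then have "\<And>d. d \<in> D \<Longrightarrow> f d < c" using that by force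
  then have "sum f D < (\<Sum>d\<in>D. c)" using assms by (intro sum_strict_mono) auto
  then show False using assms by simp
qed

text \<open>A reverse Markov inequality: the values below \<open>c * M\<close> account for at most
  half of the average \<open>2 * c * M\<close>.\<close>

lemma card_large_values:
  fixes f :: "'a \<Rightarrow> real"
  assumes "finite D" "\<And>d. d \<in> D \<Longrightarrow> f d \<le> M" "0 < M" "real (card D) * (2 * c * M) \<le> sum f D" "0 \<le> c"
  shows "c * real (card D) \<le> real (card {d \<in> D. c * M \<le> f d})"
proof -
  have "real (card D) * (2 * c * M) \<le> sum f D" by fact
  also have "\<dots> \<le> (\<Sum>d\<in>D. c * M + M * of_bool (c * M \<le> f d))"
  proof (rule sum_mono)
    fix d assume "d \<in> D"
    then show "f d \<le> c * M + M * of_bool (c * M \<le> f d)"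
      using assms(2)[of d] assms(3,5) by (auto intro: add_increasing)
  qed
  also have "\<dots> = real (card D) * (c * M) + M * real (card {d \<in> D. c * M \<le> f d})"
    using assms(1) by (simp add: sum.distrib sum_distrib_left[symmetric] of_bool_def sum.If_cases Int_def)
  finally have "M * (c * real (card D)) \<le> M * real (card {d \<in> D. c * M \<le> f d})" by (simp add: algebra_simps)
  then show ?thesis using assms(3) by (rule mult_left_le_imp_le)
qed

text \<open>The Kovari-Sos-Turan count: pairs of a vertex \<open>z\<close> and an
  \<open>m\<close>-subset of its neighbourhood are counted in two ways, and some
  \<open>m\<close>-subset reaches the average.\<close>

lemma common_neighbours:
  fixes r :: "'v \<Rightarrow> 'w \<Rightarrow> bool"
  assumes fin: "finite W" "finite Z" and \<eta>: "0 \<le> \<eta>" "\<eta> \<le> 1"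
    and deg: "\<And>z. z \<in> Z \<Longrightarrow> \<eta> * real (card W) \<le> real (card {w \<in> W. r w z})"
    and m: "real m \<le> \<eta> / 2 * real (card W)"
  obtains B where "B \<subseteq> W" "card B = m" "(\<eta> / 2) ^ m * real (card Z) \<le> real (card {z \<in> Z. \<forall>b\<in>B. r b z})"
proof -
  let ?D = "{B. B \<subseteq> W \<and> card B = m}"
  have finD: "finite ?D" by (rule finite_subset[of _ "Pow W"]) (use fin in auto)
  have "\<eta> / 2 * real (card W) \<le> 1 * real (card W)" using \<eta> by (intro mult_right_mono) auto
  then have "m \<le> card W" using m by linarith
  then have neD: "?D \<noteq> {}" using obtain_subset_with_card_n by blast
  have cD: "card ?D = card W choose m" using fin by (simp add: n_subsets)
  have "real (card ?D) * ((\<eta> / 2) ^ m * real (card Z)) = (\<Sum>z\<in>Z. (\<eta> / 2) ^ m * real (card W choose m))"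
    by (simp add: cD)
  also have "\<dots> \<le> (\<Sum>z\<in>Z. real (card {w \<in> W. r w z} choose m))"
    by (intro sum_mono binomial_ratio \<eta> deg m)
  also have "\<dots> = (\<Sum>z\<in>Z. \<Sum>B\<in>?D. of_bool (\<forall>b\<in>B. r b z))"
  proof (rule sum.cong[OF refl])
    fix z
    have "?D \<inter> {B. \<forall>b\<in>B. r b z} = {B. B \<subseteq> {w \<in> W. r w z} \<and> card B = m}" by auto
    moreover have "card {B. B \<subseteq> {w \<in> W. r w z} \<and> card B = m} = card {w \<in> W. r w z} choose m"
      using fin by (intro n_subsets) auto
    ultimately show "real (card {w \<in> W. r w z} choose m) = (\<Sum>B\<in>?D. of_bool (\<forall>b\<in>B. r b z))"
      using finD by (simp add: of_bool_def sum.If_cases)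
  qed
  also have "\<dots> = (\<Sum>B\<in>?D. real (card {z \<in> Z. \<forall>b\<in>B. r b z}))"
    using fin by (subst sum.swap) (simp add: of_bool_def sum.If_cases Int_def)
  finally obtain B where "B \<in> ?D" "(\<eta> / 2) ^ m * real (card Z) \<le> real (card {z \<in> Z. \<forall>b\<in>B. r b z})"
    by (rule exists_ge_average[OF finD neD])
  then show ?thesis using that by auto
qed

text \<open>Here the pair \<open>uv\<close> becomes free. Choosing \<open>A\<close> inside the
  neighbourhood of \<open>v\<close> makes it complete to \<open>v\<close> without cutting it down;
  this only thins out the supply of \<open>v\<close>, by the factor
  \<open>(\<omega> / 4) ^ m\<close>. The difficulty is that \<open>A\<close> must also keep many
  neighbours of suitable \<open>c\<close>. By the two bounds, at least a proportion
  \<open>p / 4\<close> of the weighted paths \<open>y\<close>, \<open>v\<close>, \<open>c\<close>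
  close to a triangle, so a random \<open>A\<close> in the neighbourhood of a typical
  \<open>v\<close> still meets the neighbourhoods of many \<open>c\<close> in a proportion
  \<open>p / 8\<close>.\<close>

lemma weighted_common_neighbours:
  fixes \<Psi> :: "'v \<Rightarrow> 'w \<Rightarrow> real" and ruv :: "'u \<Rightarrow> 'v \<Rightarrow> bool" and ruz :: "'u \<Rightarrow> 'w \<Rightarrow> bool"
    and rvz :: "'v \<Rightarrow> 'w \<Rightarrow> bool"
  assumes fin: "finite W" "finite V" "finite Z" and ne: "W \<noteq> {}" "Z \<noteq> {}"
    and \<Psi>: "\<And>v c. 0 \<le> \<Psi> v c" "\<And>v c. \<Psi> v c \<le> 1" and p: "0 \<le> p" and m: "0 < m"
    and lower: "\<And>y. y \<in> W \<Longrightarrow> p * q / 2 * h \<le> (\<Sum>v\<in>V. \<Sum>c\<in>Z. \<Psi> v c * of_bool (ruv y v \<and> ruz y c \<and> rvz v c))"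
    and upper: "\<And>y. y \<in> W \<Longrightarrow> (\<Sum>v\<in>V. \<Sum>c\<in>Z. \<Psi> v c * of_bool (ruv y v \<and> rvz v c)) \<le> 2 * q * h"
    and \<omega>: "0 < \<omega>" "\<omega> \<le> 1" "\<omega> * (real (card V) * real (card Z)) \<le> p * q / 4 * h"
    and mW: "real m \<le> \<omega> / 4 * real (card W)"
  obtains A V' where "A \<subseteq> W" "card A = m" "V' \<subseteq> V"
    "\<omega>\<^sup>2 / 8 * (\<omega> / 4) ^ m * real (card V) \<le> real (card V')"
    "\<And>v a. v \<in> V' \<Longrightarrow> a \<in> A \<Longrightarrow> ruv a v"
    "\<And>v. v \<in> V' \<Longrightarrow> \<omega> / 4 * real (card Z) \<le>
      (\<Sum>c\<in>Z. \<Psi> v c * of_bool (rvz v c \<and> p / 8 * real m \<le> real (card {a \<in> A. ruz a c})))"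
proof -
  define Wv where "Wv v = {y \<in> W. ruv y v}" for v
  define N where "N c = {y \<in> W. ruz y c}" for c
  \<comment> \<open>The excess of the edges between \<open>A\<close> and the \<open>c\<close>
    adjacent to \<open>v\<close> over density \<open>p / 8\<close>, half of the expected
    \<open>p / 4\<close>. It is linear in the indicator of \<open>A\<close>, so its mean over random
    \<open>m\<close>-subsets can be computed, and large excess forces many \<open>c\<close> with
    \<open>p / 8 * m\<close> neighbours in \<open>A\<close>.\<close>
  define f where "f v A = (\<Sum>c\<in>Z. \<Psi> v c * of_bool (rvz v c) * (real (card (A \<inter> N c)) - p / 8 * real (card A)))" for v A
  define w where "w = real (card W)"
  define z where "z = real (card Z)"
  have w: "0 < w" and z: "0 < z" using fin ne by (auto simp: w_def z_def card_gt_0_iff)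
  have f_le: "f v A \<le> real (card A) * z" if "finite A" for v A
  proof -
    have "f v A \<le> (\<Sum>c\<in>Z. 1 * real (card A))"
      unfolding f_def
    proof (rule sum_mono)
      fix c
      have "card (A \<inter> N c) \<le> card A" using that by (intro card_mono) auto
      moreover have "0 \<le> p / 8 * real (card A)" using p by simp
      ultimately have "real (card (A \<inter> N c)) - p / 8 * real (card A) \<le> real (card A)" by linarith
      then have "\<Psi> v c * of_bool (rvz v c) * (real (card (A \<inter> N c)) - p / 8 * real (card A))
         \<le> \<Psi> v c * of_bool (rvz v c) * real (card A)"
        using \<Psi> by (intro mult_left_mono) auto
      also have "\<dots> \<le> 1 * real (card A)" using \<Psi> by (intro mult_right_mono) auto
      finally show "\<Psi> v c * of_bool (rvz v c) * (real (card (A \<inter> N c)) - p / 8 * real (card A)) \<le> 1 * real (card A)" .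
    qed
    then show ?thesis by (simp add: z_def mult.commute)
  qed
  have cWv: "real (card (Wv v)) = (\<Sum>y\<in>W. of_bool (ruv y v))" for v
    using fin by (simp add: Wv_def of_bool_def sum.If_cases Int_def)
  have cWvN: "real (card (Wv v \<inter> N c)) = (\<Sum>y\<in>W. of_bool (ruv y v \<and> ruz y c))" for v c
  proof -
    have "Wv v \<inter> N c = {y \<in> W. ruv y v \<and> ruz y c}" by (auto simp: Wv_def N_def)
    then show ?thesis using fin by (simp add: of_bool_def sum.If_cases Int_def)
  qed
  have fW: "f v (Wv v) = (\<Sum>y\<in>W. (\<Sum>c\<in>Z. \<Psi> v c * of_bool (ruv y v \<and> ruz y c \<and> rvz v c))
      - p / 8 * (\<Sum>c\<in>Z. \<Psi> v c * of_bool (ruv y v \<and> rvz v c)))" for v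
  proof -
    have "f v (Wv v) = (\<Sum>c\<in>Z. \<Sum>y\<in>W. \<Psi> v c * of_bool (rvz v c) * (of_bool (ruv y v \<and> ruz y c) - p / 8 * of_bool (ruv y v)))"
      unfolding f_def cWvN cWv by (simp add: sum_distrib_left sum_subtractf right_diff_distrib)
    also have "\<dots> = (\<Sum>y\<in>W. \<Sum>c\<in>Z. \<Psi> v c * of_bool (rvz v c) * (of_bool (ruv y v \<and> ruz y c) - p / 8 * of_bool (ruv y v)))"
      by (rule sum.swap)
    also have "\<dots> = (\<Sum>y\<in>W. \<Sum>c\<in>Z. \<Psi> v c * of_bool (ruv y v \<and> ruz y c \<and> rvz v c)
      - p / 8 * (\<Psi> v c * of_bool (ruv y v \<and> rvz v c)))"
      by (intro sum.cong refl) (auto simp: algebra_simps)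
    finally show ?thesis by (simp add: sum_subtractf sum_distrib_left)
  qed
  \<comment> \<open>Taken at the full neighbourhoods \<open>Wv v\<close> and summed over
    \<open>v\<close>, each \<open>y\<close> contributes at least
    \<open>p * q / 2 * h - p / 8 * (2 * q * h) = p * q / 4 * h\<close>.\<close>
  have "w * (\<omega> * (real (card V) * z)) \<le> (\<Sum>y\<in>W. p * q / 4 * h)"
    using \<omega>(3) w by (simp add: w_def z_def mult_left_mono)
  also have "\<dots> \<le> (\<Sum>y\<in>W. (\<Sum>v\<in>V. \<Sum>c\<in>Z. \<Psi> v c * of_bool (ruv y v \<and> ruz y c \<and> rvz v c))
      - p / 8 * (\<Sum>v\<in>V. \<Sum>c\<in>Z. \<Psi> v c * of_bool (ruv y v \<and> rvz v c)))"
  proof (rule sum_mono)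
    fix y assume y: "y \<in> W"
    have "p / 8 * (\<Sum>v\<in>V. \<Sum>c\<in>Z. \<Psi> v c * of_bool (ruv y v \<and> rvz v c)) \<le> p / 8 * (2 * q * h)"
      using upper[OF y] p by (intro mult_left_mono) auto
    with lower[OF y] show "p * q / 4 * h \<le> (\<Sum>v\<in>V. \<Sum>c\<in>Z. \<Psi> v c * of_bool (ruv y v \<and> ruz y c \<and> rvz v c))
      - p / 8 * (\<Sum>v\<in>V. \<Sum>c\<in>Z. \<Psi> v c * of_bool (ruv y v \<and> rvz v c))" by (simp add: algebra_simps)
  qed
  also have "\<dots> = (\<Sum>v\<in>V. f v (Wv v))"
    unfolding fW by (subst sum.swap) (simp add: sum_subtractf sum_distrib_left sum.swap[of _ V W])
  finally have tot: "real (card V) * (2 * (\<omega> / 2) * (w * z)) \<le> (\<Sum>v\<in>V. f v (Wv v))"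
    by (simp add: algebra_simps)
  define V1 where "V1 = {v \<in> V. \<omega> / 2 * (w * z) \<le> f v (Wv v)}"
  have cW_le: "real (card (Wv v)) \<le> w" for v
    unfolding w_def of_nat_le_iff Wv_def by (intro card_mono fin) auto
  have finW: "finite (Wv v)" for v using fin by (simp add: Wv_def)
  have V1: "\<omega> / 2 * real (card V) \<le> real (card V1)"
    unfolding V1_def
  proof (rule card_large_values[OF fin(2) _ _ tot])
    show "f v (Wv v) \<le> w * z" for v
      using f_le[OF finW, of v] cW_le[of v] z by (meson mult_right_mono less_imp_le order_trans)
  qed (use w z \<omega> in auto)
  let ?D = "\<lambda>W. {A. A \<subseteq> W \<and> card A = m}"
  have finD: "finite (?D U)" if "finite U" for U :: "'u set"
    by (rule finite_subset[of _ "Pow U"]) (use that in auto)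
  \<comment> \<open>The mean excess of an \<open>m\<close>-subset of \<open>Wv v\<close> is
    \<open>m / card (Wv v)\<close> times that of \<open>Wv v\<close>, so a proportion
    \<open>\<omega> / 4\<close> of these subsets is good. As \<open>Wv v\<close> has density at
    least \<open>\<omega> / 2\<close> in \<open>W\<close>, they are numerous among all
    \<open>m\<close>-subsets of \<open>W\<close>.\<close>
  have many: "\<omega> / 4 * ((\<omega> / 4) ^ m * real (card W choose m)) \<le>
      real (card {A \<in> ?D (Wv v). \<omega> / 4 * (real m * z) \<le> f v A})" if v: "v \<in> V1" for v
  proof -
    have fv: "\<omega> / 2 * (w * z) \<le> f v (Wv v)" using v by (simp add: V1_def)
    also have "\<dots> \<le> real (card (Wv v)) * z" by (rule f_le[OF finW])
    finally have "(\<omega> / 2 * w) * z \<le> real (card (Wv v)) * z" by simp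
    then have deg: "\<omega> / 2 * w \<le> real (card (Wv v))" using z by (rule mult_right_le_imp_le)
    then have wv: "0 < real (card (Wv v))" using \<omega> w by (smt (verit) mult_pos_pos half_gt_zero)
    have "(\<Sum>A\<in>?D (Wv v). f v A) * real (card (Wv v)) = (\<Sum>c\<in>Z. \<Psi> v c * of_bool (rvz v c) *
        ((\<Sum>A\<in>?D (Wv v). real (card (A \<inter> (Wv v \<inter> N c)))) * real (card (Wv v))
         - p / 8 * real m * real (card (?D (Wv v))) * real (card (Wv v))))"
    proof -
      have AA: "A \<inter> (Wv v \<inter> N c) = A \<inter> N c" if "A \<in> ?D (Wv v)" for A c using that by auto
      have "(\<Sum>A\<in>?D (Wv v). f v A) = (\<Sum>c\<in>Z. \<Sum>A\<in>?D (Wv v). \<Psi> v c * of_bool (rvz v c) * (real (card (A \<inter> (Wv v \<inter> N c))) - p / 8 * real m))"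
        unfolding f_def by (subst sum.swap) (intro sum.cong refl, simp add: AA)
      also have "\<dots> = (\<Sum>c\<in>Z. \<Psi> v c * of_bool (rvz v c) * ((\<Sum>A\<in>?D (Wv v). real (card (A \<inter> (Wv v \<inter> N c)))) - p / 8 * real m * real (card (?D (Wv v)))))"
        by (intro sum.cong refl) (simp add: sum_distrib_left[symmetric] sum_subtractf)
      finally have eq0: "(\<Sum>A\<in>?D (Wv v). f v A) = \<dots>" .
      show ?thesis
        unfolding eq0 by (subst sum_distrib_right) (intro sum.cong refl, simp add: algebra_simps)
    qed
    also have "\<dots> = (\<Sum>c\<in>Z. \<Psi> v c * of_bool (rvz v c) *
        (real m * real (card (Wv v) choose m) * real (card (Wv v \<inter> N c))
         - p / 8 * real m * real (card (Wv v) choose m) * real (card (Wv v))))"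
      using finW m by (simp add: sum_card_Int_subsets n_subsets)
    also have "\<dots> = real m * real (card (Wv v) choose m) * f v (Wv v)"
      unfolding f_def sum_distrib_left by (intro sum.cong refl) (simp add: algebra_simps)
    finally have eq: "(\<Sum>A\<in>?D (Wv v). f v A) * real (card (Wv v)) = real m * real (card (Wv v) choose m) * f v (Wv v)" .
    have cD: "card (?D (Wv v)) = card (Wv v) choose m" using finW by (simp add: n_subsets)
    have "real (card (?D (Wv v))) * (2 * (\<omega> / 4) * (real m * z)) * real (card (Wv v))
        \<le> real m * real (card (Wv v) choose m) * (\<omega> / 2 * (real (card (Wv v)) * z))"
      by (simp add: cD)
    also have "\<dots> \<le> real m * real (card (Wv v) choose m) * (\<omega> / 2 * (w * z))"
      using cW_le[of v] \<omega> z by (intro mult_left_mono mult_right_mono) auto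
    also have "\<dots> \<le> real m * real (card (Wv v) choose m) * f v (Wv v)"
      using fv by (intro mult_left_mono) auto
    also note eq[symmetric]
    finally have "real (card (?D (Wv v))) * (2 * (\<omega> / 4) * (real m * z)) \<le> (\<Sum>A\<in>?D (Wv v). f v A)"
      using wv by (rule mult_right_le_imp_le)
    then have "\<omega> / 4 * real (card (?D (Wv v))) \<le> real (card {A \<in> ?D (Wv v). \<omega> / 4 * (real m * z) \<le> f v A})"
    proof (rule card_large_values[OF finD[OF finW], rotated 2])
      fix A assume "A \<in> ?D (Wv v)"
      then have "finite A" "card A = m" using finW finite_subset by blast+
      then show "f v A \<le> real m * z" using f_le[of A v] by simp
    qed (use m z \<omega> in auto)
    moreover have "\<omega> / 4 * ((\<omega> / 2 / 2) ^ m * real (card W choose m)) \<le> \<omega> / 4 * real (card (Wv v) choose m)"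
      using deg \<omega> mW by (intro mult_left_mono binomial_ratio) (auto simp: w_def)
    ultimately show ?thesis by (simp add: cD)
  qed
  have "card (?D W) = card W choose m" using fin by (simp add: n_subsets)
  have "\<omega> / 4 * real (card W) \<le> 1 * real (card W)" using \<omega> by (intro mult_right_mono) auto
  then have "m \<le> card W" using mW by linarith
  then have neD: "?D W \<noteq> {}" using obtain_subset_with_card_n by blast
  define good where "good A v \<longleftrightarrow> A \<subseteq> Wv v \<and> \<omega> / 4 * (real m * z) \<le> f v A" for A v
  have finV1: "finite V1" using fin by (simp add: V1_def)
  \<comment> \<open>Good pairs are now averaged over \<open>A\<close> instead of \<open>v\<close>:
    some \<open>A\<close> is good for many \<open>v\<close>, which form \<open>V'\<close>.\<close>
  have "real (card (?D W)) * (\<omega>\<^sup>2 / 8 * (\<omega> / 4) ^ m * real (card V))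
      = (\<omega> / 2 * real (card V)) * (\<omega> / 4 * ((\<omega> / 4) ^ m * real (card W choose m)))"
    using fin by (simp add: n_subsets power2_eq_square)
  also have "\<dots> \<le> real (card V1) * (\<omega> / 4 * ((\<omega> / 4) ^ m * real (card W choose m)))"
    using V1 \<omega> by (intro mult_right_mono) auto
  also have "\<dots> \<le> (\<Sum>v\<in>V1. real (card {A \<in> ?D (Wv v). \<omega> / 4 * (real m * z) \<le> f v A}))"
    using sum_mono[of V1 "\<lambda>_. \<omega> / 4 * ((\<omega> / 4) ^ m * real (card W choose m))"] many by simp
  also have "\<dots> = (\<Sum>v\<in>V1. \<Sum>A\<in>?D W. of_bool (good A v))"
  proof (rule sum.cong[OF refl])
    fix v
    have "?D W \<inter> {A. good A v} = {A \<in> ?D (Wv v). \<omega> / 4 * (real m * z) \<le> f v A}"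
      by (auto simp: good_def Wv_def)
    then show "real (card {A \<in> ?D (Wv v). \<omega> / 4 * (real m * z) \<le> f v A}) = (\<Sum>A\<in>?D W. of_bool (good A v))"
      using finD[OF fin(1)] by (simp add: of_bool_def sum.If_cases)
  qed
  also have "\<dots> = (\<Sum>A\<in>?D W. real (card {v \<in> V1. good A v}))"
    using finV1 by (subst sum.swap) (simp add: of_bool_def sum.If_cases Int_def)
  finally obtain A where A: "A \<in> ?D W" and big: "\<omega>\<^sup>2 / 8 * (\<omega> / 4) ^ m * real (card V) \<le> real (card {v \<in> V1. good A v})"
    by (rule exists_ge_average[OF finD[OF fin(1)] neD])
  show ?thesis
  proof (rule that[of A "{v \<in> V1. good A v}"])
    show "ruv a v" if "v \<in> {v \<in> V1. good A v}" "a \<in> A" for v a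
      using that by (auto simp: good_def Wv_def)
    fix v assume "v \<in> {v \<in> V1. good A v}"
    then have "\<omega> / 4 * (real m * z) \<le> f v A" by (simp add: good_def)
    also have "\<dots> \<le> (\<Sum>c\<in>Z. real m * (\<Psi> v c * of_bool (rvz v c \<and> p / 8 * real m \<le> real (card {a \<in> A. ruz a c}))))"
      unfolding f_def
    proof (rule sum_mono)
      fix c
      have AN: "A \<inter> N c = {a \<in> A. ruz a c}" using A by (auto simp: N_def)
      have finA: "finite A" using A fin finite_subset by blast
      have "card {a \<in> A. ruz a c} \<le> card A" using finA by (intro card_mono) auto
      then have "real (card {a \<in> A. ruz a c}) - p / 8 * real m \<le> real m * of_bool (p / 8 * real m \<le> real (card {a \<in> A. ruz a c}))"
        using A mult_nonneg_nonneg[OF p of_nat_0_le_iff[of m]] by (cases "p / 8 * real m \<le> real (card {a \<in> A. ruz a c})") simp_all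
      then have "\<Psi> v c * of_bool (rvz v c) * (real (card {a \<in> A. ruz a c}) - p / 8 * real m) \<le>
         \<Psi> v c * of_bool (rvz v c) * (real m * of_bool (p / 8 * real m \<le> real (card {a \<in> A. ruz a c})))"
        using \<Psi> by (intro mult_left_mono) auto
      then show "\<Psi> v c * of_bool (rvz v c) * (real (card (A \<inter> N c)) - p / 8 * real (card A)) \<le>
          real m * (\<Psi> v c * of_bool (rvz v c \<and> p / 8 * real m \<le> real (card {a \<in> A. ruz a c})))"
        using A by (simp add: AN of_bool_conj algebra_simps)
    qed
    finally have "real m * (\<omega> / 4 * z) \<le> real m * (\<Sum>c\<in>Z. \<Psi> v c * of_bool (rvz v c \<and> p / 8 * real m \<le> real (card {a \<in> A. ruz a c})))"
      by (simp add: sum_distrib_left algebra_simps)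
    then show "\<omega> / 4 * real (card Z) \<le> (\<Sum>c\<in>Z. \<Psi> v c * of_bool (rvz v c \<and> p / 8 * real m \<le> real (card {a \<in> A. ruz a c})))"
      unfolding z_def[symmetric] by (rule mult_left_le_imp_le) (use m in simp)
  qed (use A big in \<open>auto simp: V1_def\<close>)
qed

section \<open>Embedding a blowup into a regular system\<close>

text \<open>A part pays only for vertices treated after it, hence the product over
  \<open>Suc i..<n\<close> in the hypothesis. The conditions with exponent \<open>n\<close> imply
  those of all steps at once.\<close>

lemma embed_prefix:
  fixes E :: "nat \<Rightarrow> nat \<Rightarrow> 'v \<Rightarrow> 'v \<Rightarrow> bool" and s \<beta> \<epsilon> :: real
  assumes rs: "regular_system {..<n} E X p \<epsilon>" and u: "u \<le> n" and m: "0 < m"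
    and s: "0 < s" "s \<le> 1" "\<And>i. i < u \<Longrightarrow> s \<le> (\<Prod>k\<in>{Suc i..<n}. p i k)"
    and \<beta>: "\<And>f. s / 4 \<le> f \<Longrightarrow> f \<le> 1 \<Longrightarrow> \<beta> \<le> amp R Q f" "0 < \<beta>" "\<beta> \<le> 1"
    and small: "((1 + 2 ^ R) ^ Q) ^ n * real n * \<epsilon> \<le> s * ((s * \<beta> / 8) ^ n)\<^sup>2 / 32"
    and large: "\<And>i. i < u \<Longrightarrow> m * 2 ^ (m * n) \<le> (s * \<beta> / 8) ^ n / 4 * real (card (X i))"
  obtains \<tau> where "\<And>j. j < u \<Longrightarrow> \<tau> j \<subseteq> X j" "\<And>j. j < u \<Longrightarrow> card (\<tau> j) \<le> m"
    "\<And>j k a b. j < k \<Longrightarrow> k < u \<Longrightarrow> a \<in> \<tau> j \<Longrightarrow> b \<in> \<tau> k \<Longrightarrow> E j k a b"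
    "(s * \<beta> / 8) ^ u * (\<Prod>l\<in>{u..<n}. real (card (X l))) \<le> (\<Sum>x\<in>PiE {u..<n} X. weight E m R Q {..<u} {u..<n} \<tau> x)"
proof -
  interpret regular_system "{..<n}" E X p \<epsilon> by fact
  define c where "c = s * \<beta> / 8"
  have c: "0 < c" "c \<le> 1" using s \<beta> mult_le_one[of s \<beta>] by (auto simp: c_def)
  have "\<exists>\<tau>. (\<forall>j<i. \<tau> j \<subseteq> X j \<and> card (\<tau> j) \<le> m) \<and>
      (\<forall>j k a b. j < k \<longrightarrow> k < i \<longrightarrow> a \<in> \<tau> j \<longrightarrow> b \<in> \<tau> k \<longrightarrow> E j k a b) \<and>
      c ^ i * (\<Prod>l\<in>{i..<n}. real (card (X l))) \<le> (\<Sum>x\<in>PiE {i..<n} X. weight E m R Q {..<i} {i..<n} \<tau> x)"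
    if "i \<le> u" for i
    using that
  proof (induction i)
    case 0
    have "(\<Sum>x\<in>PiE {0..<n} X. weight E m R Q {} {0..<n} (\<lambda>_. {}) x) = (\<Prod>l\<in>{0..<n}. real (card (X l)))"
      by (simp add: weight_def card_PiE)
    then show ?case by (intro exI[of _ "\<lambda>_. {}"]) simp
  next
    case (Suc i)
    then have i: "i < u" "i < n" using u by auto
    obtain \<tau> where IH: "\<forall>j<i. \<tau> j \<subseteq> X j \<and> card (\<tau> j) \<le> m"
        "\<forall>j k a b. j < k \<longrightarrow> k < i \<longrightarrow> a \<in> \<tau> j \<longrightarrow> b \<in> \<tau> k \<longrightarrow> E j k a b"
        "c ^ i * (\<Prod>l\<in>{i..<n}. real (card (X l))) \<le> (\<Sum>x\<in>PiE {i..<n} X. weight E m R Q {..<i} {i..<n} \<tau> x)"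
      using Suc.IH[OF Suc_leD[OF Suc.prems]] by (elim exE conjE) (rule that)
    have \<tau>: "\<And>j. j < i \<Longrightarrow> \<tau> j \<subseteq> X j" "\<And>j. j < i \<Longrightarrow> card (\<tau> j) \<le> m"
        "\<And>j k a b. j < k \<Longrightarrow> k < i \<Longrightarrow> a \<in> \<tau> j \<Longrightarrow> b \<in> \<tau> k \<Longrightarrow> E j k a b"
      using IH(1,2) by simp_all
    note \<tau> = \<tau> IH(3)
    have ins: "insert i {Suc i..<n} = {i..<n}" using i by auto
    have cni: "c ^ n \<le> c ^ i" using c i by (intro power_decreasing) auto
    have a1: "k \<in> {Suc i..<n} \<Longrightarrow> i < k" for k by simp
    have a2: "insert i {Suc i..<n} \<subseteq> {..<n}" using i by auto
    have a3: "finite (\<tau> j) \<and> card (\<tau> j) \<le> m" if "j \<in> {..<i}" for j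
      using that \<tau>(1,2)[of j] finX[of j] i finite_subset by auto
    have a4: "real (card {Suc i..<n}) \<le> real n" by simp
    have a5: "c ^ i * (\<Prod>l\<in>insert i {Suc i..<n}. real (card (X l))) \<le>
      (\<Sum>x\<in>PiE (insert i {Suc i..<n}) X. weight E m R Q {..<i} (insert i {Suc i..<n}) \<tau> x)"
      using \<tau>(4) unfolding ins .
    have a6: "((1 + 2 ^ R) ^ Q) ^ card {..<i} * real n * \<epsilon> \<le> s * (c ^ i)\<^sup>2 / 32"
    proof -
      have "((1 + 2 ^ R) ^ Q) ^ i * (real n * \<epsilon>) \<le> ((1 + 2 ^ R) ^ Q) ^ n * (real n * \<epsilon>)"
        using i \<epsilon>_nonneg by (intro mult_right_mono power_increasing one_le_power) auto
      also have "\<dots> \<le> s * (c ^ n)\<^sup>2 / 32" using small by (simp add: c_def mult.assoc)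
      also have "\<dots> \<le> s * (c ^ i)\<^sup>2 / 32" using cni s c by (intro divide_right_mono mult_left_mono power_mono) auto
      finally show ?thesis by (simp add: mult.assoc)
    qed
    have a0: "i \<notin> {..<i}" by simp
    have c0: "0 < c ^ i" using c by simp
    have a7: "real m * 2 ^ (m * card {..<i}) \<le> c ^ i / 4 * real (card (X i))"
    proof -
      have "m * 2 ^ (m * i) \<le> m * 2 ^ (m * n)" using i by (intro mult_left_mono power_increasing) auto
      then have "real (m * 2 ^ (m * i)) \<le> real (m * 2 ^ (m * n))" by (rule of_nat_mono)
      also have "\<dots> \<le> c ^ n / 4 * real (card (X i))" using large[OF i(1)] by (simp add: c_def)
      also have "\<dots> \<le> c ^ i / 4 * real (card (X i))" using cni by (intro mult_right_mono divide_right_mono) auto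
      finally show ?thesis by simp
    qed
    obtain \<tau>' where \<tau>': "\<And>j. j \<in> {..<i} \<Longrightarrow> \<tau>' j \<subseteq> \<tau> j" "\<tau>' i \<subseteq> X i" "card (\<tau>' i) = m"
      "\<And>j a b. j \<in> {..<i} \<Longrightarrow> a \<in> \<tau>' j \<Longrightarrow> b \<in> \<tau>' i \<Longrightarrow> E j i a b"
      "c ^ i * (s * \<beta> / 8) * (\<Prod>l\<in>{Suc i..<n}. real (card (X l))) \<le>
        (\<Sum>x\<in>PiE {Suc i..<n} X. weight E m R Q (insert i {..<i}) {Suc i..<n} \<tau>' x)"
      by (rule embed_step[OF a1 a2 m finite_lessThan a0 a3 a4 s(1) s(3)[OF i(1)] c0 a5 a6 a7 \<beta>(1) less_imp_le[OF \<beta>(2)]];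
          (assumption | (rule that; assumption)))
    have "\<tau>' j \<subseteq> X j \<and> card (\<tau>' j) \<le> m" if "j < Suc i" for j
    proof (cases "j = i")
      case False
      then have "j < i" using that by simp
      then show ?thesis using \<tau>'(1)[of j] a3[of j] \<tau>(1)[of j] card_mono[of "\<tau> j" "\<tau>' j"] by auto
    qed (use \<tau>' in auto)
    moreover have "E j k a b" if "j < k" "k < Suc i" "a \<in> \<tau>' j" "b \<in> \<tau>' k" for j k a b
    proof (cases "k = i")
      case False
      then have "k < i" "j < i" using that by auto
      then show ?thesis using that \<tau>'(1)[of j] \<tau>'(1)[of k] \<tau>(3)[of j k a b] by auto
    qed (use that \<tau>' in auto)
    moreover have "c ^ Suc i * (\<Prod>l\<in>{Suc i..<n}. real (card (X l))) \<le>
        (\<Sum>x\<in>PiE {Suc i..<n} X. weight E m R Q {..<Suc i} {Suc i..<n} \<tau>' x)"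
      using \<tau>'(5) unfolding lessThan_Suc by (simp add: c_def mult.commute mult.left_commute)
    ultimately show ?case by blast
  qed
  from this[OF order_refl] obtain \<tau> where
    "\<forall>j<u. \<tau> j \<subseteq> X j \<and> card (\<tau> j) \<le> m" "\<forall>j k a b. j < k \<longrightarrow> k < u \<longrightarrow> a \<in> \<tau> j \<longrightarrow> b \<in> \<tau> k \<longrightarrow> E j k a b"
    "c ^ u * (\<Prod>l\<in>{u..<n}. real (card (X l))) \<le> (\<Sum>x\<in>PiE {u..<n} X. weight E m R Q {..<u} {u..<n} \<tau> x)"
    by (elim exE conjE) (rule that)
  then show ?thesis unfolding c_def by (intro that[of \<tau>]) simp_all
qed

text \<open>The last three vertices are \<open>u\<close>, \<open>v = u + 1\<close> and
  \<open>z = u + 2\<close>. The part \<open>A\<close> of \<open>u\<close> is complete to the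
  candidates for \<open>v\<close> and is cut down only at \<open>z\<close>, to
  \<open>p u z / 8\<close> of its size; the part of \<open>v\<close> is complete to the remaining
  candidates for \<open>z\<close>. Each earlier part keeps \<open>r * m\<close> vertices because the
  vertices finally chosen for \<open>z\<close> have weight at least
  \<open>\<omega> / 16\<close>.\<close>

lemma embed:
  fixes E :: "nat \<Rightarrow> nat \<Rightarrow> 'v \<Rightarrow> 'v \<Rightarrow> bool" and s \<beta> \<epsilon> q M :: real
  defines "\<sigma> \<equiv> \<lambda>n. (s * \<beta> / 8) ^ n" and "\<omega> \<equiv> \<lambda>n. q * (s * \<beta> / 8) ^ n / 8"
  assumes rs: "regular_system {..<n} E X p \<epsilon>" and n: "n = u + 3" and m: "0 < m" and t: "t \<le> m"
    and s: "0 < s" "s \<le> 1" "\<And>i. i < u \<Longrightarrow> s \<le> (\<Prod>k\<in>{Suc i..<n}. p i k)" "s \<le> p u (u + 2)"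
    and q: "0 < q" "q \<le> p u (u + 1) * p u (u + 2) * p (u + 1) (u + 2)"
    and \<beta>: "\<And>f. s / 4 \<le> f \<Longrightarrow> f \<le> 1 \<Longrightarrow> \<beta> \<le> amp R Q f" "0 < \<beta>" "\<beta> \<le> 1"
    and r: "\<And>f. 0 \<le> f \<Longrightarrow> f \<le> 1 \<Longrightarrow> \<omega> n / 16 \<le> amp R Q f \<Longrightarrow> r \<le> f"
    and small: "((1 + 2 ^ R) ^ Q) ^ n * real n * \<epsilon> \<le> s * q * (\<sigma> n)\<^sup>2 / 32"
    and M: "\<And>i. i < n \<Longrightarrow> M \<le> real (card (X i))"
    and large: "real (m * 2 ^ (m * n)) \<le> (\<omega> n / 32) ^ (m + 4) * M"
  obtains A where "\<And>j. j < n \<Longrightarrow> A j \<subseteq> X j"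
    "\<And>j k a b. j < k \<Longrightarrow> k < n \<Longrightarrow> a \<in> A j \<Longrightarrow> b \<in> A k \<Longrightarrow> E j k a b"
    "\<And>j. j < n \<Longrightarrow> min (real t) (min r (s / 8) * real m) \<le> real (card (A j))"
proof -
  interpret regular_system "{..<n}" E X p \<epsilon> by fact
  define v where "v = u + 1"
  define z where "z = u + 2"
  define \<sigma>n where "\<sigma>n = \<sigma> n"
  define w where "w = \<omega> n"
  have uvz: "u < v" "v < z" "z < n" "{u..<n} = {u, v, z}" using n by (auto simp: v_def z_def)
  have pr: "(u, v) \<in> pairs {..<n}" "(u, z) \<in> pairs {..<n}" "(v, z) \<in> pairs {..<n}"
    using uvz by (auto simp: pairs_def)
  note pb = p_nonneg[OF pr(1)] p_nonneg[OF pr(2)] p_nonneg[OF pr(3)] p_le_1[OF pr(1)] p_le_1[OF pr(2)] p_le_1[OF pr(3)]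
  have q': "q \<le> p u z * (p u v * p v z)" using q(2) by (simp add: v_def z_def mult.commute mult.left_commute)
  have q'': "q \<le> p u v * p v z"
    using q' pb by (meson mult_left_le_one_le mult_nonneg_nonneg order_trans)
  have q1: "q \<le> 1" using q'' pb by (meson mult_le_one order_trans)
  have c: "0 < s * \<beta> / 8" "s * \<beta> / 8 \<le> 1 / 8" using s \<beta> mult_le_one[of s \<beta>] by auto
  have \<sigma>n: "0 < \<sigma>n" "\<sigma>n \<le> 1" using c by (auto simp: \<sigma>n_def \<sigma>_def intro!: power_le_one)
  have w_eq: "w = q * \<sigma>n / 8" by (simp add: w_def \<omega>_def \<sigma>n_def \<sigma>_def)
  have w: "0 < w" "w \<le> 1 / 8" "w \<le> \<sigma>n / 8"
    using q q1 \<sigma>n mult_le_one[of q \<sigma>n] by (auto simp: w_eq mult_left_le_one_le)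
  have M0: "0 < M"
  proof (rule ccontr)
    assume "\<not> 0 < M"
    then have "(w / 32) ^ (m + 4) * M \<le> 0" using w by (intro mult_nonneg_nonpos) auto
    then have "real (m * 2 ^ (m * n)) \<le> 0" using large unfolding w_def[symmetric] by linarith
    moreover have "0 < real (m * 2 ^ (m * n))" using m by simp
    ultimately show False by linarith
  qed
  have Mle: "M \<le> real (card (X i))" if "i < n" for i by (rule M[OF that])
  have large1: "real (m * 2 ^ (m * n)) \<le> w * \<sigma>n / 16 * M"
  proof -
    have "(w / 32) ^ (m + 4) \<le> (w / 32) ^ 2" using w by (intro power_decreasing) auto
    also have "\<dots> = w * w / 1024" by (simp add: power2_eq_square)
    also have "\<dots> \<le> w * \<sigma>n / 16" using w \<sigma>n mult_left_mono[of w \<sigma>n w] by simp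
    finally show ?thesis using large M0 unfolding w_def[symmetric] by (meson less_imp_le mult_right_mono order_trans)
  qed
  have large2: "real (m * 2 ^ (m * n)) \<le> \<sigma>n / 4 * M"
  proof -
    have "w * \<sigma>n \<le> \<sigma>n" using w \<sigma>n by (simp add: mult_left_le_one_le)
    then have "w * \<sigma>n / 16 * M \<le> \<sigma>n / 4 * M" using M0 \<sigma>n by (intro mult_right_mono) auto
    with large1 show ?thesis by linarith
  qed
  have small1: "((1 + 2 ^ R) ^ Q) ^ n * real n * \<epsilon> \<le> s * \<sigma>n\<^sup>2 / 32"
    and small2: "((1 + 2 ^ R) ^ Q) ^ n * real n * \<epsilon> \<le> q * \<sigma>n\<^sup>2 / 32"
  proof -
    have "s * q * \<sigma>n\<^sup>2 / 32 \<le> s * \<sigma>n\<^sup>2 / 32" "s * q * \<sigma>n\<^sup>2 / 32 \<le> q * \<sigma>n\<^sup>2 / 32"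
      using s q q1 by (auto intro!: mult_right_mono simp: mult_left_le mult_left_le_one_le)
    with small show "((1 + 2 ^ R) ^ Q) ^ n * real n * \<epsilon> \<le> s * \<sigma>n\<^sup>2 / 32"
      "((1 + 2 ^ R) ^ Q) ^ n * real n * \<epsilon> \<le> q * \<sigma>n\<^sup>2 / 32" by (auto simp: \<sigma>n_def)
  qed
  have un: "u \<le> n" using n by simp
  have lg: "real m * 2 ^ (m * n) \<le> (s * \<beta> / 8) ^ n / 4 * real (card (X i))" if "i < u" for i
  proof -
    have "\<sigma>n / 4 * M \<le> \<sigma>n / 4 * real (card (X i))" using that un \<sigma>n by (intro mult_left_mono Mle) auto
    with large2 show ?thesis by (simp add: \<sigma>n_def \<sigma>_def)
  qed
  obtain \<tau> where \<tau>: "\<And>j. j < u \<Longrightarrow> \<tau> j \<subseteq> X j" "\<And>j. j < u \<Longrightarrow> card (\<tau> j) \<le> m"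
    "\<And>j k a b. j < k \<Longrightarrow> k < u \<Longrightarrow> a \<in> \<tau> j \<Longrightarrow> b \<in> \<tau> k \<Longrightarrow> E j k a b"
    "(s * \<beta> / 8) ^ u * (\<Prod>l\<in>{u..<n}. real (card (X l))) \<le> (\<Sum>x\<in>PiE {u..<n} X. weight E m R Q {..<u} {u..<n} \<tau> x)"
    by (rule embed_prefix[OF rs un m s(1-3) \<beta> small1[unfolded \<sigma>n_def \<sigma>_def] lg];
        (assumption | (rule that; assumption)))
  have fin\<tau>: "finite (\<tau> j) \<and> card (\<tau> j) \<le> m" if "j \<in> {..<u}" for j
    using that \<tau>(1,2)[of j] finX[of j] un finite_subset by auto
  \<comment> \<open>The triangle and the path through \<open>v\<close>: their weighted counts are
    the numerator and the denominator of the conditional density of the pair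
    \<open>uz\<close>.\<close>
  define P1 where "P1 = {(u, v), (u, z), (v, z)}"
  define P2 where "P2 = {(u, v), (v, z)}"
  have P: "P1 \<subseteq> pairs (insert u {v, z})" "P2 \<subseteq> pairs (insert u {v, z})"
    using uvz by (auto simp: P1_def P2_def pairs_def)
  have cP: "card P1 = 3" "card P2 = 2" using uvz by (auto simp: P1_def P2_def)
  have cP': "real (card P1) \<le> real n" "real (card P2) \<le> real n" using cP n by auto
  have pp: "pp P1 = p u z * (p u v * p v z)" "pp P2 = p u v * p v z"
    using uvz by (auto simp: P1_def P2_def pp_def)
  have qp: "q \<le> pp P1" "q \<le> pp P2" using q' q'' pp by auto
  have ins: "insert u {v, z} = {u..<n}" using uvz by simp
  have sum: "\<sigma>n * (\<Prod>l\<in>insert u {v, z}. real (card (X l))) \<le>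
      (\<Sum>x\<in>PiE (insert u {v, z}) X. weight E m R Q {..<u} (insert u {v, z}) \<tau> x)"
  proof -
    have "\<sigma>n \<le> (s * \<beta> / 8) ^ u" unfolding \<sigma>n_def \<sigma>_def using c un by (intro power_decreasing) auto
    then have "\<sigma>n * (\<Prod>l\<in>{u..<n}. real (card (X l))) \<le> (s * \<beta> / 8) ^ u * (\<Prod>l\<in>{u..<n}. real (card (X l)))"
      by (intro mult_right_mono prod_nonneg) auto
    with \<tau>(4) show ?thesis unfolding ins by linarith
  qed
  have sm: "((1 + 2 ^ R) ^ Q) ^ card {..<u} * real n * \<epsilon> \<le> q * \<sigma>n\<^sup>2 / 32"
  proof -
    have "((1 + 2 ^ R) ^ Q) ^ u * (real n * \<epsilon>) \<le> ((1 + 2 ^ R) ^ Q) ^ n * (real n * \<epsilon>)"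
      using un \<epsilon>_nonneg by (intro mult_right_mono power_increasing one_le_power) auto
    with small2 show ?thesis by (simp add: mult.assoc)
  qed
  have iu: "u \<notin> {v, z}" "insert u {v, z} \<subseteq> {..<n}" using uvz by auto
  let ?\<psi> = "\<lambda>\<tau>. weight E m R Q {..<u} {v, z} \<tau>"
  obtain W \<tau>1 where W: "W \<subseteq> X u" "\<sigma>n / 4 * real (card (X u)) \<le> 2 ^ (m * card {..<u}) * real (card W)"
    "\<And>j y. j \<in> {..<u} \<Longrightarrow> y \<in> W \<Longrightarrow> \<tau>1 j = {a \<in> \<tau> j. E j u a y}"
    "\<And>j. j \<in> {..<u} \<Longrightarrow> \<tau>1 j \<subseteq> \<tau> j"
    "\<sigma>n / 2 * (\<Prod>l\<in>{v, z}. real (card (X l))) \<le> (\<Sum>x\<in>PiE {v, z} X. ?\<psi> \<tau>1 x)"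
    "\<And>y. y \<in> W \<Longrightarrow> pp P1 / 2 * (\<Sum>x\<in>PiE {v, z} X. ?\<psi> \<tau>1 x) \<le>
       (\<Sum>x\<in>PiE {v, z} X. ?\<psi> \<tau>1 x * of_bool (all_rel E P1 (x(u := y))))"
    "\<And>y. y \<in> W \<Longrightarrow> (\<Sum>x\<in>PiE {v, z} X. ?\<psi> \<tau>1 x * of_bool (all_rel E P2 (x(u := y))))
       \<le> 2 * pp P2 * (\<Sum>x\<in>PiE {v, z} X. ?\<psi> \<tau>1 x)"
    by (rule select_class[OF iu m finite_lessThan fin\<tau> P cP' q(1) qp \<sigma>n(1) sum sm], assumption, (rule that; assumption))
  have mpos: "(0::real) < 2 ^ (m * n)" by simp
  have pw: "(2::real) ^ (m * k) \<le> 2 ^ (m * n)" if "k \<le> n" for k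
    using that by (intro power_increasing) auto
  \<comment> \<open>Members of \<open>PiE {v, z} X\<close> are \<open>undefined\<close> elsewhere,
    so these updates run through all of them.\<close>
  define \<Psi> where "\<Psi> b c = ?\<psi> \<tau>1 ((\<lambda>_. undefined)(z := c, v := b))" for b c
  have fin\<tau>1: "finite (\<tau>1 j) \<and> card (\<tau>1 j) \<le> m" if "j \<in> {..<u}" for j
    using fin\<tau>[OF that] W(4)[OF that] by (meson card_mono finite_subset le_trans)
  have \<Psi>: "0 \<le> \<Psi> b c" "\<Psi> b c \<le> 1" for b c
    unfolding \<Psi>_def by (rule weight_bounds[OF fin\<tau>1]; assumption)+
  have sum2: "(\<Sum>x\<in>PiE {v, z} X. g x) = (\<Sum>b\<in>X v. \<Sum>c\<in>X z. g ((\<lambda>_. undefined)(z := c, v := b)))" for g :: "_ \<Rightarrow> real"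
  proof -
    have "v \<notin> {z}" "z \<notin> {}" using uvz by auto
    then show ?thesis unfolding sum_PiE_insert[OF \<open>v \<notin> {z}\<close>] sum_PiE_insert[OF \<open>z \<notin> {}\<close>] by (simp add: fun_upd_def)
  qed
  define h where "h = (\<Sum>b\<in>X v. \<Sum>c\<in>X z. \<Psi> b c)"
  have h: "(\<Sum>x\<in>PiE {v, z} X. ?\<psi> \<tau>1 x) = h" unfolding h_def sum2 \<Psi>_def ..
  have lower: "p u z * (p u v * p v z) / 2 * h \<le> (\<Sum>b\<in>X v. \<Sum>c\<in>X z. \<Psi> b c * of_bool (E u v y b \<and> E u z y c \<and> E v z b c))"
    if "y \<in> W" for y
    using W(6)[OF that] uvz unfolding h_def pp sum2 \<Psi>_def by (simp add: all_rel_def P1_def)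
  have upper: "(\<Sum>b\<in>X v. \<Sum>c\<in>X z. \<Psi> b c * of_bool (E u v y b \<and> E v z b c)) \<le> 2 * (p u v * p v z) * h"
    if "y \<in> W" for y
    using W(7)[OF that] uvz unfolding h_def pp sum2 \<Psi>_def by (simp add: all_rel_def P2_def)
  have hlow: "\<sigma>n / 2 * (real (card (X v)) * real (card (X z))) \<le> h"
    using W(5) uvz unfolding h by simp
  \<comment> \<open>Origin of \<omega>: the factor \<open>q / 4\<close> of the triangle estimate
    times the remaining weight \<open>\<sigma> / 2\<close>.\<close>
  have w\<omega>: "w * (real (card (X v)) * real (card (X z))) \<le> p u z * (p u v * p v z) / 4 * h"
  proof -
    have "w * (real (card (X v)) * real (card (X z))) = q / 4 * (\<sigma>n / 2 * (real (card (X v)) * real (card (X z))))"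
      by (simp add: w_eq)
    also have "\<dots> \<le> q / 4 * h" using hlow q by (intro mult_left_mono) auto
    also have "\<dots> \<le> p u z * (p u v * p v z) / 4 * h" using q' \<Psi>
      by (intro mult_right_mono divide_right_mono) (auto simp: h_def intro!: sum_nonneg)
    finally show ?thesis .
  qed
  have "2 ^ (m * n) * real m \<le> w * \<sigma>n / 16 * M" using large1 by (simp add: mult.commute)
  also have "\<dots> = w / 4 * (\<sigma>n / 4 * M)" by simp
  also have "\<dots> \<le> w / 4 * (2 ^ (m * card {..<u}) * real (card W))"
    using W(2) w \<sigma>n Mle[of u] uvz by (intro mult_left_mono order_trans[OF _ W(2)]) auto
  also have "\<dots> \<le> w / 4 * (2 ^ (m * n) * real (card W))"
    using w un by (intro mult_left_mono mult_right_mono pw) auto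
  finally have "2 ^ (m * n) * real m \<le> 2 ^ (m * n) * (w / 4 * real (card W))" by (simp add: algebra_simps)
  then have mW: "real m \<le> w / 4 * real (card W)" using mpos by (rule mult_left_le_imp_le)
  then have neW: "W \<noteq> {}" using m by auto
  have finW: "finite W" using W(1) finX[of u] uvz finite_subset by auto
  have finvz: "finite (X v)" "finite (X z)" "X z \<noteq> {}" "X v \<noteq> {}" using finX neX uvz by auto
  have w1: "w \<le> 1" using w by simp
  obtain A V' where A: "A \<subseteq> W" "card A = m" "V' \<subseteq> X v"
    "w\<^sup>2 / 8 * (w / 4) ^ m * real (card (X v)) \<le> real (card V')"
    "\<And>b a. b \<in> V' \<Longrightarrow> a \<in> A \<Longrightarrow> E u v a b"
    "\<And>b. b \<in> V' \<Longrightarrow> w / 4 * real (card (X z)) \<le>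
      (\<Sum>c\<in>X z. \<Psi> b c * of_bool (E v z b c \<and> p u z / 8 * real m \<le> real (card {a \<in> A. E u z a c})))"
    by (rule weighted_common_neighbours[OF finW finvz(1,2) neW finvz(3) \<Psi> pb(2) m lower upper w(1) w1 w\<omega> mW];
        (assumption | (rule that; assumption)))
  have V'pos: "0 < real (card V')"
  proof -
    have "0 < w\<^sup>2 / 8 * (w / 4) ^ m * real (card (X v))"
      using w finvz by (simp add: card_gt_0_iff)
    with A(4) show ?thesis by linarith
  qed
  have V': "finite V'" "V' \<noteq> {}" using V'pos card.infinite by fastforce+
  \<comment> \<open>The earlier parts must be complete to the part of \<open>v\<close> too. On a
    class of equal traces \<open>\<Psi> b c\<close> does not depend on \<open>b\<close>, so the
    choice at \<open>z\<close> is governed by a weight \<psi> of one variable.\<close>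
  obtain V2 \<tau>2 where V2: "V2 \<subseteq> V'" "V2 \<noteq> {}" "real (card V') \<le> 2 ^ (m * card {..<u}) * real (card V2)"
    "\<And>j y. j \<in> {..<u} \<Longrightarrow> y \<in> V2 \<Longrightarrow> \<tau>2 j = {a \<in> \<tau>1 j. E j v a y}"
    "\<And>j. j \<in> {..<u} \<Longrightarrow> \<tau>2 j \<subseteq> \<tau>1 j"
    by (rule common_trace[OF V' finite_lessThan fin\<tau>1, where E = E and i = v], assumption, (rule that; assumption))
  have finV2: "finite V2" using V2 V' finite_subset by auto
  have fin\<tau>2: "finite (\<tau>2 j) \<and> card (\<tau>2 j) \<le> m" if "j \<in> {..<u}" for j
    using fin\<tau>1[OF that] V2(5)[OF that] by (meson card_mono finite_subset le_trans)
  define \<psi> where "\<psi> c = weight E m R Q {..<u} {z} \<tau>2 (\<lambda>_. c)" for c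
  have \<psi>_eq: "\<Psi> b c = \<psi> c" if "b \<in> V2" for b c
  proof -
    have "\<Psi> b c = weight E m R Q {..<u} {z} \<tau>2 ((\<lambda>_. undefined)(z := c))"
      unfolding \<Psi>_def using V2(4)[OF _ that] uvz by (intro weight_eq) auto
    also have "\<dots> = \<psi> c" by (simp add: \<psi>_def weight_def nbr_frac_def)
    finally show ?thesis .
  qed
  have \<psi>: "0 \<le> \<psi> c" "\<psi> c \<le> 1" for c
    unfolding \<psi>_def by (rule weight_bounds[OF fin\<tau>2]; assumption)+
  define good where "good c \<longleftrightarrow> p u z / 8 * real m \<le> real (card {a \<in> A. E u z a c})" for c
  \<comment> \<open>Heavy enough that no earlier part collapses, with enough neighbours in
    \<open>A\<close>, and with enough in \<open>V2\<close>. The average to be distributed is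
    \<open>w / 4\<close>, and a vertex missing one condition contributes at most
    \<open>w / 16\<close>, so a proportion \<open>w / 8\<close> meets all three.\<close>
  define Z1 where "Z1 = {c \<in> X z. w / 16 \<le> \<psi> c \<and> good c \<and> w / 16 * real (card V2) \<le> real (card {b \<in> V2. E v z b c})}"
  have Z1: "w / 8 * real (card (X z)) \<le> real (card Z1)"
  proof -
    let ?N = "\<lambda>c. real (card {b \<in> V2. E v z b c})"
    have cV2: "0 < real (card V2)" using V2 finV2 by (simp add: card_gt_0_iff)
    have Nle: "?N c \<le> real (card V2)" for c using finV2 by (simp add: card_mono)
    have "real (card V2) * (w / 4 * real (card (X z))) = (\<Sum>b\<in>V2. w / 4 * real (card (X z)))" by simp
    also have "\<dots> \<le> (\<Sum>b\<in>V2. \<Sum>c\<in>X z. \<Psi> b c * of_bool (E v z b c \<and> good c))"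
      unfolding good_def using V2(1) by (intro sum_mono A(6)) auto
    also have "\<dots> = (\<Sum>c\<in>X z. \<Sum>b\<in>V2. \<psi> c * of_bool (E v z b c \<and> good c))"
      by (subst sum.swap) (intro sum.cong refl, simp add: \<psi>_eq)
    also have "\<dots> = (\<Sum>c\<in>X z. \<psi> c * of_bool (good c) * ?N c)"
    proof (rule sum.cong[OF refl])
      fix c
      have "(\<Sum>b\<in>V2. \<psi> c * of_bool (E v z b c \<and> good c)) = \<psi> c * of_bool (good c) * (\<Sum>b\<in>V2. of_bool (E v z b c))"
        by (simp add: sum_distrib_left of_bool_conj mult_ac)
      then show "(\<Sum>b\<in>V2. \<psi> c * of_bool (E v z b c \<and> good c)) = \<psi> c * of_bool (good c) * ?N c"
        using finV2 by (simp add: of_bool_def sum.If_cases Int_def)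
    qed
    also have "\<dots> \<le> (\<Sum>c\<in>X z. real (card V2) * (of_bool (c \<in> Z1) + w / 8))"
    proof (rule sum_mono)
      fix c assume c: "c \<in> X z"
      consider "c \<in> Z1" | "\<psi> c < w / 16" | "\<not> good c" | "?N c < w / 16 * real (card V2)"
        using c unfolding Z1_def by force
      then show "\<psi> c * of_bool (good c) * ?N c \<le> real (card V2) * (of_bool (c \<in> Z1) + w / 8)"
      proof cases
        case 1
        have "\<psi> c * of_bool (good c) * ?N c \<le> 1 * real (card V2)" using \<psi> Nle by (intro mult_mono) auto
        also have "\<dots> \<le> real (card V2) * (of_bool (c \<in> Z1) + w / 8)" using 1 w by (simp add: distrib_left)
        finally show ?thesis .
      next
        case 2
        have "\<psi> c * of_bool (good c) * ?N c \<le> w / 16 * real (card V2)"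
          using \<psi>[of c] Nle[of c] 2 w by (intro mult_mono) auto
        also have "\<dots> = real (card V2) * (w / 16)" by simp
        also have "\<dots> \<le> real (card V2) * (of_bool (c \<in> Z1) + w / 8)" using w by (intro mult_left_mono) auto
        finally show ?thesis .
      next
        case 3
        then show ?thesis using w by simp
      next
        case 4
        have "\<psi> c * of_bool (good c) * ?N c \<le> 1 * (w / 16 * real (card V2))"
          using \<psi>[of c] 4 w by (intro mult_mono) auto
        also have "\<dots> = real (card V2) * (w / 16)" by simp
        also have "\<dots> \<le> real (card V2) * (of_bool (c \<in> Z1) + w / 8)" using w by (intro mult_left_mono) auto
        finally show ?thesis .
      qed
    qed
    also have "\<dots> = real (card V2) * (real (card Z1) + w / 8 * real (card (X z)))"
    proof -
      have "X z \<inter> Z1 = Z1" by (auto simp: Z1_def)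
      then have "(\<Sum>c\<in>X z. of_bool (c \<in> Z1)) = real (card Z1)" using finvz by (simp add: of_bool_def sum.If_cases)
      then show ?thesis by (simp add: sum.distrib flip: sum_distrib_left)
    qed
    finally have "w / 4 * real (card (X z)) \<le> real (card Z1) + w / 8 * real (card (X z))"
      using cV2 by (rule mult_left_le_imp_le)
    then show ?thesis by simp
  qed
  have finZ1: "finite Z1" using finvz by (simp add: Z1_def)
  \<comment> \<open>The exponent \<open>m + 4\<close> in \<open>large\<close>: \<open>m\<close> pays
    for the loss in \<open>V'\<close>, the surplus 4 for the constant powers of
    \<open>w\<close>.\<close>
  have tV2: "real t \<le> w / 16 / 2 * real (card V2)"
  proof -
    have "2 ^ (m * n) * real t \<le> 2 ^ (m * n) * real m" using t by simp
    also have "\<dots> \<le> (w / 32) ^ (m + 4) * M" using large by (simp add: w_def mult.commute)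
    also have "\<dots> \<le> w / 32 * (w\<^sup>2 / 8 * (w / 4) ^ m * M)"
    proof -
      have "(w / 32) ^ m \<le> (w / 4) ^ m" using w by (intro power_mono) auto
      moreover have "(w / 32) ^ 4 \<le> w / 32 * (w\<^sup>2 / 8)"
      proof -
        have "(w / 32) ^ 4 = w / 32 * (w\<^sup>2 * w / 32768)" by (simp add: power4_eq_xxxx power2_eq_square)
        also have "\<dots> \<le> w / 32 * (w\<^sup>2 / 8)" using w by (intro mult_left_mono frac_le mult_left_le) auto
        finally show ?thesis .
      qed
      ultimately have "(w / 32) ^ m * (w / 32) ^ 4 \<le> (w / 4) ^ m * (w / 32 * (w\<^sup>2 / 8))"
        using w by (intro mult_mono) auto
      then have "(w / 32) ^ (m + 4) * M \<le> ((w / 4) ^ m * (w / 32 * (w\<^sup>2 / 8))) * M"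
        using M0 unfolding power_add by (intro mult_right_mono) auto
      then show ?thesis by (simp add: mult_ac)
    qed
    also have "\<dots> \<le> w / 32 * (w\<^sup>2 / 8 * (w / 4) ^ m * real (card (X v)))"
      using w Mle[of v] uvz by (intro mult_left_mono) auto
    also have "\<dots> \<le> w / 32 * (2 ^ (m * card {..<u}) * real (card V2))"
      using A(4) V2(3) w by (intro mult_left_mono) auto
    also have "\<dots> \<le> w / 32 * (2 ^ (m * n) * real (card V2))"
      using w un by (intro mult_left_mono mult_right_mono pw) auto
    finally have "2 ^ (m * n) * real t \<le> 2 ^ (m * n) * (w / 32 * real (card V2))" by (simp add: algebra_simps)
    then have "real t \<le> w / 32 * real (card V2)" using mpos by (rule mult_left_le_imp_le)
    then show ?thesis by simp
  qed
  have deg: "c \<in> Z1 \<Longrightarrow> w / 16 * real (card V2) \<le> real (card {b \<in> V2. E v z b c})" for c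
    by (simp add: Z1_def)
  have w16: "0 \<le> w / 16" "w / 16 \<le> 1" using w by auto
  obtain B where B: "B \<subseteq> V2" "card B = t" "(w / 16 / 2) ^ t * real (card Z1) \<le> real (card {c \<in> Z1. \<forall>b\<in>B. E v z b c})"
    by (rule common_neighbours[OF finV2 finZ1 w16 deg tV2])
  define Z2 where "Z2 = {c \<in> Z1. \<forall>b\<in>B. E v z b c}"
  have Z2: "(w / 32) ^ t * (w / 8 * real (card (X z))) \<le> real (card Z2)"
  proof -
    have "(w / 32) ^ t * (w / 8 * real (card (X z))) \<le> (w / 32) ^ t * real (card Z1)"
      using Z1 w by (intro mult_left_mono) auto
    with B(3) show ?thesis by (simp add: Z2_def)
  qed
  have "0 < (w / 32) ^ t * (w / 8 * real (card (X z)))" using w finvz by (simp add: card_gt_0_iff)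
  then have "0 < real (card Z2)" using Z2 by linarith
  then have Z2': "finite Z2" "Z2 \<noteq> {}" by (simp_all add: card_gt_0_iff)
  \<comment> \<open>From here on \<open>A\<close> counts as a further part, so the last pigeonhole
    cuts it together with the earlier ones.\<close>
  define \<tau>3 where "\<tau>3 = \<tau>2(u := A)"
  have fin\<tau>3: "finite (\<tau>3 j) \<and> card (\<tau>3 j) \<le> m" if "j \<in> {..u}" for j
  proof (cases "j = u")
    case True
    then show ?thesis using A(1,2) finW finite_subset by (auto simp: \<tau>3_def)
  next
    case False
    then show ?thesis using fin\<tau>2[of j] that by (auto simp: \<tau>3_def)
  qed
  obtain Z3 \<tau>4 where Z3: "Z3 \<subseteq> Z2" "Z3 \<noteq> {}" "real (card Z2) \<le> 2 ^ (m * card {..u}) * real (card Z3)"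
    "\<And>j y. j \<in> {..u} \<Longrightarrow> y \<in> Z3 \<Longrightarrow> \<tau>4 j = {a \<in> \<tau>3 j. E j z a y}"
    "\<And>j. j \<in> {..u} \<Longrightarrow> \<tau>4 j \<subseteq> \<tau>3 j"
    by (rule common_trace[OF Z2' finite_atMost fin\<tau>3, where E = E and i = z], assumption, (rule that; assumption))
  have tZ3: "t \<le> card Z3"
  proof -
    have "2 ^ (m * n) * real t \<le> 2 ^ (m * n) * real m" using t by simp
    also have "\<dots> \<le> (w / 32) ^ (m + 4) * M" using large by (simp add: w_def mult.commute)
    also have "\<dots> \<le> (w / 32) ^ t * (w / 8 * M)"
    proof -
      have "(w / 32) ^ (m + 4) \<le> (w / 32) ^ (t + 1)" using w t by (intro power_decreasing) auto
      also have "\<dots> \<le> (w / 32) ^ t * (w / 8)" unfolding power_add using w by (intro mult_left_mono) auto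
      finally show ?thesis using M0 by (simp add: mult.assoc[symmetric])
    qed
    also have "\<dots> \<le> (w / 32) ^ t * (w / 8 * real (card (X z)))"
      using w Mle[of z] uvz by (intro mult_left_mono) auto
    also note Z2
    also note Z3(3)
    also have "2 ^ (m * card {..u}) * real (card Z3) \<le> 2 ^ (m * n) * real (card Z3)"
      using n by (intro mult_right_mono pw) auto
    finally have "real t \<le> real (card Z3)" using mpos by (rule mult_left_le_imp_le)
    then show ?thesis by simp
  qed
  obtain c0 where c0: "c0 \<in> Z3" using Z3 by auto
  have c0Z1: "c0 \<in> Z1" using c0 Z3 by (auto simp: Z2_def)
  define AA where "AA = \<tau>4(v := B, z := Z3)"
  have AAlt: "AA j = \<tau>4 j" if "j \<le> u" for j using that uvz by (auto simp: AA_def)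
  have AAv: "AA v = B" "AA z = Z3" using uvz by (auto simp: AA_def)
  \<comment> \<open>All factors of \<open>\<psi> c0\<close> are at most 1, so each of them is at
    least \<open>w / 16\<close>; the hypothesis on \<open>r\<close> converts this into a surviving
    fraction.\<close>
  have small_sets: "r * real m \<le> real (card (\<tau>4 j))" if j: "j < u" for j
  proof -
    define f where "f j = nbr_frac E m {z} (\<tau>2 j) j (\<lambda>_. c0)" for j
    have fb: "0 \<le> f j" "f j \<le> 1" if "j < u" for j
      unfolding f_def using that by (auto intro!: nbr_frac_bounds fin\<tau>2)
    have "w / 16 \<le> \<psi> c0" using c0Z1 by (simp add: Z1_def)
    also have "\<psi> c0 = amp R Q (f j) * (\<Prod>i\<in>{..<u} - {j}. amp R Q (f i))"
      unfolding \<psi>_def weight_def f_def using j by (intro prod.remove) auto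
    also have "\<dots> \<le> amp R Q (f j) * 1"
      using fb j by (intro mult_left_mono prod_le_1) (auto intro: amp_nonneg amp_le_1)
    finally have "r \<le> f j" using r[OF fb[OF j]] by (simp add: w_def)
    then have "r * real m \<le> f j * real m" by (intro mult_right_mono) auto
    also have "f j * real m = real (card (\<tau>4 j))"
      using Z3(4)[OF _ c0, of j] j m uvz by (simp add: f_def nbr_frac_def \<tau>3_def)
    finally show ?thesis .
  qed
  have Au: "s / 8 * real m \<le> real (card (\<tau>4 u))"
  proof -
    have "s / 8 * real m \<le> p u z / 8 * real m" using s(4) by (intro mult_right_mono) (auto simp: z_def)
    also have "\<dots> \<le> real (card (\<tau>4 u))" using c0Z1 Z3(4)[OF _ c0, of u] by (simp add: Z1_def good_def \<tau>3_def)
    finally show ?thesis .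
  qed
  have cases: "j < u \<or> j = u \<or> j = v \<or> j = z" if "j < n" for j
    using that n by (auto simp: v_def z_def)
  have sub4: "\<tau>4 j \<subseteq> \<tau>2 j" "\<tau>4 j \<subseteq> \<tau>1 j" "\<tau>4 j \<subseteq> \<tau> j" if "j < u" for j
  proof -
    have 1: "\<tau>4 j \<subseteq> \<tau>2 j" using Z3(5)[of j] that by (simp add: \<tau>3_def)
    moreover have 2: "\<tau>2 j \<subseteq> \<tau>1 j" "\<tau>1 j \<subseteq> \<tau> j" using V2(5)[of j] W(4)[of j] that by simp_all
    ultimately show "\<tau>4 j \<subseteq> \<tau>2 j" "\<tau>4 j \<subseteq> \<tau>1 j" "\<tau>4 j \<subseteq> \<tau> j" by blast+
  qed
  have sub4u: "\<tau>4 u \<subseteq> A" using Z3(5)[of u] by (simp add: \<tau>3_def)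
  show ?thesis
  proof (rule that[of AA])
    fix j assume j: "j < n"
    show "AA j \<subseteq> X j"
      using cases[OF j]
    proof (elim disjE)
      assume "j < u" then show ?thesis using sub4(3)[of j] \<tau>(1)[of j] AAlt[of j] by auto
    next
      assume "j = u" then show ?thesis using sub4u A W AAlt[of u] by auto
    next
      assume "j = v" then show ?thesis using AAv B V2 A by auto
    next
      assume "j = z" then show ?thesis using AAv Z3 by (auto simp: Z2_def Z1_def)
    qed
    show "min (real t) (min r (s / 8) * real m) \<le> real (card (AA j))"
      using cases[OF j]
    proof (elim disjE)
      assume "j < u"
      moreover have "min r (s / 8) * real m \<le> r * real m" by (intro mult_right_mono) auto
      ultimately show ?thesis using small_sets[of j] AAlt[of j] by simp
    next
      assume "j = u"
      moreover have "min r (s / 8) * real m \<le> s / 8 * real m" by (intro mult_right_mono) auto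
      ultimately show ?thesis using Au AAlt[of u] by simp
    next
      assume "j = v" then show ?thesis using AAv B by simp
    next
      assume "j = z" then show ?thesis using AAv tZ3 by simp
    qed
  next
    fix j k a b assume jk: "j < k" "k < n" and ab: "a \<in> AA j" "b \<in> AA k"
    show "E j k a b"
      using cases[OF jk(2)]
    proof (elim disjE)
      assume k: "k < u"
      then have "a \<in> \<tau> j" "b \<in> \<tau> k" using ab jk sub4(3)[of j] sub4(3)[of k] AAlt[of j] AAlt[of k] by auto
      then show ?thesis using \<tau>(3) jk k by auto
    next
      assume k: "k = u"
      then have "a \<in> \<tau>1 j" "b \<in> W" using ab jk sub4(2)[of j] sub4u A AAlt[of j] AAlt[of u] by auto
      then show ?thesis using W(3)[of j b] jk k by auto
    next
      assume k: "k = v"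
      then have b: "b \<in> V2" "b \<in> V'" using ab AAv B V2 by auto
      show ?thesis
      proof (cases "j = u")
        case True
        then have "a \<in> A" using ab sub4u AAlt[of u] by auto
        then show ?thesis using A(5) b k True by auto
      next
        case False
        then have j: "j < u" using jk k by (simp add: v_def)
        then have "a \<in> \<tau>2 j" using ab sub4(1)[of j] AAlt[of j] by auto
        then show ?thesis using V2(4)[of j b] b j k by auto
      qed
    next
      assume k: "k = z"
      then have b: "b \<in> Z3" using ab AAv by auto
      show ?thesis
      proof (cases "j = v")
        case True
        then show ?thesis using ab AAv b Z3 k by (auto simp: Z2_def)
      next
        case False
        then have j: "j \<le> u" using jk k by (simp add: v_def z_def)
        then show ?thesis using Z3(4)[of j b] b ab AAlt[of j] k by auto
      qed
    qed
  qed
qed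

section \<open>Regular boxes\<close>

text \<open>The tangent of \<open>exp\<close> at \<open>ln a\<close>. Combining instances with the
  same \<open>a\<close> and weights of sum 1 is the weighted AM-GM inequality, without real
  powers.\<close>

lemma am_gm_tangent:
  fixes a :: real
  assumes "0 < a" "0 < y" shows "a * (1 + ln y - ln a) \<le> y"
proof -
  have "ln (y / a) \<le> y / a - 1" using assms by (intro ln_le_minus_one) auto
  then have "1 + ln y - ln a \<le> y / a" using assms by (simp add: ln_div)
  then show ?thesis using assms by (simp add: field_simps)
qed

section \<open>Boxes, densities and their subdivision\<close>

definition volume :: "'i set \<Rightarrow> ('i \<Rightarrow> 'v set) \<Rightarrow> real" where
  "volume S X = (\<Prod>k\<in>S. real (card (X k)))"

definition density :: "'i set \<Rightarrow> ('i \<Rightarrow> 'v set) \<Rightarrow> (('i \<Rightarrow> 'v) \<Rightarrow> bool) \<Rightarrow> real" where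
  "density S X G = (\<Sum>x\<in>PiE S X. of_bool (G x)) / volume S X"

lemma volume_eq: "finite S \<Longrightarrow> volume S X = real (card (PiE S X))"
  by (simp add: volume_def card_PiE)

lemma volume_nonneg: "0 \<le> volume S X"
  by (simp add: volume_def prod_nonneg)

text \<open>Valid for an empty box as well: division by 0 gives density 0, and the sum is
  empty.\<close>

lemma density_volume:
  assumes "finite S" "\<And>k. k \<in> S \<Longrightarrow> finite (X k)"
  shows "density S X G * volume S X = (\<Sum>x\<in>PiE S X. of_bool (G x))"
proof (cases "volume S X = 0")
  case True
  then have "PiE S X = {}" using assms by (simp add: volume_eq finite_PiE)
  with True show ?thesis by (simp only: sum.empty mult_zero_right)
qed (simp add: density_def)

lemma density_bounds: "0 \<le> density S X G" "finite S \<Longrightarrow> density S X G \<le> 1"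
proof -
  show "0 \<le> density S X G" by (simp add: density_def volume_nonneg sum_nonneg)
  assume "finite S"
  moreover have "(\<Sum>x\<in>PiE S X. of_bool (G x)) \<le> (\<Sum>x\<in>PiE S X. 1 :: real)" by (intro sum_mono) auto
  ultimately show "density S X G \<le> 1" by (simp add: density_def volume_eq divide_le_eq)
qed

lemma density_mono: "finite S \<Longrightarrow> (\<And>x. G x \<Longrightarrow> G' x) \<Longrightarrow> density S X G \<le> density S X G'"
  unfolding density_def by (intro divide_right_mono sum_mono volume_nonneg) auto

lemma sum_PiE_split:
  fixes g :: "('i \<Rightarrow> 'v) \<Rightarrow> real"
  assumes "j \<in> S" "finite (X j)" "A \<subseteq> X j"
  shows "(\<Sum>x\<in>PiE S X. g x) = (\<Sum>x\<in>PiE S (X(j := A)). g x) + (\<Sum>x\<in>PiE S (X(j := X j - A)). g x)"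
proof -
  have S: "S = insert j (S - {j})" using assms by auto
  have eq: "PiE (S - {j}) (X(j := C)) = PiE (S - {j}) X" for C by (intro PiE_cong) auto
  have "(\<Sum>x\<in>PiE S (X(j := C)). g x) = (\<Sum>y\<in>C. \<Sum>x\<in>PiE (S - {j}) X. g (x(j := y)))" for C
    by (subst S, subst sum_PiE_insert) (simp_all add: eq)
  from this[of "X j"] this[of A] this[of "X j - A"] show ?thesis
    using assms by (simp add: sum.subset_diff add.commute)
qed

definition quarter :: "('i \<Rightarrow> 'v set) \<Rightarrow> 'i \<Rightarrow> 'i \<Rightarrow> 'v set \<Rightarrow> 'v set \<Rightarrow> bool \<times> bool \<Rightarrow> 'i \<Rightarrow> 'v set" where
  "quarter X j k A B = (\<lambda>(\<alpha>, \<beta>). X(j := if \<alpha> then A else X j - A, k := if \<beta> then B else X k - B))"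

lemma sum_quarters:
  fixes g :: "('i \<Rightarrow> 'v) \<Rightarrow> real"
  assumes "j \<in> S" "k \<in> S" "j \<noteq> k" "finite (X j)" "finite (X k)" "A \<subseteq> X j" "B \<subseteq> X k"
  shows "(\<Sum>c\<in>UNIV. \<Sum>x\<in>PiE S (quarter X j k A B c). g x) = (\<Sum>x\<in>PiE S X. g x)"
proof -
  have 1: "(\<Sum>x\<in>PiE S (X(j := C)). g x) = (\<Sum>x\<in>PiE S (X(j := C, k := B)). g x)
      + (\<Sum>x\<in>PiE S (X(j := C, k := X k - B)). g x)" for C
    using sum_PiE_split[of k S "X(j := C)" B g] assms by simp
  have "(\<Sum>c\<in>UNIV. h c) = h (True, True) + h (True, False) + h (False, True) + h (False, False)"
    for h :: "bool \<times> bool \<Rightarrow> real"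
    by (simp add: UNIV_Times_UNIV[symmetric] UNIV_bool sum.cartesian_product[symmetric] del: UNIV_Times_UNIV)
  then show ?thesis
    using sum_PiE_split[of j S X A g] assms by (simp add: quarter_def 1)
qed

text \<open>
  If \<open>X\<close> maximises \<open>ln F - \<theta> \<Sum> ln d\<^sub>e + \<kappa> ln (volume)\<close>, then splitting \<open>X\<close> into four boxes cannot
  change the density \<open>d\<^sub>e\<close> much: \<open>F\<close> is additive over the four parts, whereas
  \<open>\<Prod> d\<^sub>e powr \<theta>\<close> is a strictly concave function of the densities.
\<close>

lemma maximal_box_regular:
  fixes G :: "'e \<Rightarrow> ('i \<Rightarrow> 'v) \<Rightarrow> bool" and \<theta> \<kappa> :: real
  assumes S: "finite S" "\<And>k. k \<in> S \<Longrightarrow> finite (X k)" and PP: "finite PP" "e0 \<in> PP"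
    and jk: "j \<in> S" "k \<in> S" "j \<noteq> k" and AB: "A \<subseteq> X j" "B \<subseteq> X k"
    and \<theta>: "0 < \<theta>" "0 < \<kappa>" "(real (card PP) + 1) * \<theta> + \<kappa> \<le> 1"
    and FG: "\<And>x e. e \<in> PP \<Longrightarrow> F x \<Longrightarrow> G e x"
  defines "\<Phi> \<equiv> \<lambda>Y. ln (density S Y F) - \<theta> * (\<Sum>e\<in>PP. ln (density S Y (G e))) + \<kappa> * ln (volume S Y)"
  assumes pos: "0 < density S X F"
    and max: "\<And>c. 0 < density S (quarter X j k A B c) F \<Longrightarrow> \<Phi> (quarter X j k A B c) \<le> \<Phi> X"
  shows "\<bar>\<Sum>x\<in>PiE S (X(j := A, k := B)). of_bool (G e0 x) - density S X (G e0)\<bar> \<le> sqrt (12 * \<kappa> / \<theta>) * volume S X"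
proof -
  define Y where "Y = quarter X j k A B"
  have finY: "finite (Y c i)" if "i \<in> S" for c i
    using S(2)[OF that] S(2)[OF jk(1)] S(2)[OF jk(2)] AB finite_subset
    by (auto simp: Y_def quarter_def split: prod.splits)
  have v: "0 < volume S X"
  proof (rule ccontr)
    assume "\<not> 0 < volume S X"
    then have "volume S X = 0" using volume_nonneg[of S X] by linarith
    then show False using pos by (simp add: density_def)
  qed
  have dpos: "0 < density S Z (G e)" if "0 < density S Z F" "e \<in> PP" for Z e
    using density_mono[OF S(1), of F "G e" Z] FG that by fastforce
  \<comment> \<open>Ratios to the values at \<open>X\<close>. By additivity the
    \<open>l\<close>-weighted averages of \<open>a\<close> and of every \<open>r e\<close> are
    1.\<close>
  define l where "l c = volume S (Y c) / volume S X" for c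
  define a where "a c = density S (Y c) F / density S X F" for c
  define r where "r e c = density S (Y c) (G e) / density S X (G e)" for e c
  have l0: "0 \<le> l c" and r0: "0 \<le> r e c" for e c
    by (simp_all add: l_def r_def volume_nonneg density_bounds)
  have dvX: "density S X Q * volume S X = (\<Sum>x\<in>PiE S X. of_bool (Q x))" for Q
    using S by (rule density_volume)
  have dvY: "density S (Y c) Q * volume S (Y c) = (\<Sum>x\<in>PiE S (Y c). of_bool (Q x))" for c Q
    using S(1) finY by (rule density_volume)
  have sums: "(\<Sum>c\<in>UNIV. density S (Y c) Q * volume S (Y c)) = density S X Q * volume S X" for Q
    unfolding dvX dvY unfolding Y_def by (rule sum_quarters) (use S jk AB in auto)
  have "(\<Sum>c\<in>UNIV. volume S (Y c)) = volume S X"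
    using sum_quarters[OF jk S(2)[OF jk(1)] S(2)[OF jk(2)] AB, of "\<lambda>_. 1"] S(1) by (simp add: volume_eq Y_def)
  then have suml: "(\<Sum>c\<in>UNIV. l c) = 1" using v by (simp add: l_def flip: sum_divide_distrib)
  have suma: "(\<Sum>c\<in>UNIV. l c * a c) = 1"
    using sums[of F] v pos by (simp add: l_def a_def mult.commute flip: sum_divide_distrib)
  have sumr: "(\<Sum>c\<in>UNIV. l c * r e c) = 1" if "e \<in> PP" for e
    using sums[of "G e"] v dpos[OF pos that] by (simp add: l_def r_def mult.commute flip: sum_divide_distrib)
  \<comment> \<open>Maximality says that \<open>a\<close> is at most the product of all
    \<open>r e powr \<theta>\<close> times \<open>l powr (- \<kappa>)\<close>. Weighted AM-GM is
    applied with weight \<theta> on \<open>r e\<close> for each other \<open>e\<close>,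
    \<open>2 * \<theta>\<close> on \<open>sqrt (r e0)\<close>, \<kappa> on \<open>1 / l\<close>, and
    the rest on 1, which explains the bound on \<open>(card PP + 1) * \<theta> + \<kappa>\<close>.
    The square root preserves the strict concavity at \<open>e0\<close>.\<close>
  have part: "l c * a c \<le> \<theta> * (\<Sum>e\<in>PP - {e0}. l c * r e c) + 2 * \<theta> * (l c * sqrt (r e0 c)) + \<kappa>
      + (1 - \<kappa> - (real (card PP) + 1) * \<theta>) * l c" for c
  proof (cases "0 < density S (Y c) F")
    case False
    then have "a c = 0" using density_bounds(1)[of S "Y c" F] by (simp add: a_def)
    moreover have "0 \<le> \<theta> * (\<Sum>e\<in>PP - {e0}. l c * r e c) + 2 * \<theta> * (l c * sqrt (r e0 c)) + \<kappa>
      + (1 - \<kappa> - (real (card PP) + 1) * \<theta>) * l c"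
      using \<theta> l0 r0 by (intro add_nonneg_nonneg mult_nonneg_nonneg sum_nonneg) auto
    ultimately show ?thesis by simp
  next
    case True
    then have vY: "0 < volume S (Y c)"
      using volume_nonneg[of S "Y c"] by (cases "volume S (Y c) = 0") (auto simp: density_def)
    have l: "0 < l c" and a: "0 < a c" using vY v True pos by (auto simp: l_def a_def)
    have r: "0 < r e c" if "e \<in> PP" for e using dpos[OF True that] dpos[OF pos that] by (simp add: r_def)
    have "\<Phi> (Y c) \<le> \<Phi> X" using max True by (simp add: Y_def)
    moreover have "\<Phi> (Y c) - \<Phi> X = ln (a c) - \<theta> * (\<Sum>e\<in>PP. ln (r e c)) + \<kappa> * ln (l c)"
    proof -
      have "(\<Sum>e\<in>PP. ln (r e c)) = (\<Sum>e\<in>PP. ln (density S (Y c) (G e)) - ln (density S X (G e)))"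
        unfolding r_def
      proof (rule sum.cong[OF refl])
        fix e assume "e \<in> PP"
        then show "ln (density S (Y c) (G e) / density S X (G e)) = ln (density S (Y c) (G e)) - ln (density S X (G e))"
          using dpos[OF True, of e] dpos[OF pos, of e] by (simp add: ln_div)
      qed
      then have sr: "(\<Sum>e\<in>PP. ln (r e c)) = (\<Sum>e\<in>PP. ln (density S (Y c) (G e))) - (\<Sum>e\<in>PP. ln (density S X (G e)))"
        by (simp add: sum_subtractf)
      show ?thesis unfolding sr using True pos v vY
        by (simp add: \<Phi>_def a_def l_def ln_div algebra_simps)
    qed
    ultimately have ln: "ln (a c) - \<theta> * (\<Sum>e\<in>PP. ln (r e c)) + \<kappa> * ln (l c) \<le> 0" by simp
    have split: "(\<Sum>e\<in>PP. ln (r e c)) = (\<Sum>e\<in>PP - {e0}. ln (r e c)) + ln (r e0 c)"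
      using PP by (simp add: sum.remove)
    have card: "real (card (PP - {e0})) = real (card PP) - 1"
      using PP card_gt_0_iff[of PP] by (auto simp: card_Diff_singleton of_nat_diff)
    have t1: "a c * ((real (card PP) - 1) * (1 - ln (a c)) + (\<Sum>e\<in>PP - {e0}. ln (r e c))) \<le> (\<Sum>e\<in>PP - {e0}. r e c)"
    proof -
      have "(\<Sum>e\<in>PP - {e0}. a c * (1 + ln (r e c) - ln (a c))) \<le> (\<Sum>e\<in>PP - {e0}. r e c)"
        using r a by (intro sum_mono am_gm_tangent) auto
      moreover have "(\<Sum>e\<in>PP - {e0}. a c * (1 + ln (r e c) - ln (a c)))
         = a c * (real (card (PP - {e0})) * (1 - ln (a c)) + (\<Sum>e\<in>PP - {e0}. ln (r e c)))"
        by (simp add: sum_distrib_left[symmetric] sum.distrib sum_subtractf algebra_simps)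
      ultimately show ?thesis by (simp add: card)
    qed
    have t2: "a c * (1 + ln (r e0 c) / 2 - ln (a c)) \<le> sqrt (r e0 c)"
      using am_gm_tangent[OF a, of "sqrt (r e0 c)"] r[OF PP(2)] by (simp add: ln_sqrt)
    have t3: "a c * (1 - ln (l c) - ln (a c)) \<le> 1 / l c"
      using am_gm_tangent[OF a, of "1 / l c"] l by (simp add: ln_div)
    have t4: "a c * (1 - ln (a c)) \<le> 1" using am_gm_tangent[OF a, of 1] by simp
    define w where "w = 1 - \<kappa> - (real (card PP) + 1) * \<theta>"
    have w: "0 \<le> w" using \<theta> by (simp add: w_def)
    have "a c \<le> a c * (1 - (ln (a c) - \<theta> * (\<Sum>e\<in>PP. ln (r e c)) + \<kappa> * ln (l c)))"
      using a ln by (simp add: mult_le_cancel_left1)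
    also have "\<dots> = \<theta> * (a c * ((real (card PP) - 1) * (1 - ln (a c)) + (\<Sum>e\<in>PP - {e0}. ln (r e c))))
        + 2 * \<theta> * (a c * (1 + ln (r e0 c) / 2 - ln (a c))) + \<kappa> * (a c * (1 - ln (l c) - ln (a c)))
        + w * (a c * (1 - ln (a c)))"
      unfolding split w_def by (simp add: algebra_simps)
    also have "\<dots> \<le> \<theta> * (\<Sum>e\<in>PP - {e0}. r e c) + 2 * \<theta> * sqrt (r e0 c) + \<kappa> * (1 / l c) + w * 1"
      using \<theta> w by (intro add_mono mult_left_mono t1 t2 t3 t4) auto
    finally have "l c * a c \<le> l c * (\<theta> * (\<Sum>e\<in>PP - {e0}. r e c) + 2 * \<theta> * sqrt (r e0 c) + \<kappa> * (1 / l c) + w * 1)"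
      using l by (intro mult_left_mono) auto
    also have "\<dots> = \<theta> * (\<Sum>e\<in>PP - {e0}. l c * r e c) + 2 * \<theta> * (l c * sqrt (r e0 c)) + \<kappa> + w * l c"
      using l by (simp add: algebra_simps sum_distrib_left)
    finally show ?thesis by (simp add: w_def)
  qed
  \<comment> \<open>Summed over the quarters the linear terms cancel. What remains is the defect of
    \<open>sqrt\<close> from linearity, bounded through \<open>3 * \<kappa>\<close>: \<kappa> for
    each of the four quarters, less the \<kappa> in the constant term.\<close>
  have "(\<Sum>c\<in>UNIV. l c * a c) \<le> (\<Sum>c\<in>UNIV. \<theta> * (\<Sum>e\<in>PP - {e0}. l c * r e c) + 2 * \<theta> * (l c * sqrt (r e0 c)) + \<kappa>
      + (1 - \<kappa> - (real (card PP) + 1) * \<theta>) * l c)"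
    by (intro sum_mono part)
  also have "\<dots> = \<theta> * (\<Sum>e\<in>PP - {e0}. \<Sum>c\<in>UNIV. l c * r e c) + 2 * \<theta> * (\<Sum>c\<in>UNIV. l c * sqrt (r e0 c)) + 4 * \<kappa>
      + (1 - \<kappa> - (real (card PP) + 1) * \<theta>)"
  proof -
    have "(\<Sum>c\<in>UNIV. \<Sum>e\<in>PP - {e0}. l c * r e c) = (\<Sum>e\<in>PP - {e0}. \<Sum>c\<in>UNIV. l c * r e c)" by (rule sum.swap)
    moreover have "card (UNIV :: (bool \<times> bool) set) = 4"
      by (simp add: UNIV_Times_UNIV[symmetric] card_cartesian_product del: UNIV_Times_UNIV)
    ultimately show ?thesis using suml by (simp add: sum.distrib flip: sum_distrib_left)
  qed
  also have "(\<Sum>e\<in>PP - {e0}. \<Sum>c\<in>UNIV. l c * r e c) = real (card PP) - 1"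
    using sumr PP card_gt_0_iff[of PP] by (auto simp: card_Diff_singleton of_nat_diff)
  finally have sq: "2 * \<theta> * (1 - (\<Sum>c\<in>UNIV. l c * sqrt (r e0 c))) \<le> 3 * \<kappa>" unfolding suma by (simp add: algebra_simps)
  have "(\<Sum>c\<in>UNIV. l c * (1 - sqrt (r e0 c))\<^sup>2) = (\<Sum>c\<in>UNIV. l c - 2 * (l c * sqrt (r e0 c)) + l c * r e0 c)"
    using r0 by (intro sum.cong refl) (simp add: power2_diff algebra_simps)
  also have "\<dots> = 2 * (1 - (\<Sum>c\<in>UNIV. l c * sqrt (r e0 c)))"
    using suml sumr[OF PP(2)] by (simp add: sum.distrib sum_subtractf flip: sum_distrib_left)
  also have "\<dots> \<le> 3 * \<kappa> / \<theta>" using sq \<theta> by (simp add: field_simps)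
  finally have var: "(\<Sum>c\<in>UNIV. l c * (1 - sqrt (r e0 c))\<^sup>2) \<le> 3 * \<kappa> / \<theta>" .
  define c where "c = (True, True)"
  have "l c * (1 - sqrt (r e0 c))\<^sup>2 \<le> (\<Sum>c\<in>UNIV. l c * (1 - sqrt (r e0 c))\<^sup>2)"
    by (rule member_le_sum) (use l0 in auto)
  then have vc: "l c * (1 - sqrt (r e0 c))\<^sup>2 \<le> 3 * \<kappa> / \<theta>" using var by linarith
  have "l c \<le> 1" unfolding suml[symmetric] by (rule member_le_sum) (use l0 in auto)
  moreover have "l c * r e0 c \<le> 1" unfolding sumr[OF PP(2), symmetric]
    by (rule member_le_sum) (use l0 r0 in auto)
  moreover have "l c * (1 + sqrt (r e0 c))\<^sup>2 \<le> 2 * l c + 2 * (l c * r e0 c)"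
  proof -
    have "(1 + sqrt (r e0 c))\<^sup>2 \<le> 2 + 2 * r e0 c"
      using r0[of e0 c] zero_le_power2[of "1 - sqrt (r e0 c)"] by (simp add: power2_diff power2_sum)
    from mult_left_mono[OF this l0[of c]] show ?thesis by (simp add: algebra_simps)
  qed
  ultimately have up: "l c * (1 + sqrt (r e0 c))\<^sup>2 \<le> 4" by linarith
  \<comment> \<open>\<open>r - 1\<close> factors as \<open>(sqrt r - 1) * (sqrt r + 1)\<close>; the
    first factor is small by \<open>var\<close>, the second bounded, and 12 is 3 times 4.\<close>
  have "(l c * r e0 c - l c)\<^sup>2 = (l c * (1 - sqrt (r e0 c))\<^sup>2) * (l c * (1 + sqrt (r e0 c))\<^sup>2)"
  proof -
    define q where "q = sqrt (r e0 c)"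
    have "r e0 c = q * q" using r0[of e0 c] by (simp add: q_def)
    then show ?thesis unfolding q_def[symmetric] by (simp add: power2_eq_square algebra_simps)
  qed
  also have "\<dots> \<le> (3 * \<kappa> / \<theta>) * 4"
    using vc up l0 \<theta> by (intro mult_mono) auto
  finally have "(l c * r e0 c - l c)\<^sup>2 \<le> 12 * \<kappa> / \<theta>" by simp
  then have dev: "\<bar>l c * r e0 c - l c\<bar> \<le> sqrt (12 * \<kappa> / \<theta>)" using real_le_rsqrt abs_le_iff real_sqrt_abs real_sqrt_le_iff by metis
  have Yc: "Y c = X(j := A, k := B)" by (simp add: Y_def c_def quarter_def)
  have "(\<Sum>x\<in>PiE S (X(j := A, k := B)). of_bool (G e0 x) - density S X (G e0))
     = density S (Y c) (G e0) * volume S (Y c) - density S X (G e0) * volume S (Y c)"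
    unfolding dvY using S(1) by (simp add: sum_subtractf Yc volume_eq)
  also have "\<dots> = density S X (G e0) * (l c * r e0 c - l c) * volume S X"
    using v dpos[OF pos PP(2)] by (simp add: l_def r_def field_simps)
  also have "\<bar>\<dots>\<bar> \<le> 1 * sqrt (12 * \<kappa> / \<theta>) * volume S X"
    unfolding abs_mult using density_bounds[of S X "G e0"] S(1) volume_nonneg[of S X] dev \<theta>
    by (intro mult_mono) auto
  finally show ?thesis by simp
qed

lemma sum_PiE_pair:
  fixes g :: "'v \<Rightarrow> 'v \<Rightarrow> real"
  assumes "finite S" "j \<in> S" "k \<in> S" "j \<noteq> k"
  shows "(\<Sum>x\<in>PiE S (X(j := A, k := B)). g (x j) (x k))
    = (\<Prod>l\<in>S - {j, k}. real (card (X l))) * (\<Sum>a\<in>A. \<Sum>b\<in>B. g a b)"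
proof -
  have S: "S = insert j (insert k (S - {j, k}))" using assms by auto
  have ni: "j \<notin> insert k (S - {j, k})" "k \<notin> S - {j, k}" using assms by auto
  have eq: "PiE (S - {j, k}) (X(j := A, k := B)) = PiE (S - {j, k}) X" by (intro PiE_cong) auto
  have "(\<Sum>x\<in>PiE S (X(j := A, k := B)). g (x j) (x k))
    = (\<Sum>a\<in>A. \<Sum>b\<in>B. \<Sum>x\<in>PiE (S - {j, k}) X. g a b)"
    using assms(4) by (subst S, subst sum_PiE_insert[OF ni(1)], subst sum_PiE_insert[OF ni(2)]) (simp add: eq)
  also have "\<dots> = (\<Sum>a\<in>A. \<Sum>b\<in>B. real (card (PiE (S - {j, k}) X)) * g a b)" by simp
  finally show ?thesis using assms(1) by (simp add: sum_distrib_left card_PiE)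
qed

text \<open>A maximiser exists since there are finitely many boxes. Comparison with the full box
  gives the rest: \<kappa> times the logarithm of the volume ratio is at least
  \<open>ln \<gamma>\<close>, which bounds every side from below, and the density of copies is still
  \<open>2 / 3 * \<gamma>\<close>.\<close>

lemma exists_regular_box:
  fixes E :: "'i::linorder \<Rightarrow> 'i \<Rightarrow> 'v \<Rightarrow> 'v \<Rightarrow> bool" and \<gamma> \<epsilon> :: real
  assumes S: "finite S" "pairs S \<noteq> {}" and V: "finite V" and \<gamma>: "0 < \<gamma>" and \<epsilon>: "0 < \<epsilon>" "\<epsilon> \<le> 1"
    and dens: "\<gamma> \<le> density S (\<lambda>_. V) (all_rel E (pairs S))"
  defines "P \<equiv> real (card (pairs S))"
  defines "\<kappa> \<equiv> \<epsilon>\<^sup>2 / (48 * P * (1 + ln (1 / \<gamma>)))"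
  obtains X p where "regular_system S E X p \<epsilon>" "\<And>k. k \<in> S \<Longrightarrow> X k \<subseteq> V"
    "\<And>k. k \<in> S \<Longrightarrow> \<gamma> powr (1 / \<kappa>) * real (card V) \<le> real (card (X k))"
    "2 / 3 * \<gamma> - P * \<epsilon> \<le> (\<Prod>(j, k)\<in>pairs S. p j k)"
proof -
  let ?PP = "pairs S"
  have finP: "finite ?PP" using S by simp
  have P: "1 \<le> P" using finP S card_gt_0_iff[of ?PP] by (simp add: P_def Suc_leI)
  define F where "F = all_rel E ?PP"
  define G where "G e x = (case e of (j, k) \<Rightarrow> E j k (x j) (x k))" for e and x :: "'i \<Rightarrow> 'v"
  have FG: "G e x" if "e \<in> ?PP" "F x" for e x using that by (auto simp: F_def G_def all_rel_def)
  have "density S (\<lambda>_. V) F \<le> 1" using S by (simp add: density_bounds)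
  with dens have \<gamma>1: "\<gamma> \<le> 1" by (simp add: F_def)
  define L where "L = 1 + ln (1 / \<gamma>)"
  have L: "1 \<le> L" using \<gamma> \<gamma>1 by (simp add: L_def)
  \<comment> \<open>With \<open>P * \<theta> = 1 / (4 * L)\<close> the reward for low pair densities
    changes the density of copies by a bounded factor only. The given \<kappa> then satisfies
    \<open>sqrt (12 * \<kappa> / \<theta>) = \<epsilon>\<close>.\<close>
  define \<theta> where "\<theta> = 1 / (4 * P * L)"
  have \<kappa>: "\<kappa> = \<theta> * \<epsilon>\<^sup>2 / 12" by (simp add: \<kappa>_def \<theta>_def L_def)
  have \<theta>: "0 < \<theta>" using P L by (simp add: \<theta>_def)
  have \<kappa>0: "0 < \<kappa>" using \<theta> \<epsilon> by (simp add: \<kappa>)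
  have \<theta>P: "P * \<theta> = 1 / (4 * L)" using P L by (simp add: \<theta>_def)
  have \<theta>P': "P * \<theta> \<le> 1 / 4" using L by (simp add: \<theta>P)
  have 1: "\<theta> \<le> P * \<theta>" using P \<theta> by (simp add: mult_le_cancel_right1)
  have 2: "\<kappa> \<le> \<theta> * 1 / 12" unfolding \<kappa> using \<theta> \<epsilon> by (intro divide_right_mono mult_left_mono power_le_one) auto
  have "(P + 1) * \<theta> + \<kappa> = P * \<theta> + \<theta> + \<kappa>" by (simp add: distrib_right)
  then have \<theta>\<kappa>: "(P + 1) * \<theta> + \<kappa> \<le> 1" using 1 2 \<theta>P' \<theta> by linarith
  have sq: "sqrt (12 * \<kappa> / \<theta>) = \<epsilon>" using \<theta> \<epsilon> by (simp add: \<kappa>)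
  define \<Phi> where "\<Phi> Y = ln (density S Y F) - \<theta> * (\<Sum>e\<in>?PP. ln (density S Y (G e))) + \<kappa> * ln (volume S Y)" for Y
  \<comment> \<open>Boxes without copies are excluded, since their logarithms would be
    meaningless.\<close>
  define BB where "BB = {X \<in> PiE S (\<lambda>_. Pow V). 0 < density S X F}"
  have finB: "finite BB" 
    by (rule finite_subset[of _ "PiE S (\<lambda>_. Pow V)"]) (use S V in \<open>auto simp: BB_def intro!: finite_PiE\<close>)
  define X0 where "X0 = (\<lambda>k\<in>S. V)"
  have pie: "PiE S X0 = PiE S (\<lambda>_. V)" by (intro PiE_cong) (simp add: X0_def)
  have vol0: "volume S X0 = volume S (\<lambda>_. V)" by (simp add: volume_def X0_def)
  have dens0: "density S X0 Q = density S (\<lambda>_. V) Q" for Q by (simp add: density_def pie vol0)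
  have X0: "X0 \<in> BB" using dens \<gamma> by (auto simp: BB_def dens0 F_def) (auto simp: X0_def)
  then have neB: "BB \<noteq> {}" by auto
  have "Max (\<Phi> ` BB) \<in> \<Phi> ` BB" using finB neB by (intro Max_in) auto
  then obtain X where X: "X \<in> BB" "\<Phi> X = Max (\<Phi> ` BB)" by auto
  have max: "\<Phi> Y \<le> \<Phi> X" if "Y \<in> BB" for Y using that finB X(2) by simp
  have XV: "X k \<subseteq> V" if "k \<in> S" for k using X(1) that by (auto simp: BB_def)
  have finX: "finite (X k)" if "k \<in> S" for k using XV[OF that] V finite_subset by blast
  have Fpos: "0 < density S X F" using X by (simp add: BB_def)
  have vX: "0 < volume S X"
  proof (rule ccontr)
    assume "\<not> 0 < volume S X"
    then have "volume S X = 0" using volume_nonneg[of S X] by linarith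
    then show False using Fpos by (simp add: density_def)
  qed
  have neX: "X k \<noteq> {}" if "k \<in> S" for k
  proof
    assume "X k = {}"
    then have "volume S X = 0" using that S(1) by (auto simp: volume_def intro!: prod_zero bexI[of _ k])
    then show False using vX by simp
  qed
  define p where "p j k = density S X (G (j, k))" for j k
  have reg: "\<bar>\<Sum>x\<in>PiE S (X(j := A, k := B)). of_bool (G (j, k) x) - p j k\<bar> \<le> \<epsilon> * volume S X"
    if jk: "(j, k) \<in> ?PP" and AB: "A \<subseteq> X j" "B \<subseteq> X k" for j k A B
  proof -
    have jk': "j \<in> S" "k \<in> S" "j \<noteq> k" using jk by (auto simp: pairs_def)
    have "quarter X j k A B c \<in> PiE S (\<lambda>_. Pow V)" for c
      using X(1) AB XV[OF jk'(1)] XV[OF jk'(2)] jk'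
      by (auto simp: BB_def quarter_def PiE_iff extensional_def split: prod.splits)
    then have "\<Phi> (quarter X j k A B c) \<le> \<Phi> X" if "0 < density S (quarter X j k A B c) F" for c
      using that by (intro max) (simp add: BB_def)
    then show ?thesis
      using maximal_box_regular[of S X ?PP "(j, k)" j k A B \<theta> \<kappa> F G] S(1) finX finP jk jk' AB \<theta> \<kappa>0 \<theta>\<kappa> FG Fpos
      unfolding \<Phi>_def sq p_def P_def by blast
  qed
  have rs: "regular_system S E X p \<epsilon>"
  proof
    show "finite S" by (rule S)
    show "finite (X k)" "X k \<noteq> {}" if "k \<in> S" for k using finX neX that by auto
    show "0 \<le> p j k" "p j k \<le> 1" for j k using S by (auto simp: p_def density_bounds)
    show "0 \<le> \<epsilon>" using \<epsilon> by simp
    fix j k A B assume jk: "(j, k) \<in> ?PP" and AB: "A \<subseteq> X j" "B \<subseteq> X k"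
    then have jk': "j \<in> S" "k \<in> S" "j \<noteq> k" by (auto simp: pairs_def)
    define R where "R = (\<Prod>l\<in>S - {j, k}. real (card (X l)))"
    have R: "0 < R" unfolding R_def using finX neX by (intro prod_pos) (auto simp: card_gt_0_iff)
    have "volume S X = R * (real (card (X j)) * real (card (X k)))"
    proof -
      have SS: "S = insert j (insert k (S - {j, k}))" using jk' by auto
      show ?thesis unfolding volume_def R_def using S(1) jk' by (subst SS, subst prod.insert) auto
    qed
    moreover have "(\<Sum>x\<in>PiE S (X(j := A, k := B)). of_bool (G (j, k) x) - p j k)
       = R * (\<Sum>a\<in>A. \<Sum>b\<in>B. of_bool (E j k a b) - p j k)"
      unfolding R_def using sum_PiE_pair[OF S(1) jk', of "\<lambda>a b. of_bool (E j k a b) - p j k" X A B]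
      by (simp add: G_def)
    ultimately have "R * \<bar>\<Sum>a\<in>A. \<Sum>b\<in>B. of_bool (E j k a b) - p j k\<bar> \<le> R * (\<epsilon> * real (card (X j)) * real (card (X k)))"
      using reg[OF jk AB] R by (simp add: abs_mult mult_ac)
    then show "\<bar>\<Sum>a\<in>A. \<Sum>b\<in>B. of_bool (E j k a b) - p j k\<bar> \<le> \<epsilon> * real (card (X j)) * real (card (X k))"
      using R by (rule mult_left_le_imp_le)
  qed
  interpret regular_system S E X p \<epsilon> by (rule rs)
  define f where "f = density S X F"
  have f1: "f \<le> 1" unfolding f_def using S by (simp add: density_bounds)
  have fd: "f \<le> density S X (G e)" if "e \<in> ?PP" for e
    unfolding f_def using S that FG by (intro density_mono) auto
  define D where "D = (\<Sum>e\<in>?PP. ln (density S X (G e)))"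
  have D: "P * ln f \<le> D"
  proof -
    have "(\<Sum>e\<in>?PP. ln f) \<le> D"
      unfolding D_def
    proof (rule sum_mono)
      fix e assume "e \<in> ?PP"
      then show "ln f \<le> ln (density S X (G e))" using fd[of e] Fpos by (simp add: f_def)
    qed
    then show ?thesis by (simp add: P_def)
  qed
  have lnf: "ln f \<le> 0" using f1 Fpos by (simp add: f_def)
  define V0 where "V0 = volume S (\<lambda>_. V)"
  have volle: "volume S X \<le> V0"
    unfolding V0_def volume_def using XV V by (intro prod_mono) (auto intro: card_mono)
  have V0: "0 < V0" using vX volle by linarith
  have main: "ln \<gamma> + \<kappa> * ln V0 \<le> ln f - \<theta> * D + \<kappa> * ln (volume S X)"
  proof -
    have "(\<Sum>e\<in>?PP. ln (density S X0 (G e))) \<le> 0"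
    proof (rule sum_nonpos)
      fix e assume "e \<in> ?PP"
      then have "density S X0 F \<le> density S X0 (G e)" using FG by (intro density_mono S(1)) auto
      then have "\<gamma> \<le> density S X0 (G e)" using dens by (simp add: F_def dens0)
      then show "ln (density S X0 (G e)) \<le> 0" using \<gamma> density_bounds(2)[OF S(1), of X0 "G e"] by simp
    qed
    then have "0 \<le> - (\<theta> * (\<Sum>e\<in>?PP. ln (density S X0 (G e))))" using \<theta> by (simp add: mult_nonneg_nonpos)
    moreover have "ln \<gamma> \<le> ln (density S X0 F)" using dens \<gamma> by (simp add: dens0 F_def)
    ultimately have "ln \<gamma> + \<kappa> * ln V0 \<le> \<Phi> X0" by (simp add: \<Phi>_def vol0 V0_def)
    also have "\<dots> \<le> \<Phi> X" by (rule max[OF X0])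
    finally show ?thesis by (simp add: \<Phi>_def f_def D_def)
  qed
  have "\<theta> * (P * ln f) \<le> \<theta> * D" using D \<theta> by (intro mult_left_mono) auto
  then have D': "P * \<theta> * ln f \<le> \<theta> * D" by (simp add: mult_ac)
  have "\<kappa> * ln (volume S X) \<le> \<kappa> * ln V0" using volle vX \<kappa>0 by (intro mult_left_mono) auto
  with main have ff: "ln \<gamma> + \<theta> * D \<le> ln f" by linarith
  \<comment> \<open>Bootstrapping: the crude bound \<open>4 / 3 * ln \<gamma>\<close> for
    \<open>ln f\<close> is fed back into \<open>P * \<theta> * ln f\<close> and improves to
    \<open>ln \<gamma> - 1 / 3\<close>, and \<open>exp (- 1 / 3)\<close> is at least
    \<open>2 / 3\<close>.\<close>
  have quarter: "1 / 4 * ln f \<le> P * \<theta> * ln f" using \<theta>P' lnf by (intro mult_right_mono_neg) auto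
  with ff D' have "4 / 3 * ln \<gamma> \<le> ln f" by linarith
  then have "P * \<theta> * (4 / 3 * ln \<gamma>) \<le> P * \<theta> * ln f" using P \<theta> by (intro mult_left_mono) auto
  moreover have "P * \<theta> * (4 / 3 * ln \<gamma>) \<ge> - 1 / 3"
  proof -
    have "- ln \<gamma> \<le> L" using \<gamma> by (simp add: L_def ln_div)
    then show ?thesis unfolding \<theta>P using L by (simp add: field_simps)
  qed
  ultimately have "ln \<gamma> - 1 / 3 \<le> ln f" using ff D' by linarith
  then have "exp (ln \<gamma> - 1 / 3) \<le> f" using Fpos by (metis exp_le_cancel_iff exp_ln f_def)
  moreover have "exp (ln \<gamma> - 1 / 3) = \<gamma> * exp (- 1 / 3)" using \<gamma> exp_add[of "ln \<gamma>" "- 1 / 3"] by simp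
  moreover have "\<gamma> * (2 / 3) \<le> \<gamma> * exp (- 1 / 3)" using \<gamma> exp_ge_add_one_self[of "- 1 / 3"] by (intro mult_left_mono) auto
  ultimately have f23: "2 / 3 * \<gamma> \<le> f" by linarith
  have prodp: "2 / 3 * \<gamma> - P * \<epsilon> \<le> (\<Prod>(j, k)\<in>?PP. p j k)"
  proof -
    have "\<bar>\<Sum>x\<in>PiE S X. of_bool (all_rel E ?PP x) - pp ?PP\<bar> \<le> P * \<epsilon> * volume S X"
      unfolding volume_def P_def by (rule counting) auto
    moreover have "(\<Sum>x\<in>PiE S X. of_bool (all_rel E ?PP x) - pp ?PP) = (f - pp ?PP) * volume S X"
      using density_volume[OF S(1) finX, where G = F] S(1)
      by (simp add: sum_subtractf f_def F_def volume_eq left_diff_distrib)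
    ultimately have "\<bar>f - pp ?PP\<bar> * volume S X \<le> P * \<epsilon> * volume S X" using vX by (simp add: abs_mult)
    then have "\<bar>f - pp ?PP\<bar> \<le> P * \<epsilon>" using vX by (rule mult_right_le_imp_le)
    then show ?thesis using f23 by (simp add: pp_def)
  qed
  have size: "\<gamma> powr (1 / \<kappa>) * real (card V) \<le> real (card (X k))" if k: "k \<in> S" for k
  proof -
    have cX: "0 < real (card (X k))" using finX neX k by (simp add: card_gt_0_iff)
    have cV: "0 < real (card V)" using cX card_mono[OF V XV[OF k]] by linarith
    have le: "volume S X * real (card V) \<le> real (card (X k)) * V0"
    proof -
      have "volume S X = real (card (X k)) * (\<Prod>l\<in>S - {k}. real (card (X l)))"
        unfolding volume_def using S(1) k by (rule prod.remove)
      also have "\<dots> \<le> real (card (X k)) * (\<Prod>l\<in>S - {k}. real (card V))"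
        using XV V by (intro mult_left_mono prod_mono) (auto intro: card_mono)
      finally have "volume S X * real (card V) \<le> real (card (X k)) * (\<Prod>l\<in>S - {k}. real (card V)) * real (card V)"
        by (intro mult_right_mono) auto
      also have "\<dots> = real (card (X k)) * V0"
        unfolding V0_def volume_def by (subst prod.remove[OF S(1) k]) (simp add: mult_ac)
      finally show ?thesis .
    qed
    have "ln \<gamma> \<le> \<kappa> * (ln (volume S X) - ln V0)"
    proof -
      have "0 \<le> - (3 / 4 * ln f)" using lnf by simp
      with main D' quarter show ?thesis by (simp add: right_diff_distrib)
    qed
    also have "ln (volume S X) - ln V0 = ln (volume S X / V0)" using vX V0 by (simp add: ln_div)
    also have "\<dots> \<le> ln (real (card (X k)) / real (card V))"
      using le vX V0 cX cV by (intro ln_mono) (auto simp: field_simps)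
    finally have "ln \<gamma> / \<kappa> \<le> ln (real (card (X k)) / real (card V))" using \<kappa>0 by (simp add: field_simps)
    then have "exp (ln \<gamma> / \<kappa>) \<le> real (card (X k)) / real (card V)"
      using cX cV by (metis divide_pos_pos exp_le_cancel_iff exp_ln)
    then show ?thesis using \<gamma> cV by (simp add: powr_def field_simps)
  qed
  show ?thesis using that rs XV size prodp by blast
qed

text \<open>The locale constrains increasing pairs only, so densities are read at \<open>min\<close>
  and \<open>max\<close>, and symmetry of \<open>E\<close> covers the pairs that \<pi>
  reverses.\<close>

lemma regular_system_permute:
  fixes E :: "nat \<Rightarrow> nat \<Rightarrow> 'v \<Rightarrow> 'v \<Rightarrow> bool"
  assumes "regular_system {..<n} E X p \<epsilon>" and \<pi>: "bij_betw \<pi> {..<n} {..<n}"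
    and sym: "\<And>j k a b. j \<noteq> k \<Longrightarrow> E j k a b \<longleftrightarrow> E k j b a"
  shows "regular_system {..<n} (\<lambda>j k. E (\<pi> j) (\<pi> k)) (X \<circ> \<pi>)
    (\<lambda>j k. p (min (\<pi> j) (\<pi> k)) (max (\<pi> j) (\<pi> k))) \<epsilon>"
proof -
  interpret regular_system "{..<n}" E X p \<epsilon> by fact
  have \<pi>n: "\<pi> k < n" if "k < n" for k using \<pi> that by (auto simp: bij_betw_def)
  have inj: "\<pi> j \<noteq> \<pi> k" if "j < n" "k < n" "j \<noteq> k" for j k
    using \<pi> that by (auto simp: bij_betw_def inj_on_def)
  have mm: "(min (\<pi> j) (\<pi> k), max (\<pi> j) (\<pi> k)) \<in> pairs {..<n}" if "(j, k) \<in> pairs {..<n}" for j k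
  proof -
    have "j < n" "k < n" "j \<noteq> k" using that by (auto simp: pairs_def)
    with inj[of j k] \<pi>n[of j] \<pi>n[of k] show ?thesis by (auto simp: pairs_def min_def max_def)
  qed
  show ?thesis
  proof
    show "finite ((X \<circ> \<pi>) k)" "(X \<circ> \<pi>) k \<noteq> {}" if "k \<in> {..<n}" for k
      using that \<pi>n finX neX by auto
    show "0 \<le> p (min (\<pi> j) (\<pi> k)) (max (\<pi> j) (\<pi> k))" "p (min (\<pi> j) (\<pi> k)) (max (\<pi> j) (\<pi> k)) \<le> 1"
      if "(j, k) \<in> pairs {..<n}" for j k using p_nonneg p_le_1 mm[OF that] by auto
    show "0 \<le> \<epsilon>" by (rule \<epsilon>_nonneg)
    fix j k A B assume jk: "(j, k) \<in> pairs {..<n}" and AB: "A \<subseteq> (X \<circ> \<pi>) j" "B \<subseteq> (X \<circ> \<pi>) k"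
    show "\<bar>\<Sum>a\<in>A. \<Sum>b\<in>B. of_bool (E (\<pi> j) (\<pi> k) a b) - p (min (\<pi> j) (\<pi> k)) (max (\<pi> j) (\<pi> k))\<bar>
      \<le> \<epsilon> * real (card ((X \<circ> \<pi>) j)) * real (card ((X \<circ> \<pi>) k))"
    proof (cases "\<pi> j < \<pi> k")
      case True
      then show ?thesis using regular[of "\<pi> j" "\<pi> k" A B] mm[OF jk] AB by (simp add: min_def max_def)
    next
      case False
      have "\<pi> j \<noteq> \<pi> k" using inj jk by (auto simp: pairs_def)
      with False have lt: "\<pi> k < \<pi> j" by simp
      have "(\<Sum>a\<in>A. \<Sum>b\<in>B. of_bool (E (\<pi> j) (\<pi> k) a b) - p (\<pi> k) (\<pi> j))
         = (\<Sum>b\<in>B. \<Sum>a\<in>A. of_bool (E (\<pi> k) (\<pi> j) b a) - p (\<pi> k) (\<pi> j))"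
        using sym[of "\<pi> j" "\<pi> k"] lt by (subst sum.swap) simp
      then show ?thesis using regular[of "\<pi> k" "\<pi> j" B A] mm[OF jk] AB lt
        by (simp add: min_def max_def mult_ac)
    qed
  qed simp
qed

text \<open>
  The product over \<open>v\<close> of \<open>w v = \<Prod>\<^bsub>k \<noteq> v\<^esub> q v k\<close> is the square of the product over all pairs,
  so at most three vertices have \<open>w v < s\<close>; these come last, the largest \<open>q\<close> among them joining
  the first and the third.
\<close>

lemma good_ordering:
  fixes q :: "nat \<Rightarrow> nat \<Rightarrow> real"
  assumes n: "n = u + 3" and s: "0 < s" "s \<le> 1"
    and q: "\<And>j k. j < n \<Longrightarrow> k < n \<Longrightarrow> j \<noteq> k \<Longrightarrow> 0 \<le> q j k \<and> q j k \<le> 1 \<and> q j k = q k j"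
    and prod: "s\<^sup>2 \<le> (\<Prod>(j, k)\<in>pairs {..<n}. q j k)"
  obtains \<pi> where "bij_betw \<pi> {..<n} {..<n}"
    "\<And>i. i < u \<Longrightarrow> s \<le> (\<Prod>k\<in>{Suc i..<n}. q (\<pi> i) (\<pi> k))" "s \<le> q (\<pi> u) (\<pi> (u + 2))"
    "s\<^sup>2 \<le> q (\<pi> u) (\<pi> (u + 1)) * q (\<pi> u) (\<pi> (u + 2)) * q (\<pi> (u + 1)) (\<pi> (u + 2))"
proof -
  define g where "g = (\<Prod>(j, k)\<in>pairs {..<n}. q j k)"
  define w where "w v = (\<Prod>k\<in>{..<n} - {v}. q v k)" for v
  have w: "0 \<le> w v" "w v \<le> 1" if "v < n" for v
    unfolding w_def using q that by (auto intro!: prod_nonneg prod_le_1)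
  have g0: "s\<^sup>2 \<le> g" using prod by (simp add: g_def)
  have "(\<Prod>v\<in>{..<n}. w v) = (\<Prod>(v, k)\<in>(SIGMA v:{..<n}. {..<n} - {v}). q v k)"
    unfolding w_def by (rule prod.Sigma) auto
  also have "(SIGMA v:{..<n}. {..<n} - {v}) = pairs {..<n} \<union> prod.swap ` pairs {..<n}"
    by (auto simp: pairs_def image_iff)
  also have "(\<Prod>(v, k)\<in>pairs {..<n} \<union> prod.swap ` pairs {..<n}. q v k)
      = g * (\<Prod>(v, k)\<in>prod.swap ` pairs {..<n}. q v k)"
    unfolding g_def by (rule prod.union_disjoint) (simp, simp, auto simp: pairs_def)
  also have "(\<Prod>(v, k)\<in>prod.swap ` pairs {..<n}. q v k) = g"
    unfolding g_def
    by (subst prod.reindex) (auto simp: inj_on_def pairs_def q case_prod_unfold intro!: prod.cong)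
  finally have prodw: "(\<Prod>v\<in>{..<n}. w v) = g * g" .
  define Bad where "Bad = {v. v < n \<and> w v < s}"
  have finBad: "finite Bad" by (simp add: Bad_def)
  \<comment> \<open>Four factors below \<open>s\<close> would push the product of all
    \<open>w v\<close> below \<open>s ^ 4\<close>, but it equals \<open>g * g\<close>.\<close>
  have "card Bad \<le> 3"
  proof (rule ccontr)
    assume "\<not> card Bad \<le> 3"
    then have "4 \<le> card Bad" by simp
    then obtain D where D: "D \<subseteq> Bad" "card D = 4" by (meson obtain_subset_with_card_n)
    have finD: "finite D" using D finBad finite_subset by blast
    have Dn: "D \<subseteq> {..<n}" using D by (auto simp: Bad_def)
    have "g * g = (\<Prod>v\<in>D. w v) * (\<Prod>v\<in>{..<n} - D. w v)"
      unfolding prodw[symmetric] using Dn by (simp add: prod.subset_diff mult.commute)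
    also have "\<dots> \<le> (\<Prod>v\<in>D. w v) * 1"
      using w Dn by (intro mult_left_mono prod_le_1 prod_nonneg) auto
    also have "(\<Prod>v\<in>D. w v) < (\<Prod>v\<in>D. s)"
    proof -
      obtain d where "d \<in> D" using D(2) by force
      then show ?thesis
        using D w Dn finD s by (intro prod_mono_strict[of d]) (auto simp: Bad_def subset_iff less_imp_le)
    qed
    also have "(\<Prod>v\<in>D. s) = s\<^sup>2 * s\<^sup>2" using D by (simp add: power4_eq_xxxx power2_eq_square)
    also have "\<dots> \<le> g * g" using g0 order_trans[OF zero_le_power2 g0] by (intro mult_mono) auto
    finally show False by simp
  qed
  obtain T where T: "Bad \<subseteq> T" "T \<subseteq> {..<n}" "card T = 3"
    using exists_subset_between[of Bad 3 "{..<n}"] \<open>card Bad \<le> 3\<close> n by (auto simp: Bad_def)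
  obtain a b c where abc: "T = {a, b, c}" "a \<noteq> b" "a \<noteq> c" "b \<noteq> c" using T(3) by (auto simp: card_3_iff)
  have abcn: "a < n" "b < n" "c < n" using T abc by auto
  have q3: "s\<^sup>2 \<le> q a b * q a c * q b c" if "a \<noteq> b" "a \<noteq> c" "b \<noteq> c" "a < n" "b < n" "c < n" for a b c
  proof -
    define o2 where "o2 x y = (min x y, max x y)" for x y :: nat
    let ?D = "{o2 a b, o2 a c, o2 b c}"
    have Dp: "?D \<subseteq> pairs {..<n}" using that by (auto simp: o2_def pairs_def min_def max_def)
    have dist: "o2 a b \<noteq> o2 a c" "o2 a b \<noteq> o2 b c" "o2 a c \<noteq> o2 b c"
      using that by (auto simp: o2_def min_def max_def split: if_splits)
    have qo: "(case o2 x y of (j, k) \<Rightarrow> q j k) = q x y" if "x \<noteq> y" "x < n" "y < n" for x y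
      using q[of x y] that by (auto simp: o2_def min_def max_def)
    have b01: "0 \<le> (case e of (j, k) \<Rightarrow> q j k) \<and> (case e of (j, k) \<Rightarrow> q j k) \<le> 1" if "e \<in> pairs {..<n}" for e
      using that q by (auto simp: pairs_def)
    have "g = (\<Prod>(j, k)\<in>pairs {..<n} - ?D. q j k) * (\<Prod>(j, k)\<in>?D. q j k)"
      unfolding g_def using Dp by (intro prod.subset_diff) auto
    also have "\<dots> \<le> 1 * (\<Prod>(j, k)\<in>?D. q j k)"
      using b01 Dp by (intro mult_right_mono prod_le_1 prod_nonneg) auto
    also have "(\<Prod>(j, k)\<in>?D. q j k) = q a b * q a c * q b c"
      using dist qo that by simp
    finally show ?thesis using g0 by simp
  qed
  have "\<exists>x y z. T = {x, y, z} \<and> x \<noteq> y \<and> x \<noteq> z \<and> y \<noteq> z \<and> s \<le> q x y"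
  proof (rule ccontr)
    assume no: "\<not> ?thesis"
    have "q a b < s" using no abc by (metis not_le)
    moreover have "q a c < s" using no abc by (metis insert_commute not_le)
    moreover have "q b c < s" using no abc by (metis insert_commute not_le)
    ultimately have "q a b * q a c * q b c < s * s * 1"
      using q[of a b] q[of a c] q[of b c] abc abcn s
      by (intro mult_strict_mono' mult_nonneg_nonneg) auto
    then show False using q3[OF abc(2-4) abcn] by (simp add: power2_eq_square)
  qed
  then obtain x y z where xyz: "T = {x, y, z}" "x \<noteq> y" "x \<noteq> z" "y \<noteq> z" "s \<le> q x y" by blast
  have xyzn: "x < n" "y < n" "z < n" using T xyz by auto
  have "card ({..<n} - T) = card {..<u}" using T n by (subst card_Diff_subset) (auto intro: finite_subset)
  then obtain f where f: "bij_betw f {..<u} ({..<n} - T)"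
    by (metis finite_Diff finite_lessThan finite_same_card_bij)
  \<comment> \<open>The pair \<open>x\<close>, \<open>y\<close> with density at least
    \<open>s\<close> goes to positions \<open>u\<close> and \<open>u + 2\<close>, the only pair
    among the last three that is charged for.\<close>
  define \<pi> where "\<pi> i = (if i < u then f i else if i = u then x else if i = u + 1 then z else y)" for i
  have \<pi>u: "\<pi> u = x" "\<pi> (u + 1) = z" "\<pi> (u + 2) = y" by (auto simp: \<pi>_def)
  have "\<pi> ` {..<n} = {..<n}"
  proof -
    have "{..<n} = {..<u} \<union> {u, u + 1, u + 2}" using n by auto
    then have "\<pi> ` {..<n} = \<pi> ` {..<u} \<union> {x, z, y}"
      by (simp only: image_Un image_insert image_empty \<pi>u)
    also have "\<pi> ` {..<u} = {..<n} - T" using f by (auto simp: bij_betw_def \<pi>_def)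
    finally show ?thesis using xyz T by auto
  qed
  then have bij: "bij_betw \<pi> {..<n} {..<n}"
    using eq_card_imp_inj_on[of "{..<n}" \<pi>] by (simp add: bij_betw_def)
  have ne: "\<pi> l \<noteq> \<pi> i \<and> \<pi> l < n" if "i < u" "Suc i \<le> l" "l < n" for i l
    using that n bij inj_onD[of \<pi> "{..<n}" l i] unfolding bij_betw_def by fastforce
  show ?thesis
  proof (rule that[OF bij])
    show "s \<le> q (\<pi> u) (\<pi> (u + 2))" using xyz \<pi>u by simp
    have "q x z * q x y * q z y = q x y * q x z * q y z"
      using q[of z y] xyz xyzn by (simp add: mult_ac)
    then show "s\<^sup>2 \<le> q (\<pi> u) (\<pi> (u + 1)) * q (\<pi> u) (\<pi> (u + 2)) * q (\<pi> (u + 1)) (\<pi> (u + 2))"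
      unfolding \<pi>u using q3[OF xyz(2-4) xyzn(1,2,3)] by linarith
    fix i assume i: "i < u"
    then have "\<pi> i \<in> {..<n} - T" using f by (auto simp: \<pi>_def bij_betw_def)
    then have \<pi>i: "\<pi> i < n" "\<pi> i \<notin> Bad" using T by auto
    have "s \<le> w (\<pi> i)" using \<pi>i by (simp add: Bad_def)
    also have "w (\<pi> i) = (\<Prod>k\<in>({..<n} - {\<pi> i}) - \<pi> ` {Suc i..<n}. q (\<pi> i) k) * (\<Prod>k\<in>\<pi> ` {Suc i..<n}. q (\<pi> i) k)"
      unfolding w_def
    proof (rule prod.subset_diff)
      show "\<pi> ` {Suc i..<n} \<subseteq> {..<n} - {\<pi> i}"
        using ne[OF i] by auto
    qed simp
    also have "\<dots> \<le> 1 * (\<Prod>k\<in>\<pi> ` {Suc i..<n}. q (\<pi> i) k)"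
    proof (intro mult_right_mono prod_le_1 prod_nonneg)
      fix k assume "k \<in> \<pi> ` {Suc i..<n}"
      then obtain l where l: "k = \<pi> l" "Suc i \<le> l" "l < n" by auto
      then have "\<pi> l \<noteq> \<pi> i" "\<pi> l < n" using ne[OF i] by auto
      then show "0 \<le> q (\<pi> i) k" using q[of "\<pi> i" k] \<pi>i l by auto
    qed (use q \<pi>i in auto)
    also have "\<dots> = (\<Prod>k\<in>{Suc i..<n}. q (\<pi> i) (\<pi> k))"
      using bij by (subst prod.reindex) (auto simp: bij_betw_def intro: inj_on_subset)
    finally show "s \<le> (\<Prod>k\<in>{Suc i..<n}. q (\<pi> i) (\<pi> k))" .
  qed
qed

section \<open>Blowups in dense systems of tuples\<close>

text \<open>The inner power lifts fractions from \<open>s / 4\<close> on to at least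
  \<open>1 - 1 / (2 * n)\<close>, by the exponential bound, and leaves fractions below
  \<open>s / (4 * (K + 1))\<close> at 1/4 or less, by Bernoulli. The outer power separates them: a
  product of \<open>n\<close> values of the first kind is still at least \<open>(1 / 2) ^ Q\<close>,
  one of the second is at most \<open>(1 / 4) ^ Q\<close>. Since \<open>K\<close> depends on
  \<open>n\<close> alone, the thresholds differ by a constant factor.\<close>

lemma amp_params:
  fixes s :: real and n :: nat
  assumes n: "0 < n" and s: "0 < s" "s \<le> 1"
  defines "K \<equiv> 4 * ln (2 * real n)"
  defines "R \<equiv> nat \<lceil>K / s\<rceil>"
  shows "\<And>f. s / 4 \<le> f \<Longrightarrow> f \<le> 1 \<Longrightarrow> (1 - 1 / (2 * real n)) ^ Q \<le> amp R Q f"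
    and "\<And>f. 0 \<le> f \<Longrightarrow> f \<le> 1 \<Longrightarrow> f < s / (4 * (K + 1)) \<Longrightarrow> amp R Q f \<le> (1 / 4) ^ Q"
proof -
  have K: "0 < K" using n by (simp add: K_def)
  have Ks: "0 < K / s" using K s by simp
  have R: "K / s \<le> real R" "real R \<le> K / s + 1" using Ks unfolding R_def by linarith+
  show "(1 - 1 / (2 * real n)) ^ Q \<le> amp R Q f" if f: "s / 4 \<le> f" "f \<le> 1" for f
  proof -
    have "(1 - f) ^ R \<le> exp (- f) ^ R" using f exp_ge_add_one_self[of "- f"] by (intro power_mono) auto
    also have "\<dots> = exp (- (real R * f))" by (simp add: exp_of_nat_mult[symmetric])
    also have "\<dots> \<le> exp (- (K / 4))"
    proof -
      have "K / s * (s / 4) \<le> real R * f" using R f s Ks by (intro mult_mono) auto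
      then show ?thesis using s by simp
    qed
    also have "\<dots> = 1 / (2 * real n)" using n by (simp add: K_def exp_minus inverse_eq_divide)
    finally show ?thesis unfolding amp_def using n by (intro power_mono) auto
  qed
  show "amp R Q f \<le> (1 / 4) ^ Q" if f: "0 \<le> f" "f \<le> 1" "f < s / (4 * (K + 1))" for f
  proof -
    have "1 - real R * f \<le> (1 - f) ^ R" using Bernoulli_inequality[of "- f" R] f by simp
    moreover have "real R * f \<le> (K / s + 1) * (s / (4 * (K + 1)))" using R f Ks by (intro mult_mono) auto
    moreover have "(K / s + 1) * (s / (4 * (K + 1))) \<le> 1 / 4"
    proof -
      have "(K / s + 1) * (s / (4 * (K + 1))) = (K + s) / (4 * (K + 1))"
      proof -
        have "K / s + 1 = (K + s) / s" using s by (simp add: add_divide_distrib)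
        then show ?thesis using s by simp
      qed
      also have "\<dots> \<le> (K + 1) / (4 * (K + 1))" using s K by (intro divide_right_mono) auto
      also have "\<dots> = 1 / 4" using K by simp
      finally show ?thesis .
    qed
    ultimately have "1 - (1 - f) ^ R \<le> 1 / 4" by linarith
    moreover have "0 \<le> 1 - (1 - f) ^ R" using f by (simp add: power_le_one)
    ultimately show ?thesis unfolding amp_def by (intro power_mono)
  qed
qed

lemma power_of_two_between:
  fixes x :: real
  assumes "1 \<le> x"
  obtains Q :: nat where "x < 2 ^ Q" "2 ^ Q \<le> 2 * x"
proof -
  have ex: "\<exists>Q. x < 2 ^ Q" using real_arch_pow[of 2 x] by auto
  define Q where "Q = (LEAST Q. x < (2::real) ^ Q)"
  have Q: "x < 2 ^ Q" unfolding Q_def using ex by (rule LeastI_ex)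
  moreover have "2 ^ Q \<le> 2 * x"
  proof (cases Q)
    case 0
    then show ?thesis using assms by simp
  next
    case (Suc k)
    then have "\<not> x < 2 ^ k" using not_less_Least[of k "\<lambda>Q. x < (2::real) ^ Q"] by (simp add: Q_def)
    then show ?thesis using Suc by simp
  qed
  ultimately show ?thesis using that by blast
qed

text \<open>All constants are fixed here. The point is that \<omega> stays above a power of
  \<gamma>, so \<open>m\<close> can be of order \<open>ln N / ln (1 / \<gamma>)\<close>, of which a
  proportion of order \<open>s\<close> survives in every part.\<close>

lemma tuple_blowup:
  fixes u :: nat
  defines "n \<equiv> u + 3"
  shows "\<exists>c>0. \<forall>\<gamma>::real. 0 < \<gamma> \<longrightarrow> \<gamma> \<le> 1 / 2 \<longrightarrow> (\<exists>N0. \<forall>(V :: 'v set) E. finite V \<longrightarrow> N0 \<le> card V \<longrightarrow>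
    (\<forall>j k a b. j \<noteq> k \<longrightarrow> E j k a b = E k j b a) \<longrightarrow>
    \<gamma> \<le> density {..<n} (\<lambda>_. V) (all_rel E (pairs {..<n})) \<longrightarrow>
    (\<exists>A. (\<forall>j<n. A j \<subseteq> V \<and> c * sqrt \<gamma> / ln (1 / \<gamma>) * ln (real (card V)) \<le> real (card (A j))) \<and>
      (\<forall>j<n. \<forall>k<n. \<forall>a\<in>A j. \<forall>b\<in>A k. j \<noteq> k \<longrightarrow> E j k a b)))"
proof -
  have n0: "0 < n" "3 \<le> n" by (simp_all add: n_def)
  define K where "K = 4 * ln (2 * real n)"
  have K: "0 < K" using n0 by (simp add: K_def)
  define C where "C = 4 * (K + 1)"
  \<comment> \<open>\<open>(n + 1) + (8 * n + 20) + 1\<close>, in units of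
    \<open>m * \<Lambda>\<close>: the pigeonhole losses, the \<open>m\<close>-th power of
    \<open>\<omega>0\<close>, and slack.\<close>
  define a where "a = 9 * real n + 22"
  \<comment> \<open>The 8 collects the 2 in \<open>sqrt \<gamma> / 2 \<le> s\<close>, the 2 in
    \<open>x\<close>, and a 2 for rounding \<open>x\<close> down; \<open>C + 8\<close> dominates
    both \<open>C\<close> and 8.\<close>
  define c where "c = 1 / (8 * (C + 8) * a)"
  have a: "0 < a" by (simp add: a_def)
  have C: "0 < C" using K by (simp add: C_def)
  have c: "0 < c" using a C by (simp add: c_def)
  show ?thesis
  proof (intro exI[of _ c] conjI c allI impI)
    fix \<gamma> :: real assume \<gamma>: "0 < \<gamma>" "\<gamma> \<le> 1 / 2"
    define \<Lambda> where "\<Lambda> = ln (1 / \<gamma>)"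
    have \<Lambda>2: "ln 2 \<le> \<Lambda>" using \<gamma> by (simp add: \<Lambda>_def ln_mono field_simps)
    have \<Lambda>: "0 < \<Lambda>" using \<Lambda>2 ln_gt_zero[of "2::real"] by linarith
    \<comment> \<open>\<open>\<gamma> / 2 = 2 / 3 * \<gamma> - \<gamma> / 6\<close> is what the
      error \<open>P * \<epsilon>\<close> leaves of the product of the pair densities.\<close>
    define s where "s = sqrt (\<gamma> / 2)"
    have s: "0 < s" "s \<le> 1" using \<gamma> by (auto simp: s_def)
    have s2: "s\<^sup>2 = \<gamma> / 2" using \<gamma> by (simp add: s_def)
    define R where "R = nat \<lceil>K / s\<rceil>"
    define b where "b = s\<^sup>2 * (s / 8) ^ n"
    have b: "0 < b" "b \<le> 1"
      using s by (auto simp: b_def intro!: mult_le_one power_le_one)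
    \<comment> \<open>As \<open>8 * \<omega> = b * \<beta> ^ n\<close> is at least
      \<open>b * (1 / 2) ^ Q\<close>, a \<open>Q\<close> with \<open>2 ^ Q > 128 / b\<close> brings
      \<open>(1 / 4) ^ Q\<close> below \<open>\<omega> / 16\<close>. The upper bound on
      \<open>2 ^ Q\<close> keeps \<omega> polynomial in \<open>b\<close>.\<close>
    have "1 \<le> 128 / b" using b by (simp add: field_simps)
    then obtain Q where Q: "128 / b < 2 ^ Q" "2 ^ Q \<le> 2 * (128 / b)" by (rule power_of_two_between)
    define \<beta> where "\<beta> = (1 - 1 / (2 * real n)) ^ Q"
    have \<beta>: "0 < \<beta>" "\<beta> \<le> 1" 
    proof -
      have "1 / (2 * real n) < 1" using n0 by simp
      moreover have "0 \<le> 1 / (2 * real n)" by simp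
      ultimately show "0 < \<beta>" "\<beta> \<le> 1" unfolding \<beta>_def by (auto intro!: zero_less_power power_le_one)
    qed
    have \<beta>n: "(1 / 2) ^ Q \<le> \<beta> ^ n"
    proof -
      have "1 / 2 \<le> (1 - 1 / (2 * real n)) ^ n"
        using Bernoulli_inequality[of "- (1 / (2 * real n))" n] n0 by (simp add: field_simps)
      then have "(1 / 2) ^ Q \<le> ((1 - 1 / (2 * real n)) ^ n) ^ Q" by (intro power_mono) auto
      then show ?thesis by (simp add: \<beta>_def power_mult[symmetric] mult.commute)
    qed
    define \<sigma> where "\<sigma> = (s * \<beta> / 8) ^ n"
    define \<omega> where "\<omega> = s\<^sup>2 * (s * \<beta> / 8) ^ n / 8"
    have \<sigma>: "0 < \<sigma>" using s \<beta> by (simp add: \<sigma>_def)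
    have \<omega>: "b * (1 / 2) ^ Q / 8 \<le> \<omega>"
    proof -
      have "b * (1 / 2) ^ Q \<le> b * \<beta> ^ n" using b \<beta>n by (intro mult_left_mono) auto
      also have "\<dots> = s\<^sup>2 * (s * \<beta> / 8) ^ n" by (simp add: b_def power_mult_distrib power_divide)
      finally show ?thesis by (simp add: \<omega>_def)
    qed
    have r: "s / C \<le> f" if f: "0 \<le> f" "f \<le> 1" "\<omega> / 16 \<le> amp R Q f" for f
    proof (rule ccontr)
      assume "\<not> s / C \<le> f"
      then have "amp R Q f \<le> (1 / 4) ^ Q"
        unfolding R_def K_def using f s n0 by (intro amp_params(2)) (auto simp: C_def K_def)
      also have "\<dots> = (1 / 2) ^ Q * (1 / 2) ^ Q" by (simp add: power_mult_distrib[symmetric])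
      also have "\<dots> < b / 128 * (1 / 2) ^ Q"
      proof -
        have "1 / 2 ^ Q < b / 128" using Q(1) b by (simp add: field_simps)
        then show ?thesis by (intro mult_strict_right_mono) (auto simp: power_one_over)
      qed
      also have "\<dots> \<le> \<omega> / 16" using \<omega> by simp
      finally show False using f by simp
    qed
    \<comment> \<open>A bound without \<beta> and \<open>Q\<close>:
      \<open>(1 / 2) ^ Q \<ge> b / 256\<close> gives \<open>\<omega> \<ge> b ^ 2 / 2048\<close>, and
      \<open>embed\<close> asks for a further 32.\<close>
    define \<omega>0 where "\<omega>0 = b\<^sup>2 / 65536"
    have \<omega>0: "0 < \<omega>0" "\<omega>0 \<le> \<omega> / 32"
    proof -
      show "0 < \<omega>0" using b by (simp add: \<omega>0_def)
      have "b / 256 \<le> (1 / 2) ^ Q" using Q(2) b by (simp add: field_simps power_one_over)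
      then have "b * (b / 256) \<le> b * (1 / 2) ^ Q" using b by (intro mult_left_mono) auto
      with \<omega> show "\<omega>0 \<le> \<omega> / 32" by (simp add: \<omega>0_def power2_eq_square)
    qed
    have ln\<omega>0: "- ln \<omega>0 \<le> (8 * real n + 20) * \<Lambda>"
    proof -
      have lns: "- ln s \<le> \<Lambda>"
      proof -
        have "ln s = ln (\<gamma> / 2) / 2" using \<gamma> by (simp add: s_def ln_sqrt)
        moreover have "ln (\<gamma> / 2) = ln \<gamma> - ln 2" "\<Lambda> = - ln \<gamma>" using \<gamma> by (simp_all add: \<Lambda>_def ln_div)
        ultimately show ?thesis using \<Lambda>2 by linarith
      qed
      have "ln b = 2 * ln s + real n * (ln s - 3 * ln 2)"
      proof -
        have "ln (8::real) = 3 * ln 2" using ln_realpow[of 2 3] by simp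
        then show ?thesis using s by (simp add: b_def ln_mult ln_realpow ln_div)
      qed
      moreover have "ln \<omega>0 = 2 * ln b - 16 * ln 2"
      proof -
        have "ln (65536::real) = 16 * ln 2" using ln_realpow[of 2 16] by simp
        then show ?thesis using b by (simp add: \<omega>0_def ln_div ln_realpow)
      qed
      ultimately have "- ln \<omega>0 = 4 * (- ln s) + 2 * real n * (- ln s) + 6 * real n * ln 2 + 16 * ln 2"
        by (simp add: algebra_simps)
      also have "\<dots> \<le> 4 * \<Lambda> + 2 * real n * \<Lambda> + 6 * real n * \<Lambda> + 16 * \<Lambda>"
        using lns \<Lambda>2 by (intro add_mono mult_left_mono) auto
      finally show ?thesis by (simp add: algebra_simps)
    qed
    define P where "P = real (card (pairs {..<n}))"
    have "(0, 1) \<in> pairs {..<n}" using n0 by (auto simp: pairs_def)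
    then have neP: "pairs {..<n} \<noteq> {}" by auto
    then have P: "0 < P" by (simp add: P_def card_gt_0_iff)
    define B where "B = ((1 + 2 ^ R) ^ Q) ^ n * real n"
    have B: "0 < B" using n0 by (simp add: B_def zero_less_power add_pos_pos)
    define \<epsilon> where "\<epsilon> = min 1 (min (\<gamma> / (6 * P)) (s * s\<^sup>2 * \<sigma>\<^sup>2 / 32 / B))"
    have \<epsilon>: "0 < \<epsilon>" "\<epsilon> \<le> 1" using \<gamma> P s \<sigma> B by (auto simp: \<epsilon>_def)
    have \<epsilon>P: "P * \<epsilon> \<le> \<gamma> / 6"
    proof -
      have "P * \<epsilon> \<le> P * (\<gamma> / (6 * P))" using P by (intro mult_left_mono) (auto simp: \<epsilon>_def)
      then show ?thesis using P by simp
    qed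
    have \<epsilon>B: "B * \<epsilon> \<le> s * s\<^sup>2 * \<sigma>\<^sup>2 / 32"
    proof -
      have "B * \<epsilon> \<le> B * (s * s\<^sup>2 * \<sigma>\<^sup>2 / 32 / B)" using B by (intro mult_left_mono) (auto simp: \<epsilon>_def)
      then show ?thesis using B by simp
    qed
    define c0 where "c0 = \<gamma> powr (1 / (\<epsilon>\<^sup>2 / (48 * P * (1 + ln (1 / \<gamma>)))))"
    have c0: "0 < c0" using \<gamma> by (simp add: c0_def)
    \<comment> \<open>The first entry ensures that \<open>m\<close> is positive. The second lets one
      half of \<open>ln N\<close> absorb \<open>c0\<close> and the four surplus factors
      \<open>\<omega>0\<close>; the other half pays for what grows with \<open>m\<close>.\<close>
    define x0 where "x0 = max (2 * a * \<Lambda>) (8 * ((8 * real n + 20) * \<Lambda>) - 2 * ln c0)"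
    define N0 where "N0 = nat \<lceil>exp x0\<rceil>"
    show "\<exists>N0. \<forall>(V :: 'v set) E. finite V \<longrightarrow> N0 \<le> card V \<longrightarrow>
      (\<forall>j k a b. j \<noteq> k \<longrightarrow> E j k a b = E k j b a) \<longrightarrow>
      \<gamma> \<le> density {..<n} (\<lambda>_. V) (all_rel E (pairs {..<n})) \<longrightarrow>
      (\<exists>A. (\<forall>j<n. A j \<subseteq> V \<and> c * sqrt \<gamma> / ln (1 / \<gamma>) * ln (real (card V)) \<le> real (card (A j))) \<and>
        (\<forall>j<n. \<forall>k<n. \<forall>a\<in>A j. \<forall>b\<in>A k. j \<noteq> k \<longrightarrow> E j k a b))"
    proof (intro exI[of _ N0] allI impI)
      fix V :: "'v set" and E :: "nat \<Rightarrow> nat \<Rightarrow> 'v \<Rightarrow> 'v \<Rightarrow> bool"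
      assume V: "finite V" "N0 \<le> card V"
        and sym0: "\<forall>j k a b. j \<noteq> k \<longrightarrow> E j k a b = E k j b a"
        and dens: "\<gamma> \<le> density {..<n} (\<lambda>_. V) (all_rel E (pairs {..<n}))"
      define N where "N = real (card V)"
      have "exp x0 \<le> N" using V(2) unfolding N0_def N_def by linarith
      then have N: "0 < N" "x0 \<le> ln N"
        using exp_gt_zero[of x0] by (linarith, metis exp_gt_zero ln_exp ln_mono)
      have sym: "E j k a b \<longleftrightarrow> E k j b a" if "j \<noteq> k" for j k a b using sym0 that by blast
      obtain X p where rs: "regular_system {..<n} E X p \<epsilon>" and XV: "\<And>k. k \<in> {..<n} \<Longrightarrow> X k \<subseteq> V"
        and size: "\<And>k. k \<in> {..<n} \<Longrightarrow> c0 * N \<le> real (card (X k))"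
        and pp: "2 / 3 * \<gamma> - P * \<epsilon> \<le> (\<Prod>(j, k)\<in>pairs {..<n}. p j k)"
        by (rule exists_regular_box[OF finite_lessThan neP V(1) \<gamma>(1) \<epsilon> dens, folded P_def, folded c0_def N_def])
          (rule that; assumption)
      interpret reg: regular_system "{..<n}" E X p \<epsilon> by (rule rs)
      define q where "q j k = p (min j k) (max j k)" for j k
      have q: "0 \<le> q j k \<and> q j k \<le> 1 \<and> q j k = q k j" if "j < n" "k < n" "j \<noteq> k" for j k
      proof -
        have "(min j k, max j k) \<in> pairs {..<n}" using that by (auto simp: pairs_def min_def max_def)
        then show ?thesis using reg.p_nonneg reg.p_le_1 by (auto simp: q_def min.commute max.commute)
      qed
      have qp: "s\<^sup>2 \<le> (\<Prod>(j, k)\<in>pairs {..<n}. q j k)"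
      proof -
        have "(\<Prod>(j, k)\<in>pairs {..<n}. q j k) = (\<Prod>(j, k)\<in>pairs {..<n}. p j k)"
          by (intro prod.cong refl) (auto simp: q_def pairs_def)
        then show ?thesis using pp \<epsilon>P by (simp add: s2)
      qed
      obtain \<pi> where \<pi>: "bij_betw \<pi> {..<n} {..<n}"
        "\<And>i. i < u \<Longrightarrow> s \<le> (\<Prod>k\<in>{Suc i..<n}. q (\<pi> i) (\<pi> k))" "s \<le> q (\<pi> u) (\<pi> (u + 2))"
        "s\<^sup>2 \<le> q (\<pi> u) (\<pi> (u + 1)) * q (\<pi> u) (\<pi> (u + 2)) * q (\<pi> (u + 1)) (\<pi> (u + 2))"
        by (rule good_ordering[OF n_def[THEN meta_eq_to_obj_eq] s q qp]; (assumption | (rule that; assumption)))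
      have rs': "regular_system {..<n} (\<lambda>j k. E (\<pi> j) (\<pi> k)) (X \<circ> \<pi>) (\<lambda>j k. q (\<pi> j) (\<pi> k)) \<epsilon>"
        unfolding q_def by (rule regular_system_permute[OF rs \<pi>(1) sym])
      have \<pi>n: "\<pi> k < n" if "k < n" for k using \<pi>(1) that by (auto simp: bij_betw_def)
      define x where "x = ln N / (2 * a * \<Lambda>)"
      have x: "1 \<le> x" using N(2) a \<Lambda> by (simp add: x_def x0_def)
      define m where "m = nat \<lfloor>x\<rfloor>"
      have m: "real m \<le> x" "x / 2 \<le> real m" "0 < m"
      proof -
        have "1 \<le> \<lfloor>x\<rfloor>" using x by simp
        then have "real m = of_int \<lfloor>x\<rfloor>" "1 \<le> real m" by (simp_all add: m_def)
        then show "real m \<le> x" "x / 2 \<le> real m" "0 < m" by linarith+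
      qed
      have large: "real (m * 2 ^ (m * n)) \<le> (\<omega> / 32) ^ (m + 4) * (c0 * N)"
      proof -
        have "real m \<le> 2 ^ m" using less_exp[of m] by (metis less_imp_le of_nat_le_iff of_nat_numeral of_nat_power)
        then have "real (m * 2 ^ (m * n)) \<le> 2 ^ m * 2 ^ (m * n)" by (simp add: mult_right_mono)
        also have "\<dots> = 2 ^ (m * (n + 1))" by (simp add: power_add)
        also have "\<dots> = exp (real (m * (n + 1)) * ln 2)" by (simp only: exp_of_nat_mult) simp
        also have "\<dots> \<le> exp (real (m + 4) * ln \<omega>0 + ln c0 + ln N)"
        proof -
          define D where "D = (8 * real n + 20) * \<Lambda>"
          have "real (m * (n + 1)) * ln 2 \<le> real (m * (n + 1)) * \<Lambda>" using \<Lambda>2 by (intro mult_left_mono) auto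
          moreover have "real (m * (n + 1)) * \<Lambda> + real m * D + real m * \<Lambda> = real m * (a * \<Lambda>)"
            by (simp add: a_def D_def algebra_simps)
          moreover have "0 \<le> real m * \<Lambda>" using \<Lambda> by simp
          moreover have "real m * (a * \<Lambda>) \<le> x * (a * \<Lambda>)" using m a \<Lambda> by (intro mult_right_mono) auto
          moreover have "x * (a * \<Lambda>) = ln N / 2" using a \<Lambda> by (simp add: x_def)
          moreover have "8 * D - 2 * ln c0 \<le> ln N"
            using N(2) by (simp only: x0_def max.bounded_iff D_def)
          moreover have "real (m + 4) * (- ln \<omega>0) \<le> real m * D + 4 * D"
            using mult_left_mono[OF ln\<omega>0[folded D_def], of "real (m + 4)"] by (simp add: distrib_right)
          ultimately have "real (m * (n + 1)) * ln 2 \<le> - (real (m + 4) * - ln \<omega>0) + ln c0 + ln N"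
            by linarith
          then show ?thesis by simp
        qed
        also have "\<dots> = \<omega>0 ^ (m + 4) * (c0 * N)"
          using \<omega>0 c0 N by (simp only: exp_add exp_of_nat_mult exp_ln mult.assoc)
        also have "\<dots> \<le> (\<omega> / 32) ^ (m + 4) * (c0 * N)"
          using \<omega>0 c0 N by (intro mult_right_mono power_mono) auto
        finally show ?thesis .
      qed
      have \<beta>amp: "\<beta> \<le> amp R Q f" if "s / 4 \<le> f" "f \<le> 1" for f
        unfolding \<beta>_def R_def K_def using that s n0 by (intro amp_params(1))
      obtain A where A: "\<And>j. j < n \<Longrightarrow> A j \<subseteq> (X \<circ> \<pi>) j"
        "\<And>j k a b. j < k \<Longrightarrow> k < n \<Longrightarrow> a \<in> A j \<Longrightarrow> b \<in> A k \<Longrightarrow> E (\<pi> j) (\<pi> k) a b"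
        "\<And>j. j < n \<Longrightarrow> min (real m) (min (s / C) (s / 8) * real m) \<le> real (card (A j))"
      proof (rule embed[OF rs' n_def[THEN meta_eq_to_obj_eq] m(3) order_refl s \<pi>(2,3) _ \<pi>(4) \<beta>amp \<beta> r])
        show "0 < s\<^sup>2" using s by simp
        show "((1 + 2 ^ R) ^ Q) ^ n * real n * \<epsilon> \<le> s * s\<^sup>2 * ((s * \<beta> / 8) ^ n)\<^sup>2 / 32"
          using \<epsilon>B by (simp add: B_def \<sigma>_def)
        show "c0 * N \<le> real (card ((X \<circ> \<pi>) i))" if "i < n" for i using size[of "\<pi> i"] \<pi>n[OF that] by simp
        show "real (m * 2 ^ (m * n)) \<le> (s\<^sup>2 * (s * \<beta> / 8) ^ n / 8 / 32) ^ (m + 4) * (c0 * N)"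
          using large by (simp add: \<omega>_def)
      qed (auto simp: \<omega>_def)
      define \<rho> where "\<rho> = inv_into {..<n} \<pi>"
      have \<rho>: "\<rho> j < n" "\<pi> (\<rho> j) = j" if "j < n" for j
        using \<pi>(1) that inv_into_into[of j \<pi> "{..<n}"] f_inv_into_f[of j \<pi> "{..<n}"]
        by (auto simp: \<rho>_def bij_betw_def)
      have lower: "c * sqrt \<gamma> / ln (1 / \<gamma>) * ln (real (card V)) \<le> real (card (A (\<rho> j)))" if j: "j < n" for j
      proof -
        have "c * sqrt \<gamma> / ln (1 / \<gamma>) * ln (real (card V)) = (sqrt \<gamma> / 2) / (C + 8) * (x / 2)"
          using a C \<Lambda> by (simp add: c_def x_def N_def \<Lambda>_def[symmetric] field_simps)
        also have "\<dots> \<le> s / (C + 8) * real m"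
        proof -
          have "sqrt \<gamma> / 2 = sqrt (\<gamma> / 4)" by (simp add: real_sqrt_divide)
          also have "\<dots> \<le> s" unfolding s_def using \<gamma> by (intro real_sqrt_le_mono) auto
          finally show ?thesis using m x C \<gamma> s by (intro mult_mono divide_right_mono) auto
        qed
        also have "\<dots> \<le> min (real m) (min (s / C) (s / 8) * real m)"
        proof -
          have "s / (C + 8) \<le> s / C" "s / (C + 8) \<le> s / 8" "s / (C + 8) \<le> 1"
            using s C by (auto simp: field_simps intro: frac_le)
          then have "s / (C + 8) * real m \<le> min (s / C) (s / 8) * real m" "s / (C + 8) * real m \<le> 1 * real m"
            by (intro mult_right_mono; simp)+
          then show ?thesis by simp
        qed
        also have "\<dots> \<le> real (card (A (\<rho> j)))" using A(3) \<rho>(1)[OF j] by blast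
        finally show ?thesis .
      qed
      show "\<exists>A. (\<forall>j<n. A j \<subseteq> V \<and> c * sqrt \<gamma> / ln (1 / \<gamma>) * ln (real (card V)) \<le> real (card (A j))) \<and>
        (\<forall>j<n. \<forall>k<n. \<forall>a\<in>A j. \<forall>b\<in>A k. j \<noteq> k \<longrightarrow> E j k a b)"
      proof (intro exI[of _ "A \<circ> \<rho>"] conjI allI impI ballI)
        fix j assume j: "j < n"
        show "(A \<circ> \<rho>) j \<subseteq> V" using A(1)[OF \<rho>(1)[OF j]] XV[of j] \<rho>(2)[OF j] j by auto
        show "c * sqrt \<gamma> / ln (1 / \<gamma>) * ln (real (card V)) \<le> real (card ((A \<circ> \<rho>) j))" using lower[OF j] by simp
      next
        fix j k y z assume jk: "j < n" "k < n" "j \<noteq> k" and yz: "y \<in> (A \<circ> \<rho>) j" "z \<in> (A \<circ> \<rho>) k"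
        have "\<rho> j \<noteq> \<rho> k" using \<rho>(2) jk by metis
        then consider "\<rho> j < \<rho> k" | "\<rho> k < \<rho> j" by linarith
        then show "E j k y z"
        proof cases
          case 1
          then show ?thesis using A(2)[OF 1 \<rho>(1)[OF jk(2)], of y z] yz \<rho>(2) jk by simp
        next
          case 2
          then show ?thesis using A(2)[OF 2 \<rho>(1)[OF jk(1)], of z y] yz \<rho>(2) jk sym[of j k y z] by simp
        qed
      qed
    qed
  qed
qed

section \<open>Copies and blowups in graphs\<close>

lemma density_insert:
  fixes V :: "'v set"
  assumes "finite S" "k \<notin> S" "finite V" "V \<noteq> {}" "\<And>x y. G (x(k := y)) \<longleftrightarrow> G x"
  shows "density (insert k S) (\<lambda>_. V) G = density S (\<lambda>_. V) G"
  using assms by (simp add: density_def volume_def sum_PiE_insert card_gt_0_iff)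

text \<open>Parts of non-adjacent vertices of \<open>H\<close> may overlap, which a blowup forbids.
  With \<open>h * t\<close> elements each there is room for a greedy choice.\<close>

lemma disjoint_subsets:
  fixes A :: "nat \<Rightarrow> 'v set"
  assumes "\<And>j. j < h \<Longrightarrow> finite (A j) \<and> h * t \<le> card (A j)"
  obtains B where "\<And>j. j < h \<Longrightarrow> B j \<subseteq> A j \<and> card (B j) = t"
    "\<And>j k. j < h \<Longrightarrow> k < h \<Longrightarrow> j \<noteq> k \<Longrightarrow> B j \<inter> B k = {}"
proof -
  have "\<exists>B. (\<forall>j<i. B j \<subseteq> A j \<and> card (B j) = t) \<and> (\<forall>j<i. \<forall>k<i. j \<noteq> k \<longrightarrow> B j \<inter> B k = {})"
    if "i \<le> h" for i
    using that
  proof (induction i)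
    case (Suc i)
    then obtain B where B: "\<And>j. j < i \<Longrightarrow> B j \<subseteq> A j \<and> card (B j) = t"
      "\<And>j k. j < i \<Longrightarrow> k < i \<Longrightarrow> j \<noteq> k \<Longrightarrow> B j \<inter> B k = {}"
      by (meson Suc_leD)
    define U where "U = (\<Union>j<i. B j)"
    have fB: "finite (B j)" if "j < i" for j using B(1)[OF that] assms[of j] that Suc.prems finite_subset by auto
    have finU: "finite U" unfolding U_def using fB by auto
    have "card U \<le> (\<Sum>j<i. card (B j))" unfolding U_def by (rule card_UN_le) simp
    also have "\<dots> = i * t" using B by simp
    finally have cU: "card U \<le> i * t" .
    have "t + i * t \<le> h * t" using Suc.prems by (metis mult_Suc mult_le_mono1)
    also have "\<dots> \<le> card (A i)" using assms[of i] Suc.prems by simp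
    finally have "t \<le> card (A i) - card U" using cU by linarith
    also have "\<dots> \<le> card (A i - U)" using finU by (rule diff_card_le_card_Diff)
    finally obtain C where C: "C \<subseteq> A i - U" "card C = t" by (meson obtain_subset_with_card_n)
    show ?case
    proof (intro exI[of _ "B(i := C)"] conjI allI impI)
      fix j assume "j < Suc i"
      then show "(B(i := C)) j \<subseteq> A j" "card ((B(i := C)) j) = t"
        using B(1)[of j] C by (cases "j = i"; force)+
    next
      fix j k assume "j < Suc i" "k < Suc i" "j \<noteq> k"
      then show "(B(i := C)) j \<inter> (B(i := C)) k = {}"
        using B(2)[of j k] C by (cases "j = i"; cases "k = i"; force simp: U_def)
    qed
  qed simp
  from this[OF order_refl] show ?thesis using that by blast
qed

text \<open>True for non-adjacent pairs, since copies need not be induced, and for indices from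
  \<open>h\<close> on, which act as dummy vertices.\<close>

definition edge_rel :: "nat \<Rightarrow> (nat \<Rightarrow> 'a) \<Rightarrow> 'a pair_pre_digraph \<Rightarrow> 'b pair_pre_digraph \<Rightarrow> nat \<Rightarrow> nat \<Rightarrow> 'b \<Rightarrow> 'b \<Rightarrow> bool" where
  "edge_rel h e H G j k a b \<longleftrightarrow> (j < h \<and> k < h \<and> (e j, e k) \<in> parcs H \<longrightarrow> (a, b) \<in> parcs G)"

lemma copyE:
  assumes "pair_graph H" "S \<in> copies H G"
  obtains f where "inj_on f (pverts H)" "pverts S = f ` pverts H" "parcs S = map_prod f f ` parcs H"
    "pverts S \<subseteq> pverts G" "parcs S \<subseteq> parcs G"
proof -
  interpret pair_graph H by fact
  have "pair_wf_digraph H" by unfold_locales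
  with assms(2) show ?thesis
    using that by (auto simp: copies_def digraph_iso_with_proj_iff subgraph_def)
qed

text \<open>An isomorphism onto a copy determines the copy, so choosing one for each copy gives an
  injection into tuples. Injectivity of the tuples is recorded for the case
  \<open>\<gamma> \<ge> 1\<close>.\<close>

lemma card_copies_le:
  fixes H :: "'a pair_pre_digraph" and G :: "'b pair_pre_digraph"
  assumes H: "pair_graph H" and G: "pair_graph G" and e: "bij_betw e {..<h} (pverts H)"
  shows "card (copies H G) \<le>
    card {x \<in> PiE {..<h} (\<lambda>_. pverts G). inj_on x {..<h} \<and> all_rel (edge_rel h e H G) (pairs {..<h}) x}"
proof -
  interpret H: pair_graph H by fact
  interpret G: pair_graph G by fact
  let ?T = "{x \<in> PiE {..<h} (\<lambda>_. pverts G). inj_on x {..<h} \<and> all_rel (edge_rel h e H G) (pairs {..<h}) x}"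
  have "\<forall>S\<in>copies H G. \<exists>f. inj_on f (pverts H) \<and> pverts S = f ` pverts H \<and> parcs S = map_prod f f ` parcs H
      \<and> pverts S \<subseteq> pverts G \<and> parcs S \<subseteq> parcs G"
    using copyE[OF H] by metis
  then obtain f where f: "\<And>S. S \<in> copies H G \<Longrightarrow> inj_on (f S) (pverts H) \<and> pverts S = f S ` pverts H
      \<and> parcs S = map_prod (f S) (f S) ` parcs H \<and> pverts S \<subseteq> pverts G \<and> parcs S \<subseteq> parcs G"
    by metis
  define x where "x S = restrict (f S \<circ> e) {..<h}" for S
  have eH: "e ` {..<h} = pverts H" and einj: "inj_on e {..<h}" using e by (auto simp: bij_betw_def)
  have ev: "\<exists>j<h. v = e j" if "v \<in> pverts H" for v using that eH by auto
  have "x ` copies H G \<subseteq> ?T"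
  proof (rule image_subsetI)
    fix S assume S: "S \<in> copies H G"
    have "inj_on (f S \<circ> e) {..<h}" using f[OF S] einj eH by (auto intro: comp_inj_on)
    then have "inj_on (x S) {..<h}" by (simp add: x_def inj_on_def)
    moreover have "x S \<in> PiE {..<h} (\<lambda>_. pverts G)"
    proof -
      have "f S (e j) \<in> pverts G" if "j < h" for j using f[OF S] eH that by blast
      then show ?thesis by (auto simp: x_def)
    qed
    moreover have "all_rel (edge_rel h e H G) (pairs {..<h}) (x S)"
      using f[OF S] by (force simp: all_rel_def edge_rel_def pairs_def x_def)
    ultimately show "x S \<in> ?T" by simp
  qed
  moreover have "inj_on x (copies H G)"
  proof (rule inj_onI)
    fix S S' assume SS: "S \<in> copies H G" "S' \<in> copies H G" and eq: "x S = x S'"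
    have ff: "f S v = f S' v" if v: "v \<in> pverts H" for v
    proof -
      obtain j where j: "j < h" "v = e j" using ev[OF v] by auto
      have "x S j = x S' j" using eq by simp
      then show ?thesis using j by (simp add: x_def)
    qed
    have "pverts S = pverts S'" using f[OF SS(1)] f[OF SS(2)] ff by (auto simp: image_iff)
    moreover have "map_prod (f S) (f S) ` parcs H = map_prod (f S') (f S') ` parcs H"
      using ff H.in_arcsD1 H.in_arcsD2 by (intro image_cong refl) (auto simp: map_prod_def)
    then have "parcs S = parcs S'" using f[OF SS(1)] f[OF SS(2)] by simp
    ultimately show "S = S'" by simp
  qed
  moreover have "finite ?T" by (rule finite_subset[of _ "PiE {..<h} (\<lambda>_. pverts G)"]) (auto intro!: finite_PiE)
  ultimately show ?thesis using card_inj_on_le by blast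
qed

lemma contains_blowup:
  fixes H :: "'a pair_pre_digraph" and G :: "'b pair_pre_digraph"
  assumes H: "pair_graph H" and G: "pair_graph G"
    and B: "\<And>v. v \<in> pverts H \<Longrightarrow> B v \<subseteq> pverts G \<and> card (B v) = t"
    and disj: "\<And>v w. v \<in> pverts H \<Longrightarrow> w \<in> pverts H \<Longrightarrow> v \<noteq> w \<Longrightarrow> B v \<inter> B w = {}"
    and compl: "\<And>v w a b. (v, w) \<in> parcs H \<Longrightarrow> a \<in> B v \<Longrightarrow> b \<in> B w \<Longrightarrow> (a, b) \<in> parcs G"
  shows "contains_copy G (blowup H t)"
proof -
  interpret H: pair_graph H by fact
  interpret G: pair_graph G by fact
  interpret BH: pair_graph "blowup H t" by (rule pair_graph_blowup[OF H])
  have "\<exists>g. bij_betw g {..<t} (B v)" if "v \<in> pverts H" for v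
    using B[OF that] finite_subset[OF _ G.finite_verts] ex_bij_betw_nat_finite[of "B v"]
    by (auto simp: atLeast0LessThan)
  then obtain g where g: "\<And>v. v \<in> pverts H \<Longrightarrow> bij_betw (g v) {..<t} (B v)" by metis
  define f where "f = (\<lambda>(v, i). g v i)"
  have gB: "g v i \<in> B v" if "v \<in> pverts H" "i < t" for v i using g[OF that(1)] that(2) by (auto simp: bij_betw_def)
  have inj: "inj_on f (pverts (blowup H t))"
  proof (rule inj_onI)
    fix a b assume ab: "a \<in> pverts (blowup H t)" "b \<in> pverts (blowup H t)" "f a = f b"
    obtain v i w j where e: "a = (v, i)" "b = (w, j)" by force
    have vw: "v \<in> pverts H" "w \<in> pverts H" "i < t" "j < t" using ab e by (auto simp: blowup_def)
    have eq: "g v i = g w j" using ab e by (simp add: f_def)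
    have "v = w" using disj[OF vw(1,2)] gB[OF vw(1,3)] gB[OF vw(2,4)] eq by auto
    moreover have "i = j" using g[OF vw(1)] eq vw \<open>v = w\<close> by (auto simp: bij_betw_def inj_on_def)
    ultimately show "a = b" using e by simp
  qed
  define S where "S = \<lparr>pverts = f ` pverts (blowup H t), parcs = map_prod f f ` parcs (blowup H t)\<rparr>"
  have "pair_wf_digraph (blowup H t)" by unfold_locales
  then have "digraph_iso (with_proj (blowup H t)) (with_proj S)"
    using inj by (auto simp: digraph_iso_with_proj_iff S_def)
  moreover have "pverts S \<subseteq> pverts G"
  proof
    fix x assume "x \<in> pverts S"
    then obtain v i where "v \<in> pverts H" "i < t" "x = g v i" by (auto simp: S_def f_def blowup_def)
    then show "x \<in> pverts G" using gB B by blast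
  qed
  moreover have "parcs S \<subseteq> parcs G"
  proof
    fix x assume "x \<in> parcs S"
    then obtain v i w j where x: "(v, w) \<in> parcs H" "i < t" "j < t" "x = (g v i, g w j)"
      by (auto simp: S_def f_def blowup_def)
    then have "v \<in> pverts H" "w \<in> pverts H" using H.in_arcsD1 H.in_arcsD2 by blast+
    then show "x \<in> parcs G" using compl x gB by blast
  qed
  moreover have "wf_digraph (with_proj S)"
    unfolding wf_digraph_wp_iff
  proof
    fix x assume "x \<in> parcs S"
    then obtain a b where ab: "(a, b) \<in> parcs (blowup H t)" "x = (f a, f b)" by (auto simp: S_def)
    then have "a \<in> pverts (blowup H t)" "b \<in> pverts (blowup H t)"
      using BH.in_arcsD1 BH.in_arcsD2 by blast+
    then show "fst x \<in> pverts S" "snd x \<in> pverts S" using ab by (auto simp: S_def)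
  qed
  moreover have "wf_digraph (with_proj G)" by (rule G.wf_digraph)
  ultimately have "S \<in> copies (blowup H t) G"
    by (simp add: copies_def subgraph_def compatible_def)
  then show ?thesis by (auto simp: contains_copy_def)
qed

text \<open>The empty graph serves those \<open>N\<close> for which the required size is not
  positive.\<close>

lemma contains_blowup_0: "pair_graph H \<Longrightarrow> pair_graph G \<Longrightarrow> contains_copy G (blowup H 0)"
  by (rule contains_blowup[where B = "\<lambda>_. {}"]) auto

lemma many_copies_blowup:
  fixes H :: "'a pair_pre_digraph"
  assumes H: "pair_graph H"
  shows "\<exists>c>0. \<forall>\<gamma>. 0 < \<gamma> \<longrightarrow> \<gamma> \<le> 1 / 2 \<longrightarrow> (\<exists>N0. \<forall>N\<ge>N0. \<forall>G. many_copies H \<gamma> N G \<longrightarrow>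
    (\<exists>t. c * sqrt \<gamma> / ln (1 / \<gamma>) * ln (real N) \<le> real t \<and> contains_copy G (blowup H t)))"
proof -
  interpret H: pair_graph H by fact
  define h where "h = card (pverts H)"
  have "finite (pverts H)" using H.finite_verts by simp
  then obtain e where e: "bij_betw e {..<h} (pverts H)"
    using ex_bij_betw_nat_finite[of "pverts H"] by (auto simp: h_def atLeast0LessThan)
  define \<rho> where "\<rho> = inv_into {..<h} e"
  have \<rho>: "\<rho> v < h" "e (\<rho> v) = v" if "v \<in> pverts H" for v
    using e that inv_into_into[of v e "{..<h}"] f_inv_into_f[of v e "{..<h}"]
    by (auto simp: \<rho>_def bij_betw_def)
  from tuple_blowup[of h, where 'v = nat] obtain c where c: "0 < c" and
    tb: "\<forall>\<gamma>::real. 0 < \<gamma> \<longrightarrow> \<gamma> \<le> 1 / 2 \<longrightarrow> (\<exists>N0. \<forall>(V :: nat set) E. finite V \<longrightarrow> N0 \<le> card V \<longrightarrow>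
      (\<forall>j k a b. j \<noteq> k \<longrightarrow> E j k a b = E k j b a) \<longrightarrow>
      \<gamma> \<le> density {..<h + 3} (\<lambda>_. V) (all_rel E (pairs {..<h + 3})) \<longrightarrow>
      (\<exists>A. (\<forall>j<h + 3. A j \<subseteq> V \<and> c * sqrt \<gamma> / ln (1 / \<gamma>) * ln (real (card V)) \<le> real (card (A j))) \<and>
        (\<forall>j<h + 3. \<forall>k<h + 3. \<forall>a\<in>A j. \<forall>b\<in>A k. j \<noteq> k \<longrightarrow> E j k a b)))"
    by (elim exE conjE) (rule that)
  \<comment> \<open>\<open>h + 1\<close> pays for disjointness and stays positive for empty
    \<open>H\<close>; the 2 pays for rounding down.\<close>
  define c' where "c' = c / (2 * (real h + 1))"
  have c': "0 < c'" using c by (simp add: c'_def)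
  show ?thesis
  proof (intro exI[of _ c'] conjI c' allI impI)
    fix \<gamma> :: real assume \<gamma>: "0 < \<gamma>" "\<gamma> \<le> 1 / 2"
    define \<Lambda> where "\<Lambda> = ln (1 / \<gamma>)"
    have \<Lambda>: "0 < \<Lambda>" using \<gamma> by (simp add: \<Lambda>_def)
    from tb[rule_format, OF \<gamma>, folded \<Lambda>_def] obtain N1 where
      N1: "\<forall>(V :: nat set) E. finite V \<longrightarrow> N1 \<le> card V \<longrightarrow>
      (\<forall>j k a b. j \<noteq> k \<longrightarrow> E j k a b = E k j b a) \<longrightarrow>
      \<gamma> \<le> density {..<h + 3} (\<lambda>_. V) (all_rel E (pairs {..<h + 3})) \<longrightarrow>
      (\<exists>A. (\<forall>j<h + 3. A j \<subseteq> V \<and> c * sqrt \<gamma> / \<Lambda> * ln (real (card V)) \<le> real (card (A j))) \<and>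
        (\<forall>j<h + 3. \<forall>k<h + 3. \<forall>a\<in>A j. \<forall>b\<in>A k. j \<noteq> k \<longrightarrow> E j k a b))"
      by (elim exE) (rule that)
    define x0 where "x0 = (real h + 1) * \<Lambda> / (c * sqrt \<gamma>)"
    define N0 where "N0 = max N1 (nat \<lceil>exp x0\<rceil>)"
    show "\<exists>N0. \<forall>N\<ge>N0. \<forall>G. many_copies H \<gamma> N G \<longrightarrow>
      (\<exists>t. c' * sqrt \<gamma> / ln (1 / \<gamma>) * ln (real N) \<le> real t \<and> contains_copy G (blowup H t))"
    proof (rule exI[of _ N0], intro allI impI)
      fix N :: nat and G :: "nat pair_pre_digraph"
      assume N: "N0 \<le> N" and mc: "many_copies H \<gamma> N G"
      then have G: "pair_graph G" and cG: "card (pverts G) = N"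
        and copies: "\<gamma> * real N ^ h \<le> real (card (copies H G))" by (auto simp: many_copies_def h_def)
      interpret G: pair_graph G by (rule G)
      have finV: "finite (pverts G)" using G.finite_verts by simp
      have "exp x0 \<le> real N" using N unfolding N0_def by linarith
      then have Npos: "0 < real N" and lnN: "x0 \<le> ln (real N)"
        using exp_gt_zero[of x0] by (linarith, metis exp_gt_zero ln_exp ln_mono)
      have neV: "pverts G \<noteq> {}" using Npos cG by auto
      define E where "E = edge_rel h e H G"
      have sym: "\<forall>j k a b. j \<noteq> k \<longrightarrow> E j k a b = E k j b a"
        unfolding E_def edge_rel_def using H.arcs_symmetric G.arcs_symmetric by blast
      \<comment> \<open>Three dummy vertices provide a final triple whatever the size of
        \<open>H\<close>, without affecting the density.\<close>
      have all_eq: "all_rel E (pairs {..<h + 3}) = all_rel E (pairs {..<h})"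
        by (auto simp: fun_eq_iff all_rel_def pairs_def E_def edge_rel_def)
      let ?Q = "all_rel E (pairs {..<h})"
      have upd: "?Q (x(k := y)) \<longleftrightarrow> ?Q x" if "h \<le> k" for x y k
        using that by (auto simp: all_rel_def pairs_def)
      have ins: "{..<h + 3} = insert (h + 2) (insert (h + 1) (insert h {..<h}))" by auto
      have "density {..<h + 3} (\<lambda>_. pverts G) ?Q = density {..<h} (\<lambda>_. pverts G) ?Q"
        unfolding ins using finV neV upd by (simp add: density_insert)
      also have "\<gamma> \<le> \<dots>"
      proof -
        have "card (copies H G) \<le> card {x \<in> PiE {..<h} (\<lambda>_. pverts G). ?Q x}"
          by (rule order_trans[OF card_copies_le[OF H G e]], rule card_mono)
             (auto simp: E_def intro!: finite_PiE finV)
        moreover have "(\<Sum>x\<in>PiE {..<h} (\<lambda>_. pverts G). of_bool (?Q x)) = real (card {x \<in> PiE {..<h} (\<lambda>_. pverts G). ?Q x})"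
          using finV by (simp add: of_bool_def sum.If_cases finite_PiE Int_def)
        ultimately have "\<gamma> * real N ^ h \<le> (\<Sum>x\<in>PiE {..<h} (\<lambda>_. pverts G). of_bool (?Q x))"
          using copies by simp
        then show ?thesis using Npos by (simp add: density_def volume_def cG pos_le_divide_eq)
      qed
      finally have dens: "\<gamma> \<le> density {..<h + 3} (\<lambda>_. pverts G) (all_rel E (pairs {..<h + 3}))"
        unfolding all_eq .
      have "N1 \<le> card (pverts G)" using N cG by (simp add: N0_def)
      with N1 finV sym dens have "\<exists>A. (\<forall>j<h + 3. A j \<subseteq> pverts G \<and> c * sqrt \<gamma> / \<Lambda> * ln (real N) \<le> real (card (A j))) \<and>
        (\<forall>j<h + 3. \<forall>k<h + 3. \<forall>a\<in>A j. \<forall>b\<in>A k. j \<noteq> k \<longrightarrow> E j k a b)"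
        unfolding cG[symmetric] by blast
      then obtain A where
        A0: "\<forall>j<h + 3. A j \<subseteq> pverts G \<and> c * sqrt \<gamma> / \<Lambda> * ln (real N) \<le> real (card (A j))"
          "\<forall>j<h + 3. \<forall>k<h + 3. \<forall>a\<in>A j. \<forall>b\<in>A k. j \<noteq> k \<longrightarrow> E j k a b"
        by (elim exE conjE) (rule that)
      have A: "\<And>j. j < h + 3 \<Longrightarrow> A j \<subseteq> pverts G"
        "\<And>j. j < h + 3 \<Longrightarrow> c * sqrt \<gamma> / \<Lambda> * ln (real N) \<le> real (card (A j))"
        "\<And>j k a b. j < h + 3 \<Longrightarrow> k < h + 3 \<Longrightarrow> a \<in> A j \<Longrightarrow> b \<in> A k \<Longrightarrow> j \<noteq> k \<Longrightarrow> E j k a b"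
        using A0 by blast+
      define T where "T = c * sqrt \<gamma> / \<Lambda> * ln (real N)"
      have T: "real h + 1 \<le> T"
      proof -
        have "c * sqrt \<gamma> / \<Lambda> * x0 \<le> T" unfolding T_def using c \<gamma> \<Lambda> lnN by (intro mult_left_mono) auto
        then show ?thesis using c \<gamma> \<Lambda> by (simp add: x0_def)
      qed
      define y where "y = T / (real h + 1)"
      have y1: "1 \<le> y" using T by (simp add: y_def)
      define t where "t = nat \<lfloor>y\<rfloor>"
      have "1 \<le> \<lfloor>y\<rfloor>" using y1 by simp
      then have "real t = of_int \<lfloor>y\<rfloor>" "1 \<le> real t" by (simp_all add: t_def)
      then have t: "real t \<le> y" "y / 2 \<le> real t" by linarith+
      have ht: "h * t \<le> card (A j)" if "j < h" for j
      proof -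
        have "real h * real t \<le> (real h + 1) * y" using t y1 by (intro mult_mono) auto
        also have "\<dots> = T" by (simp add: y_def)
        also have "\<dots> \<le> real (card (A j))" using A(2)[of j] that by (simp add: T_def)
        finally have "real (h * t) \<le> real (card (A j))" by simp
        then show ?thesis by (simp only: of_nat_le_iff)
      qed
      have finA: "finite (A j) \<and> h * t \<le> card (A j)" if "j < h" for j
        using ht[OF that] finite_subset[OF A(1) finV, of j] that by simp
      obtain B where B: "\<And>j. j < h \<Longrightarrow> B j \<subseteq> A j \<and> card (B j) = t"
        "\<And>j k. j < h \<Longrightarrow> k < h \<Longrightarrow> j \<noteq> k \<Longrightarrow> B j \<inter> B k = {}"
        by (rule disjoint_subsets[of h A t]) (use finA in blast)+
      have "contains_copy G (blowup H t)"
      proof (rule contains_blowup[OF H G])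
        show "B (\<rho> v) \<subseteq> pverts G \<and> card (B (\<rho> v)) = t" if "v \<in> pverts H" for v
          using B(1)[OF \<rho>(1)[OF that]] A(1)[of "\<rho> v"] \<rho>(1)[OF that] by auto
        show "B (\<rho> v) \<inter> B (\<rho> w) = {}" if "v \<in> pverts H" "w \<in> pverts H" "v \<noteq> w" for v w
          using B(2)[OF \<rho>(1) \<rho>(1)] \<rho>(2) that by metis
        fix v w a b assume vw: "(v, w) \<in> parcs H" and ab: "a \<in> B (\<rho> v)" "b \<in> B (\<rho> w)"
        have vw': "v \<in> pverts H" "w \<in> pverts H" "v \<noteq> w"
          using vw H.in_arcsD1 H.in_arcsD2 H.no_loops' by auto
        then have "\<rho> v \<noteq> \<rho> w" using \<rho>(2) by metis
        moreover have "a \<in> A (\<rho> v)" "b \<in> A (\<rho> w)" using ab B(1) \<rho>(1) vw' by blast+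
        ultimately have "E (\<rho> v) (\<rho> w) a b" using A(3)[of "\<rho> v" "\<rho> w"] \<rho>(1) vw' by (simp add: trans_less_add1)
        then show "(a, b) \<in> parcs G" using vw \<rho> vw' by (simp add: E_def edge_rel_def)
      qed
      moreover have "c' * sqrt \<gamma> / ln (1 / \<gamma>) * ln (real N) \<le> real t"
      proof -
        have "c' * sqrt \<gamma> / ln (1 / \<gamma>) * ln (real N) = y / 2"
          by (simp add: y_def c'_def T_def \<Lambda>_def[symmetric] field_simps)
        then show ?thesis using t(2) by (rule ord_eq_le_trans)
      qed
      ultimately show "\<exists>t. c' * sqrt \<gamma> / ln (1 / \<gamma>) * ln (real N) \<le> real t \<and> contains_copy G (blowup H t)" by blast
    qed
  qed
qed

section \<open>From finite hosts to the constant\<close>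

lemma many_copies_mono: "many_copies H \<gamma> N G \<Longrightarrow> \<gamma>' \<le> \<gamma> \<Longrightarrow> many_copies H \<gamma>' N G"
  unfolding many_copies_def by (meson mult_right_mono of_nat_0_le_iff order_trans zero_le_power)

text \<open>The hypothesis is nearly contradictory: copies are at most as many as injective tuples,
  fewer than \<open>N ^ h\<close> once \<open>h\<close> and \<open>N\<close> are at least 2.
  Otherwise the host has at most one vertex, or \<open>H\<close> has at most one vertex and no arcs,
  and \<open>H[N]\<close> is present.\<close>

lemma forces_blowup_dense:
  fixes H :: "'a pair_pre_digraph"
  assumes H: "pair_graph H" and \<gamma>: "1 \<le> \<gamma>"
  shows "forces_blowup H \<gamma> 1"
  unfolding forces_blowup_def
proof (intro exI[of _ "\<lambda>_. 0"] conjI tendsto_const allI impI)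
  interpret H: pair_graph H by fact
  fix N and G :: "nat pair_pre_digraph" assume mc: "many_copies H \<gamma> N G"
  then have G: "pair_graph G" and cG: "card (pverts G) = N"
    and copies: "\<gamma> * real N ^ card (pverts H) \<le> real (card (copies H G))" by (auto simp: many_copies_def)
  interpret G: pair_graph G by (rule G)
  have finV: "finite (pverts G)" "finite (pverts H)" using G.finite_verts H.finite_verts by simp_all
  define h where "h = card (pverts H)"
  obtain e where e: "bij_betw e {..<h} (pverts H)"
    using ex_bij_betw_nat_finite[of "pverts H"] finV by (auto simp: h_def atLeast0LessThan)
  show "\<exists>t. (1 - 0) * log 2 (real N) \<le> real t \<and> contains_copy G (blowup H t)"
  proof (cases "N \<le> 1")
    case True
    then have "N = 0 \<or> N = 1" by auto
    \<comment> \<open>For \<open>N = 0\<close> this uses the convention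
      \<open>ln 0 = 0\<close>.\<close>
    then have "log 2 (real N) \<le> 0" by (auto simp: log_def)
    then show ?thesis using contains_blowup_0[OF H G] by (intro exI[of _ 0]) simp
  next
    case False
    have "h \<le> 1"
    proof (rule ccontr)
      assume h: "\<not> h \<le> 1"
      let ?F = "PiE {..<h} (\<lambda>_. pverts G)"
      let ?T = "{x \<in> ?F. inj_on x {..<h} \<and> all_rel (edge_rel h e H G) (pairs {..<h}) x}"
      obtain y where y: "y \<in> pverts G" using False cG by fastforce
      have "\<not> inj_on (\<lambda>j\<in>{..<h}. y) {..<h}"
        using h inj_onD[of "\<lambda>j\<in>{..<h}. y" "{..<h}" 0 1] by auto
      then have "(\<lambda>j\<in>{..<h}. y) \<in> ?F - ?T" using y by auto
      then have "?T \<subset> ?F" by blast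
      then have "card ?T < card ?F" using finV by (intro psubset_card_mono finite_PiE) auto
      also have "card ?F = N ^ h" using cG by (simp add: card_PiE)
      finally have "card (copies H G) < N ^ h" using card_copies_le[OF H G e] by linarith
      then have "real (card (copies H G)) < real N ^ h" by (metis of_nat_less_iff of_nat_power)
      also have "\<dots> \<le> \<gamma> * real N ^ h" using \<gamma> by (simp add: mult_le_cancel_right1)
      finally show False using copies by (simp add: h_def)
    qed
    then have uniq: "v = w" if "v \<in> pverts H" "w \<in> pverts H" for v w
      using that finV card_le_Suc0_iff_eq[of "pverts H"] by (simp add: h_def)
    have "contains_copy G (blowup H N)"
    proof (rule contains_blowup[OF H G, where B = "\<lambda>_. pverts G"])
      show "(a, b) \<in> parcs G" if "(v, w) \<in> parcs H" for v w a b
        using that uniq[of v w] H.in_arcsD1 H.in_arcsD2 H.no_loops' by auto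
    qed (use cG uniq in auto)
    moreover have "log 2 (real N) \<le> real N"
    proof -
      have "real N \<le> 2 ^ N" by (metis less_exp less_imp_le of_nat_le_iff of_nat_numeral of_nat_power)
      then show ?thesis using False by (simp add: log_le_iff powr_realpow)
    qed
    ultimately show ?thesis by auto
  qed
qed

lemma blowup_const_ge: "0 < c \<Longrightarrow> forces_blowup H \<gamma> c \<Longrightarrow> ereal c \<le> blowup_const H \<gamma>"
  unfolding blowup_const_def by (rule SUP_upper) simp

text \<open>The error term is arbitrary on finitely many \<open>N\<close>, so it cancels
  \<open>c\<close> below \<open>N0\<close>, where the empty blowup suffices.\<close>

lemma forces_blowup_eventually:
  assumes H: "pair_graph H"
    and ev: "\<And>N G. N0 \<le> N \<Longrightarrow> many_copies H \<gamma> N G \<Longrightarrow>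
      \<exists>t. c * log 2 (real N) \<le> real t \<and> contains_copy G (blowup H t)"
  shows "forces_blowup H \<gamma> c"
  unfolding forces_blowup_def
proof (intro exI[of _ "\<lambda>N. if N < N0 then c else 0"] conjI allI impI)
  have "\<forall>\<^sub>F N in sequentially. (if N < N0 then c else 0) = 0"
    using eventually_ge_at_top[of N0] by eventually_elim simp
  then show "(\<lambda>N. if N < N0 then c else 0) \<longlonglongrightarrow> 0" by (rule tendsto_eventually)
  fix N and G :: "nat pair_pre_digraph" assume mc: "many_copies H \<gamma> N G"
  show "\<exists>t. (c - (if N < N0 then c else 0)) * log 2 (real N) \<le> real t \<and> contains_copy G (blowup H t)"
  proof (cases "N < N0")
    case True
    then show ?thesis using contains_blowup_0[OF H, of G] mc
      by (intro exI[of _ 0]) (simp add: many_copies_def)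
  next
    case False
    then show ?thesis using ev[OF _ mc] by simp
  qed
qed

text \<open>So far only one factor \<open>ln (1 / \<gamma>)\<close> was lost; the second is given
  away here. Values of \<gamma> above \<open>1 / 2\<close> are reduced to \<open>1 / 2\<close> by
  monotonicity. Then \<delta> must depend on \<gamma>0, because the claimed bound blows up as
  \<gamma> tends to 1.\<close>

lemma large_blowup:
  fixes H :: "'a pair_pre_digraph"
  assumes H: "pair_graph H" and \<gamma>0: "\<gamma>0 < 1"
  shows "\<exists>\<delta>>0. \<forall>\<gamma>::real. 0 < \<gamma> \<and> \<gamma> \<le> \<gamma>0 \<longrightarrow> (\<exists>N0. \<forall>N\<ge>N0. \<forall>G. many_copies H \<gamma> N G \<longrightarrow>
    (\<exists>t. \<delta> * sqrt \<gamma> / (log 2 (1 / \<gamma>))\<^sup>2 * log 2 (real N) \<le> real t \<and> contains_copy G (blowup H t)))"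
proof (cases "0 < \<gamma>0")
  case False
  then show ?thesis by (intro exI[of _ 1]) auto
next
  case pos: True
  obtain c where c: "0 < c" and blow: "\<And>\<gamma>. 0 < \<gamma> \<Longrightarrow> \<gamma> \<le> 1 / 2 \<Longrightarrow> \<exists>N0. \<forall>N\<ge>N0. \<forall>G. many_copies H \<gamma> N G \<longrightarrow>
    (\<exists>t. c * sqrt \<gamma> / ln (1 / \<gamma>) * ln (real N) \<le> real t \<and> contains_copy G (blowup H t))"
    using many_copies_blowup[OF H] by blast
  define l where "l = ln (1 / \<gamma>0)"
  have l: "0 < l" using pos \<gamma>0 by (simp add: l_def)
  have ln2: "0 < ln (2::real)" "ln (2::real) \<le> 1" using ln_le_minus_one[of "2::real"] by auto
  \<comment> \<open>The second entry serves \<open>\<gamma> > 1 / 2\<close>, where \<open>L\<close>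
    is only known to be at least \<open>l\<close>.\<close>
  define \<delta> where "\<delta> = min c (c * l\<^sup>2 / 2)"
  have \<delta>: "0 < \<delta>" using c l by (simp add: \<delta>_def)
  show ?thesis
  proof (intro exI[of _ \<delta>] conjI \<delta> allI impI)
    fix \<gamma> :: real assume \<gamma>: "0 < \<gamma> \<and> \<gamma> \<le> \<gamma>0"
    define \<gamma>' where "\<gamma>' = min \<gamma> (1 / 2)"
    have \<gamma>': "0 < \<gamma>'" "\<gamma>' \<le> 1 / 2" "\<gamma>' \<le> \<gamma>" using \<gamma> by (auto simp: \<gamma>'_def)
    define L where "L = ln (1 / \<gamma>)"
    have "l \<le> L" unfolding l_def L_def using \<gamma> pos by (intro ln_mono) (auto simp: field_simps)
    then have L: "0 < L" "l \<le> L" using l by auto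
    obtain N0 where N0: "\<forall>N\<ge>N0. \<forall>G. many_copies H \<gamma>' N G \<longrightarrow>
      (\<exists>t. c * sqrt \<gamma>' / ln (1 / \<gamma>') * ln (real N) \<le> real t \<and> contains_copy G (blowup H t))"
      using blow[OF \<gamma>'(1,2)] by blast
    have coef: "\<delta> * sqrt \<gamma> * ln 2 / L\<^sup>2 \<le> c * sqrt \<gamma>' / ln (1 / \<gamma>')"
    proof (cases "\<gamma> \<le> 1 / 2")
      case True
      have "ln 2 \<le> L" unfolding L_def using True \<gamma> by (intro ln_mono) (auto simp: field_simps)
      have "\<delta> * sqrt \<gamma> * ln 2 / L\<^sup>2 \<le> c * sqrt \<gamma> * L / L\<^sup>2"
        using \<open>ln 2 \<le> L\<close> \<gamma> c ln2 \<delta> by (intro divide_right_mono mult_mono) (auto simp: \<delta>_def)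
      also have "\<dots> = c * sqrt \<gamma> / L" using L by (simp add: power2_eq_square)
      finally show ?thesis using True by (simp add: \<gamma>'_def L_def)
    next
      case False
      have "sqrt \<gamma> \<le> 1" using \<gamma> \<gamma>0 by simp
      then have "\<delta> * sqrt \<gamma> * ln 2 / L\<^sup>2 \<le> (c * l\<^sup>2 / 2) * 1 * 1 / l\<^sup>2"
        using \<gamma> c ln2 \<delta> l L by (intro frac_le mult_mono power_mono) (auto simp: \<delta>_def)
      also have "\<dots> = c * (1 / 2) / 1" using l by simp
      also have "\<dots> \<le> c * sqrt (1 / 2) / ln 2"
      proof -
        have "1 / 2 \<le> sqrt (1 / 2 :: real)" by (rule real_le_rsqrt) (simp add: power2_eq_square)
        then show ?thesis using c ln2 by (intro frac_le mult_left_mono) auto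
      qed
      finally show ?thesis using False by (simp add: \<gamma>'_def)
    qed
    show "\<exists>N0. \<forall>N\<ge>N0. \<forall>G. many_copies H \<gamma> N G \<longrightarrow>
      (\<exists>t. \<delta> * sqrt \<gamma> / (log 2 (1 / \<gamma>))\<^sup>2 * log 2 (real N) \<le> real t \<and> contains_copy G (blowup H t))"
    proof (rule exI[of _ "max 1 N0"], intro allI impI)
      fix N and G :: "nat pair_pre_digraph" assume N: "max 1 N0 \<le> N" and mc: "many_copies H \<gamma> N G"
      obtain t where t: "c * sqrt \<gamma>' / ln (1 / \<gamma>') * ln (real N) \<le> real t" "contains_copy G (blowup H t)"
        using N0 N many_copies_mono[OF mc \<gamma>'(3)] by auto
      have "\<delta> * sqrt \<gamma> / (log 2 (1 / \<gamma>))\<^sup>2 * log 2 (real N) = \<delta> * sqrt \<gamma> * ln 2 / L\<^sup>2 * ln (real N)"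
        using ln2 by (simp add: log_def L_def power2_eq_square)
      also have "\<dots> \<le> c * sqrt \<gamma>' / ln (1 / \<gamma>') * ln (real N)"
        using coef N by (intro mult_right_mono) auto
      finally show "\<exists>t. \<delta> * sqrt \<gamma> / (log 2 (1 / \<gamma>))\<^sup>2 * log 2 (real N) \<le> real t \<and> contains_copy G (blowup H t)"
        using t by (intro exI[of _ t] conjI) auto
    qed
  qed
qed

theorem theorem1p2:
  fixes H :: "'a pair_pre_digraph"
  assumes "pair_graph H"
  shows "(\<exists>e :: real \<Rightarrow> real. (e \<longlongrightarrow> 0) (at_right 0) \<and>
           (\<forall>\<gamma> > 0. blowup_const H \<gamma> \<ge> ereal (\<gamma> powr (1/2 + e \<gamma>)))) \<and>
         (\<forall>\<gamma>\<^sub>0 < 1. \<exists>\<delta> > 0. \<forall>\<gamma> :: real. 0 < \<gamma> \<and> \<gamma> \<le> \<gamma>\<^sub>0 \<longrightarrow>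
           (\<exists>N\<^sub>0. \<forall>N \<ge> N\<^sub>0. \<forall>G. many_copies H \<gamma> N G \<longrightarrow>
             (\<exists>t :: nat. real t \<ge> \<delta> * sqrt \<gamma> / (log 2 (1 / \<gamma>))\<^sup>2 * log 2 (real N) \<and>
                         contains_copy G (blowup H t))))"
proof (rule conjI)
  have bound: "\<exists>\<delta>>0. \<forall>\<gamma>. 0 < \<gamma> \<longrightarrow> \<gamma> \<le> \<gamma>0 \<longrightarrow> ereal (\<delta> * sqrt \<gamma> / (log 2 (1 / \<gamma>))\<^sup>2) \<le> blowup_const H \<gamma>"
    if lt: "\<gamma>0 < 1" for \<gamma>0
  proof -
    obtain \<delta> where \<delta>: "0 < \<delta>" "\<And>\<gamma>. 0 < \<gamma> \<and> \<gamma> \<le> \<gamma>0 \<Longrightarrow> \<exists>N0. \<forall>N\<ge>N0. \<forall>G. many_copies H \<gamma> N G \<longrightarrow>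
      (\<exists>t. \<delta> * sqrt \<gamma> / (log 2 (1 / \<gamma>))\<^sup>2 * log 2 (real N) \<le> real t \<and> contains_copy G (blowup H t))"
      using large_blowup[OF assms lt] by blast
    have "ereal (\<delta> * sqrt \<gamma> / (log 2 (1 / \<gamma>))\<^sup>2) \<le> blowup_const H \<gamma>" if \<gamma>: "0 < \<gamma>" "\<gamma> \<le> \<gamma>0" for \<gamma>
    proof (rule blowup_const_ge)
      have "log 2 (1 / \<gamma>) \<noteq> 0" using \<gamma> \<open>\<gamma>0 < 1\<close> by (simp add: log_def)
      then show "0 < \<delta> * sqrt \<gamma> / (log 2 (1 / \<gamma>))\<^sup>2" using \<delta>(1) \<gamma> by simp
      obtain N0 where "\<forall>N\<ge>N0. \<forall>G. many_copies H \<gamma> N G \<longrightarrow>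
        (\<exists>t. \<delta> * sqrt \<gamma> / (log 2 (1 / \<gamma>))\<^sup>2 * log 2 (real N) \<le> real t \<and> contains_copy G (blowup H t))"
        using \<delta>(2) \<gamma> by blast
      then show "forces_blowup H \<gamma> (\<delta> * sqrt \<gamma> / (log 2 (1 / \<gamma>))\<^sup>2)"
        by (intro forces_blowup_eventually[OF assms, of N0]) blast
    qed
    with \<delta>(1) show ?thesis by blast
  qed
  obtain \<delta> where \<delta>: "0 < \<delta>"
    "\<And>\<gamma>. 0 < \<gamma> \<Longrightarrow> \<gamma> \<le> 1 / 2 \<Longrightarrow> ereal (\<delta> * sqrt \<gamma> / (log 2 (1 / \<gamma>))\<^sup>2) \<le> blowup_const H \<gamma>"
    using bound[of "1 / 2"] by auto
  \<comment> \<open>The explicit bound determines the limit of the exponent at 0; between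
    \<open>1 / 2\<close> and 1 any positive lower bound will do.\<close>
  define D where "D \<gamma> = (if \<gamma> \<le> 1 / 2 then \<delta> * sqrt \<gamma> / (log 2 (1 / \<gamma>))\<^sup>2
      else SOME d. 0 < d \<and> ereal d \<le> blowup_const H \<gamma>)" for \<gamma>
  have D: "0 < D \<gamma> \<and> ereal (D \<gamma>) \<le> blowup_const H \<gamma>" if \<gamma>: "0 < \<gamma>" "\<gamma> < 1" for \<gamma>
  proof (cases "\<gamma> \<le> 1 / 2")
    case True
    have "log 2 (1 / \<gamma>) \<noteq> 0" using \<gamma> by (simp add: log_def)
    then show ?thesis using True \<delta>(1) \<delta>(2)[OF \<gamma>(1) True] \<gamma> by (simp add: D_def)
  next
    case False
    obtain \<delta>' where "0 < \<delta>'" "ereal (\<delta>' * sqrt \<gamma> / (log 2 (1 / \<gamma>))\<^sup>2) \<le> blowup_const H \<gamma>"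
      using bound[OF \<gamma>(2)] \<gamma> by blast
    moreover have "log 2 (1 / \<gamma>) \<noteq> 0" using \<gamma> by (simp add: log_def)
    ultimately have "\<exists>d. 0 < d \<and> ereal d \<le> blowup_const H \<gamma>"
      using \<gamma> by (intro exI[of _ "\<delta>' * sqrt \<gamma> / (log 2 (1 / \<gamma>))\<^sup>2"]) simp
    then show ?thesis using False someI_ex[of "\<lambda>d. 0 < d \<and> ereal d \<le> blowup_const H \<gamma>"] by (simp add: D_def)
  qed
  \<comment> \<open>The solution of \<open>\<gamma> powr (1 / 2 + e \<gamma>) = D \<gamma>\<close>
    for \<open>\<gamma> < 1\<close>. For \<open>\<gamma> \<ge> 1\<close> the exponent becomes 0 and
    the power 1, the case of \<open>forces_blowup_dense\<close>.\<close>
  define e where "e \<gamma> = (if \<gamma> < 1 then ln (D \<gamma>) / ln \<gamma> - 1 / 2 else - 1 / 2)" for \<gamma>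
  show "\<exists>e :: real \<Rightarrow> real. (e \<longlongrightarrow> 0) (at_right 0) \<and> (\<forall>\<gamma>>0. ereal (\<gamma> powr (1 / 2 + e \<gamma>)) \<le> blowup_const H \<gamma>)"
  proof (intro exI[of _ e] conjI allI impI)
    have ev: "\<forall>\<^sub>F \<gamma> :: real in at_right 0. \<gamma> \<in> {0<..<1 / 2}"
      by (rule eventually_at_right_real) simp
    have lim: "filterlim (\<lambda>\<gamma>::real. - ln \<gamma>) at_top (at_right 0)"
      using ln_at_0 by (simp add: filterlim_uminus_at_top)
    \<comment> \<open>With \<open>x = - ln \<gamma>\<close>, the term \<open>2 * ln x / x\<close>
      stems from the squared logarithm in the bound, and the other is a constant over
      \<open>x\<close>.\<close>
    have "((\<lambda>\<gamma>. 2 * (ln (- ln \<gamma>) / - ln \<gamma>) + (ln \<delta> + 2 * ln (ln 2)) * - inverse (- ln \<gamma>))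
        \<longlongrightarrow> 2 * 0 + (ln \<delta> + 2 * ln (ln 2)) * - 0) (at_right 0)"
      by (intro tendsto_intros filterlim_compose[OF ln_x_over_x_tendsto_0 lim]
          filterlim_compose[OF tendsto_inverse_0_at_top[OF filterlim_ident] lim])
    then have "((\<lambda>\<gamma>. 2 * (ln (- ln \<gamma>) / - ln \<gamma>) + (ln \<delta> + 2 * ln (ln 2)) * - inverse (- ln \<gamma>)) \<longlongrightarrow> 0) (at_right 0)"
      by simp
    moreover have "\<forall>\<^sub>F \<gamma> in at_right 0.
        2 * (ln (- ln \<gamma>) / - ln \<gamma>) + (ln \<delta> + 2 * ln (ln 2)) * - inverse (- ln \<gamma>) = e \<gamma>"
      using ev
    proof eventually_elim
      case (elim \<gamma>)
      define x where "x = - ln \<gamma>"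
      have x: "0 < x" and ln\<gamma>: "ln \<gamma> = - x" using elim by (auto simp: x_def)
      have lg: "log 2 (1 / \<gamma>) = x / ln 2" using elim by (simp add: log_def x_def ln_div)
      have lnD: "ln (D \<gamma>) = ln \<delta> - x / 2 - 2 * (ln x - ln (ln 2))"
        using elim \<delta>(1) x by (simp add: D_def lg ln_mult ln_div ln_sqrt ln_realpow ln\<gamma>)
      show ?case using elim x by (simp add: e_def ln\<gamma> lnD field_simps)
    qed
    ultimately show "(e \<longlongrightarrow> 0) (at_right 0)" by (rule Lim_transform_eventually)
    fix \<gamma> :: real assume \<gamma>: "0 < \<gamma>"
    show "ereal (\<gamma> powr (1 / 2 + e \<gamma>)) \<le> blowup_const H \<gamma>"
    proof (cases "\<gamma> < 1")
      case True
      then have "\<gamma> powr (1 / 2 + e \<gamma>) = D \<gamma>" using \<gamma> D[OF \<gamma> True] by (simp add: e_def powr_def)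
      then show ?thesis using D[OF \<gamma> True] by simp
    next
      case False
      then have "ereal 1 \<le> blowup_const H \<gamma>"
        using forces_blowup_dense[OF assms, of \<gamma>] by (intro blowup_const_ge) auto
      then show ?thesis using False \<gamma> by (simp add: e_def)
    qed
  qed
  show "\<forall>\<gamma>\<^sub>0 < 1. \<exists>\<delta> > 0. \<forall>\<gamma> :: real. 0 < \<gamma> \<and> \<gamma> \<le> \<gamma>\<^sub>0 \<longrightarrow>
           (\<exists>N\<^sub>0. \<forall>N \<ge> N\<^sub>0. \<forall>G. many_copies H \<gamma> N G \<longrightarrow>
             (\<exists>t :: nat. real t \<ge> \<delta> * sqrt \<gamma> / (log 2 (1 / \<gamma>))\<^sup>2 * log 2 (real N) \<and>
                         contains_copy G (blowup H t)))"
    using large_blowup[OF assms] by blast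
qed

end
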